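(* Fix $0<\nu<2$ and an integer $n\ge 1$. Let $E$ be a nonpolynomial even real entire function of order at most one such that $\mathcal Z(E)\subseteq S_{\mathfrak h_{n,\nu}}$. Suppose that all zeros of $\mathscr M_{E,\nu}(y^n)$ and of $\mathscr M_{E,\nu}(y^{n+1})$ are simple and lie in $(0,4)$. Then the two zero sets strictly interlace.
   Context: An entire function $H$ is called real if $H(\overline u)=\overline{H(u)}$. $\mathcal Z(H)$ is the zero set of $H$, and $S_h=\{u\in\mathbb C: |\operatorname{Re} u|\le h\}$. For $n\ge1$ and $0<\nu<2$, $$\mathfrak e_{n,\nu}=\frac{n(n+1)(2-\nu)}{2n+\nu},\qquad \mathfrak h_{n,\nu}=\min\left\{1,\sqrt{\tfrac14+\mathfrak e_{n,\nu}}\right\}.$$ Jacobi multiplier: let $$\mathscr J_\nu=y(y-4)\frac{d^2}{dy^2}+(2y-4\nu)\frac{d}{dy},$$ and for $r\ge 0$ let $\mathsf P_r^{(\nu)}\in\mathbb R[y]$ be its unique monic eigenpolynomial of degree $r$, with $\mathscr J_\nu\mathsf P_r^{(\nu)}=r(r+1)\mathsf P_r^{(\nu)}$. The linear operator $\mathscr M_{E,\nu}:\mathbb R[y]\to\mathbb R[y]$ is defined by $\mathscr M_{E,\nu}\mathsf P_r^{(\nu)}=E(r+1/2)\,\mathsf P_r^{(\nu)}$ for all $r\ge 0$. Two finite sets of distinct real points strictly interlace if they are disjoint and, when their union is listed in increasing order, the entries come alternately from the two sets (so the cardinalities differ by at most one). *)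

theory Defs
  imports "HOL-Complex_Analysis.Complex_Analysis" "HOL-Computational_Algebra.Polynomial"
begin

section \<open>Entire functions\<close>

definition real_entire :: "(complex \<Rightarrow> complex) \<Rightarrow> bool" where
  "real_entire H \<longleftrightarrow> H holomorphic_on UNIV \<and> (\<forall>u. H (cnj u) = cnj (H u))"

text \<open>The order of growth: the infimum of all exponents \<open>\<rho> \<ge> 0\<close> for which
  \<open>H z = O(exp (|z|\<^sup>\<rho>))\<close> as \<open>z \<rightarrow> \<infinity>\<close>; it is \<open>\<infinity>\<close> if there is no such exponent.\<close>

definition entire_order :: "(complex \<Rightarrow> complex) \<Rightarrow> ereal" where
  "entire_order H = (INF \<rho>\<in>{\<rho>::real. 0 \<le> \<rho> \<and>
     (\<lambda>z. norm (H z)) \<in> O[at_infinity](\<lambda>z. exp (norm z powr \<rho>))}. ereal \<rho>)"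

definition polynomial_fun :: "(complex \<Rightarrow> complex) \<Rightarrow> bool" where
  "polynomial_fun H \<longleftrightarrow> (\<exists>p. H = poly p)"

definition zero_set :: "(complex \<Rightarrow> complex) \<Rightarrow> complex set" where
  "zero_set H = {u. H u = 0}"

definition strip :: "real \<Rightarrow> complex set" where
  "strip h = {u. \<bar>Re u\<bar> \<le> h}"

definition e_const :: "nat \<Rightarrow> real \<Rightarrow> real" where
  "e_const n \<nu> = real n * (real n + 1) * (2 - \<nu>) / (2 * real n + \<nu>)"

definition h_const :: "nat \<Rightarrow> real \<Rightarrow> real" where
  "h_const n \<nu> = min 1 (sqrt (1 / 4 + e_const n \<nu>))"

section \<open>The Jacobi multiplier\<close>

definition jacobi_op :: "real \<Rightarrow> real poly \<Rightarrow> real poly" where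
  "jacobi_op \<nu> p = [:0, - 4, 1:] * pderiv (pderiv p) + [:- 4 * \<nu>, 2:] * pderiv p"

definition jacobi_P :: "real \<Rightarrow> nat \<Rightarrow> real poly" where
  "jacobi_P \<nu> r = (THE p. degree p = r \<and> lead_coeff p = 1 \<and>
     jacobi_op \<nu> p = smult (real r * (real r + 1)) p)"

text \<open>For a real entire \<open>E\<close> the values \<open>E (r + 1/2)\<close> are real, so that \<open>Re\<close> below only adapts the
  type. That both definite descriptions are well-defined is shown in \<open>jacobi_P_unique\<close> and
  \<open>jacobi_multiplier_unique\<close>.\<close>

definition jacobi_multiplier ::
    "(complex \<Rightarrow> complex) \<Rightarrow> real \<Rightarrow> real poly \<Rightarrow> real poly" where
  "jacobi_multiplier E \<nu> = (THE T. Vector_Spaces.linear smult smult T \<and>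
     (\<forall>r. T (jacobi_P \<nu> r) = smult (Re (E (of_nat r + 1 / 2))) (jacobi_P \<nu> r)))"

section \<open>Zeros and interlacing\<close>

text \<open>All complex zeros are meant. The predicate fails for the zero polynomial, which also has
  nonreal zeros.\<close>

definition zeros_simple_in :: "real poly \<Rightarrow> real set \<Rightarrow> bool" where
  "zeros_simple_in p A \<longleftrightarrow> (\<forall>z. poly (map_poly complex_of_real p) z = 0 \<longrightarrow>
     order z (map_poly complex_of_real p) = 1 \<and> z \<in> complex_of_real ` A)"

definition strictly_interlace :: "real set \<Rightarrow> real set \<Rightarrow> bool" where
  "strictly_interlace A B \<longleftrightarrow> finite A \<and> finite B \<and> A \<inter> B = {} \<and>
     (let xs = sorted_list_of_set (A \<union> B) in
       \<forall>i. Suc i < length xs \<longrightarrow> (xs ! i \<in> A \<longleftrightarrow> xs ! Suc i \<in> B))"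

section \<open>Well-definedness\<close>

lemma coeff_jacobi_op:
  "coeff (jacobi_op \<nu> p) k = real k * (real k + 1) * coeff p k
     - (real k + 1) * (4 * real k + 4 * \<nu>) * coeff p (Suc k)"
proof (cases k)
  case 0
  then show ?thesis by (simp add: jacobi_op_def coeff_pCons coeff_pderiv)
next
  case (Suc m)
  then show ?thesis
    by (cases m) (simp_all add: jacobi_op_def coeff_pCons coeff_pderiv algebra_simps)
qed

lemma eigenvalue_inj:
  "real k * (real k + 1) = real r * (real r + 1) \<longleftrightarrow> k = r"
proof
  assume "real k * (real k + 1) = real r * (real r + 1)"
  then have "(real k - real r) * (real k + real r + 1) = 0" by (simp add: algebra_simps)
  moreover have "real k + real r + 1 \<noteq> 0" by linarith
  ultimately show "k = r" by simp
qed simp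

lemma jacobi_P_unique:
  "\<exists>!p. degree p = r \<and> lead_coeff p = 1 \<and> jacobi_op \<nu> p = smult (real r * (real r + 1)) p"
proof (rule ex_ex1I)
  let ?q = "\<lambda>j. (real j + 1) * (4 * real j + 4 * \<nu>) /
    (real j * (real j + 1) - real r * (real r + 1))"
  define c where "c k = (\<Prod>j\<in>{k..<r}. ?q j)" for k
  define p where "p = (\<Sum>k\<le>r. monom (c k) k)"
  have cf: "coeff p k = (if k \<le> r then c k else 0)" for k
    by (simp add: p_def coeff_sum)
  have cr: "c r = 1" by (simp add: c_def)
  have "degree p \<le> r" by (rule degree_le) (simp add: cf)
  moreover have "degree p \<ge> r" by (rule le_degree) (simp add: cf cr)
  ultimately have d: "degree p = r" by simp
  have "coeff (jacobi_op \<nu> p) k = coeff (smult (real r * (real r + 1)) p) k" for k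
  proof (cases "k < r")
    case True
    then have "real k * (real k + 1) - real r * (real r + 1) \<noteq> 0"
      using eigenvalue_inj[of k r] by auto
    moreover have "c k = ?q k * c (Suc k)"
      using True by (simp add: c_def prod.atLeast_Suc_lessThan)
    ultimately show ?thesis
      using True by (simp add: coeff_jacobi_op cf field_simps)
  qed (auto simp: coeff_jacobi_op cf not_less le_less)
  then have "jacobi_op \<nu> p = smult (real r * (real r + 1)) p" by (rule poly_eqI)
  with d show "\<exists>p. degree p = r \<and> lead_coeff p = 1 \<and>
      jacobi_op \<nu> p = smult (real r * (real r + 1)) p"
    by (intro exI[of _ p]) (simp add: cf cr)
next
  fix p q
  assume p: "degree p = r \<and> lead_coeff p = 1 \<and> jacobi_op \<nu> p = smult (real r * (real r + 1)) p"
    and q: "degree q = r \<and> lead_coeff q = 1 \<and> jacobi_op \<nu> q = smult (real r * (real r + 1)) q"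
  show "p = q"
  proof (rule ccontr)
    assume "p \<noteq> q"
    then have nz: "p - q \<noteq> 0" by simp
    have "jacobi_op \<nu> (p - q) = jacobi_op \<nu> p - jacobi_op \<nu> q"
      by (rule poly_eqI) (simp add: coeff_jacobi_op algebra_simps)
    then have eq: "jacobi_op \<nu> (p - q) = smult (real r * (real r + 1)) (p - q)"
      using p q by (simp add: smult_diff_right)
    let ?m = "degree (p - q)"
    have "coeff (p - q) (Suc ?m) = 0" by (rule coeff_eq_0) simp
    with arg_cong[OF eq, of "\<lambda>x. coeff x ?m"] 
    have "real ?m * (real ?m + 1) * coeff (p - q) ?m = real r * (real r + 1) * coeff (p - q) ?m"
      unfolding coeff_jacobi_op by simp
    moreover have l: "coeff (p - q) ?m \<noteq> 0" using nz by (simp only: leading_coeff_0_iff not_False_eq_True)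
    ultimately have "?m = r" using eigenvalue_inj by (metis mult_right_cancel)
    with l p q show False by (metis coeff_diff diff_self)
  qed
qed

lemma jacobi_P:
  shows degree_jacobi_P: "degree (jacobi_P \<nu> r) = r"
    and lead_coeff_jacobi_P: "coeff (jacobi_P \<nu> r) r = 1"
    and jacobi_op_jacobi_P:
      "jacobi_op \<nu> (jacobi_P \<nu> r) = smult (real r * (real r + 1)) (jacobi_P \<nu> r)"
  using theI'[OF jacobi_P_unique[of r \<nu>]] unfolding jacobi_P_def[symmetric] by auto

lemma vector_space_smult: "vector_space (smult :: real \<Rightarrow> real poly \<Rightarrow> real poly)"
  by unfold_locales (simp_all add: smult_add_right smult_add_left)

lemma jacobi_multiplier_unique:
  fixes E :: "complex \<Rightarrow> complex"
  shows "\<exists>!T. Vector_Spaces.linear smult smult T \<and>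
     (\<forall>r. T (jacobi_P \<nu> r) = smult (Re (E (of_nat r + 1 / 2))) (jacobi_P \<nu> r))"
proof -
  interpret V: vector_space "smult :: real \<Rightarrow> real poly \<Rightarrow> real poly"
    by (rule vector_space_smult)
  interpret VV: vector_space_pair "smult :: real \<Rightarrow> real poly \<Rightarrow> real poly"
      "smult :: real \<Rightarrow> real poly \<Rightarrow> real poly"
    by unfold_locales
  let ?B = "range (jacobi_P \<nu>)"
  have indep: "V.independent ?B"
  proof
    assume "V.dependent ?B"
    then obtain t u where t: "finite t" "t \<subseteq> ?B" and z: "(\<Sum>v\<in>t. smult (u v) v) = 0"
      and ex: "\<exists>v\<in>t. u v \<noteq> 0"
      unfolding V.dependent_explicit by blast
    let ?S = "{v\<in>t. u v \<noteq> 0}"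
    have fS: "finite ?S" "?S \<noteq> {}" using t ex by auto
    then have "Max (degree ` ?S) \<in> degree ` ?S" by (intro Max_in) auto
    then obtain v where v: "v \<in> ?S" and mx: "degree v = Max (degree ` ?S)" by auto
    have B: "w = jacobi_P \<nu> (degree w)" if "w \<in> t" for w
      using that t(2) by (auto simp: degree_jacobi_P)
    have "smult (u w) w = 0 \<or> degree w < degree v" if "w \<in> t" "w \<noteq> v" for w
    proof (cases "u w = 0")
      case False
      then have "degree w \<le> degree v" using that fS mx by auto
      moreover have "degree w \<noteq> degree v" using B[of w] B[of v] that v by auto
      ultimately show ?thesis by simp
    qed simp
    then have o: "u w * coeff w (degree v) = 0" if "w \<in> t - {v}" for w
      using that by (metis DiffE coeff_eq_0 insertI1 mult_zero_left mult_zero_right smult_eq_0_iff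
          coeff_0)
    have "0 = (\<Sum>w\<in>t. u w * coeff w (degree v))"
      using arg_cong[OF z, of "\<lambda>p. coeff p (degree v)"] by (simp add: coeff_sum)
    also have "\<dots> = u v * coeff v (degree v)"
      using t(1) v sum.neutral[of "t - {v}", OF ballI, OF o] by (subst sum.remove[of _ v]) auto
    finally have "0 = u v * coeff v (degree v)" .
    moreover have "coeff v (degree v) = 1"
      using B[of v] lead_coeff_jacobi_P[of \<nu> "degree v"] v by auto
    ultimately show False using v by simp
  qed
  have span: "p \<in> V.span ?B" for p
  proof (induction "degree p" arbitrary: p rule: less_induct)
    case less
    let ?n = "degree p"
    let ?q = "p - smult (lead_coeff p) (jacobi_P \<nu> ?n)"
    have b: "smult (lead_coeff p) (jacobi_P \<nu> ?n) \<in> V.span ?B"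
      by (intro V.span_scale V.span_base) auto
    have c: "coeff ?q ?n = 0" by (simp add: lead_coeff_jacobi_P)
    have dq: "degree ?q \<le> ?n"
      by (intro degree_diff_le) (auto intro: order_trans[OF degree_smult_le] simp: degree_jacobi_P)
    have "?q \<in> V.span ?B"
    proof (cases "?q = 0")
      case True
      then show ?thesis by (metis V.span_zero)
    next
      case False
      then have "degree ?q \<noteq> ?n" using c by (metis leading_coeff_0_iff)
      then show ?thesis using dq by (intro less) simp
    qed
    from V.span_add[OF this b] show ?case by simp
  qed
  obtain T where T: "Vector_Spaces.linear smult smult T"
    "\<forall>x\<in>?B. T x = smult (Re (E (of_nat (degree x) + 1 / 2))) x"
    using VV.linear_independent_extend[OF indep,
        of "\<lambda>x. smult (Re (E (of_nat (degree x) + 1 / 2))) x"] by blast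
  show ?thesis
  proof (rule ex1I[of _ T])
    show "Vector_Spaces.linear smult smult T \<and>
        (\<forall>r. T (jacobi_P \<nu> r) = smult (Re (E (of_nat r + 1 / 2))) (jacobi_P \<nu> r))"
      using T by (simp add: degree_jacobi_P)
    fix S :: "real poly \<Rightarrow> real poly"
    assume S: "Vector_Spaces.linear smult smult S \<and>
        (\<forall>r. S (jacobi_P \<nu> r) = smult (Re (E (of_nat r + 1 / 2))) (jacobi_P \<nu> r))"
    show "S = T"
    proof
      fix p
      show "S p = T p"
        by (rule VV.linear_eq_on[of S T p ?B]) (use S T span in \<open>auto simp: degree_jacobi_P\<close>)
    qed
  qed
qed

end

theory Submission
  imports Defs
begin

text \<open>
  Let \<open>X = J + 1/4\<close>, so that the multiplier is \<open>M = E (sqrt X)\<close>, and let \<open>p = M y\<^sup>n\<close>, \<open>q = M y\<^sup>n\<^sup>+\<^sup>1\<close>. By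
  Rolle's theorem the zeros interlace as soon as the Wronskian \<open>q' p - q p'\<close> has no zero in \<open>(0, 4)\<close>. At
  such a zero some \<open>\<alpha> q + \<beta> p\<close> of degree at most \<open>n + 1\<close> would have a double zero, hence fewer than
  \<open>n\<close> sign changes in \<open>(0, 4)\<close>. But \<open>M (\<alpha> y\<^sup>n\<^sup>+\<^sup>1 + \<beta> y\<^sup>n)\<close> always has at least \<open>n\<close>: counting zeros at 0 together with
  sign changes in \<open>(0, 4)\<close>, a factor \<open>X - t\<close> of \<open>M\<close> with \<open>t = \<rho>\<^sup>2\<close>, \<open>E \<rho> = 0\<close>, never lowers the count.

  For real \<open>t \<le> 1/4\<close> this follows from Rolle's theorem, because \<open>X y = t y\<close> has a positive solution.
  Conjugate pairs, and pairs of numbers in \<open>(1/4, 1]\<close>, are treated by factoring the fourth-order operator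
  into first-order ones. This requires a regular solution \<open>v\<close> without zeros; it exists because all Taylor
  coefficients of \<open>Im y\<^sub>t\<close>, where \<open>X y\<^sub>t = t y\<^sub>t\<close>, have the same sign for \<open>|Re \<rho>| \<le> 1\<close>. At most one \<open>t\<close> in
  \<open>(1/4, 1]\<close> is left over; it is applied first, and there the constant \<open>e\<close> of the hypothesis enters.

  In place of the Hadamard product, the zeros of \<open>E\<close> in a disc are divided out; after normalization the
  remaining factor tends to 1 by the Borel--Caratheodory inequality.
\<close>

section \<open>Alternation lists and Rolle's theorem\<close>

text \<open>On monomials \<open>X\<close> is bidiagonal: X y^(k+1) = \<open>eig (k+1)\<close>
  y^(k+1) - \<open>shift_const \<nu> k\<close> y^k. Hence the regular solution of X y = t y has as
  Taylor coefficients positive multiples of the products of \<open>eig j - t\<close> over j < k. As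
  \<open>eig 0 = 1/4\<close>, none is negative for t <= 1/4, but for t in (1/4, 1] all except the
  first are negative: the solution may vanish in (0, 4), and dividing by it is no longer possible.
  This forces the grouping in pairs. Squaring maps the strip of half-width 1 onto (Im t)^2 <= 4 (1 -
  Re t), the range in which the sign argument for a conjugate pair closes. The constant e compares
  roots: (X - t) y^n and (X - t) y^(n+1) have one nonzero root each, and t <= 1/4 + e holds iff the
  first is at most the second. At 4 the exponents are 0 and \<nu> - 1, so solutions may be unbounded
  there; the fluxes s f' still have limits. Each factor trades zeros at 0 for sign changes in (0,
  4). A nonpolynomial E supplies n + 1 factors, enough to exhaust the n zeros of y^n at 0 even if a
  leftover factor trades none.\<close>

fun alternating :: "('a \<Rightarrow> real \<Rightarrow> bool) \<Rightarrow> real \<Rightarrow> 'a list \<Rightarrow> bool" where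
  "alternating Q e [] = True"
| "alternating Q e (x # xs) = (Q x e \<and> alternating Q (- e) xs)"

text \<open>A list of length L shows L - 1 sign changes, and \<open>e * (-1) ^ length xs\<close> is
  the sign demanded of an entry appended to it. This expression recurs wherever an alternation is
  continued to the endpoint 4.\<close>

lemma alternating_append:
  "alternating Q e (xs @ ys) \<longleftrightarrow> alternating Q e xs \<and> alternating Q (e * (-1) ^ length xs) ys"
  by (induction xs arbitrary: e) auto

lemma alternating_mono:
  assumes "alternating Q e xs" "\<And>x e. x \<in> set xs \<Longrightarrow> Q x e \<Longrightarrow> R x e"
  shows "alternating R e xs"
  using assms by (induction xs arbitrary: e) auto

lemma alternating_flip:
  assumes "alternating Q e xs" "\<And>x e. x \<in> set xs \<Longrightarrow> Q x e \<Longrightarrow> R x (- e)"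
  shows "alternating R (- e) xs"
  using assms
proof (induction xs arbitrary: e)
  case (Cons x xs)
  then have "alternating R (- (- e)) xs" by (metis alternating.simps(2) list.set_intros(2))
  with Cons.prems show ?case by auto
qed auto

text \<open>At the endpoints 0 and 4 only the boundary behaviour of \<open>F\<close> is tested, so that an endpoint
  where \<open>F\<close> tends to 0 fits either sign.\<close>

definition weakly_signed :: "(real \<Rightarrow> real) \<Rightarrow> real \<Rightarrow> real \<Rightarrow> bool" where
  "weakly_signed F x e \<longleftrightarrow> (if 0 < x \<and> x < 4 then 0 \<le> e * F x
     else \<forall>\<epsilon>>0. \<exists>y. 0 < y \<and> y < 4 \<and> \<bar>y - x\<bar> < \<epsilon> \<and> - \<epsilon> < e * F y)"

definition weakly_alternates :: "(real \<Rightarrow> real) \<Rightarrow> real \<Rightarrow> real list \<Rightarrow> bool" where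
  "weakly_alternates F e xs \<longleftrightarrow>
     sorted_wrt (<) xs \<and> set xs \<subseteq> {0..4} \<and> alternating (weakly_signed F) e xs"

definition alternates :: "(real \<Rightarrow> real) \<Rightarrow> real \<Rightarrow> real list \<Rightarrow> bool" where
  "alternates F e xs \<longleftrightarrow>
     sorted_wrt (<) xs \<and> set xs \<subseteq> {0<..<4} \<and> alternating (\<lambda>x e. 0 < e * F x) e xs"

text \<open>Stands in for analyticity: weak alternation of a function gives strict signs of its
  derivative only if the derivative vanishes on no interval. The property starts at a nonzero
  polynomial and passes to antiderivatives and through nonvanishing factors.\<close>

definition nowhere_null :: "(real \<Rightarrow> real) \<Rightarrow> bool" where
  "nowhere_null F \<longleftrightarrow> (\<forall>c d. 0 \<le> c \<longrightarrow> c < d \<longrightarrow> d \<le> 4 \<longrightarrow> (\<exists>y. c < y \<and> y < d \<and> F y \<noteq> 0))"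

lemma nowhere_null_mult:
  assumes "nowhere_null F" "\<And>y. 0 < y \<Longrightarrow> y < 4 \<Longrightarrow> F y \<noteq> 0 \<Longrightarrow> G y \<noteq> 0"
  shows "nowhere_null G"
  unfolding nowhere_null_def
proof (intro allI impI)
  fix c d :: real assume cd: "0 \<le> c" "c < d" "d \<le> 4"
  then obtain y where y: "c < y" "y < d" "F y \<noteq> 0" using assms(1) unfolding nowhere_null_def by blast
  then have "G y \<noteq> 0" using assms(2)[of y] cd by linarith
  with y show "\<exists>y>c. y < d \<and> G y \<noteq> 0" by blast
qed

lemma nowhere_null_antiderivative:
  assumes "nowhere_null F'"
    and D: "\<And>y. 0 < y \<Longrightarrow> y < 4 \<Longrightarrow> (F has_real_derivative F' y) (at y)"
  shows "nowhere_null F"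
  unfolding nowhere_null_def
proof (intro allI impI, rule ccontr)
  fix c d :: real assume cd: "0 \<le> c" "c < d" "d \<le> 4"
    and "\<not> (\<exists>y>c. y < d \<and> F y \<noteq> 0)"
  then have z: "F y = 0" if "y \<in> {c<..<d}" for y using that by auto
  obtain y where y: "c < y" "y < d" "F' y \<noteq> 0"
    using assms(1) cd unfolding nowhere_null_def by blast
  have "(F has_real_derivative 0) (at y)"
    by (rule has_field_derivative_transform_within_open[where f = "\<lambda>_. 0" and S = "{c<..<d}"])
      (use y z in auto)
  with D[of y] y cd show False using DERIV_unique by fastforce
qed

lemma nowhere_null_poly:
  assumes "p \<noteq> 0" shows "nowhere_null (poly p)"
  unfolding nowhere_null_def
proof (intro allI impI, rule ccontr)
  fix c d :: real assume cd: "c < d" and "\<not> (\<exists>y>c. y < d \<and> poly p y \<noteq> 0)"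
  then have "{c<..<d} \<subseteq> {y. poly p y = 0}" by auto
  then show False using poly_roots_finite[OF assms] infinite_Ioo[OF cd] finite_subset by blast
qed

text \<open>\<open>G\<close> is nondecreasing, so the sign at the left end persists. At
  \<open>x = 0\<close> there is no value to start from, merely points arbitrarily close to 0 at
  which \<open>G\<close> is hardly negative.\<close>

lemma nonneg_between:
  fixes G :: "real \<Rightarrow> real"
  assumes D: "\<And>y. 0 < y \<Longrightarrow> y < 4 \<Longrightarrow> (G has_real_derivative G' y) (at y)"
    and sg: "\<And>y. x < y \<Longrightarrow> y < x' \<Longrightarrow> 0 \<le> G' y" and x: "0 \<le> x" "x < y" "y < x'" "x' \<le> 4"
    and w: "weakly_signed G x 1"
  shows "0 \<le> G y"
proof (cases "x = 0")
  case False
  have "G x \<le> G y"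
  proof (rule DERIV_nonneg_imp_increasing_open[where f = G])
    show "x \<le> y" using x by simp
    show "\<exists>l. (G has_real_derivative l) (at t) \<and> 0 \<le> l" if "x < t" "t < y" for t
      using D[of t] sg[of t] that x by fastforce
    show "continuous_on {x..y} G"
      using D x False by (intro continuous_at_imp_continuous_on ballI DERIV_isCont[OF D]) auto
  qed
  with w x False show ?thesis by (simp add: weakly_signed_def)
next
  case True
  show ?thesis
  proof (rule ccontr)
    assume "\<not> 0 \<le> G y"
    \<comment> \<open>A negative value at \<open>y\<close> bounds \<open>G\<close> away from 0 on
      all of (0, y], so the boundary condition fails at this scale.\<close>
    then have "0 < min y (- G y)" using x True by simp
    moreover have "\<forall>\<epsilon>>0. \<exists>y. 0 < y \<and> y < 4 \<and> \<bar>y - x\<bar> < \<epsilon> \<and> - \<epsilon> < 1 * G y"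
      using w True by (simp add: weakly_signed_def)
    ultimately obtain z where z: "0 < z" "z < 4" "\<bar>z - x\<bar> < min y (- G y)"
      "- min y (- G y) < 1 * G z" by blast
    have "G z \<le> G y"
    proof (rule DERIV_nonneg_imp_nondecreasing[where f = G])
      show "\<exists>l. (G has_real_derivative l) (at t) \<and> 0 \<le> l" if "z \<le> t" "t \<le> y" for t
        using D[of t] sg[of t] that x z True by fastforce
    qed (use z True in simp)
    with z show False by linarith
  qed
qed

lemma nonpos_between:
  fixes G :: "real \<Rightarrow> real"
  assumes D: "\<And>y. 0 < y \<Longrightarrow> y < 4 \<Longrightarrow> (G has_real_derivative G' y) (at y)"
    and sg: "\<And>y. x < y \<Longrightarrow> y < x' \<Longrightarrow> 0 \<le> G' y" and x: "0 \<le> x" "x < y" "y < x'" "x' \<le> 4"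
    and w: "weakly_signed G x' (-1)"
  shows "G y \<le> 0"
proof -
  have "0 \<le> - G (4 - (4 - y))"
  proof (rule nonneg_between[where G = "\<lambda>y. - G (4 - y)" and G' = "\<lambda>y. G' (4 - y)"
        and x = "4 - x'" and x' = "4 - x"])
    show "((\<lambda>y. - G (4 - y)) has_real_derivative G' (4 - t)) (at t)" if "0 < t" "t < 4" for t
      using that by (auto intro!: derivative_eq_intros DERIV_chain2[OF D])
    show "weakly_signed (\<lambda>y. - G (4 - y)) (4 - x') 1"
      unfolding weakly_signed_def
    proof (split if_split, intro conjI impI allI)
      fix \<epsilon> :: real assume "\<not> (0 < 4 - x' \<and> 4 - x' < 4)" "0 < \<epsilon>"
      then have "x' = 4" using x by auto
      then obtain z where "0 < z" "z < 4" "\<bar>z - 4\<bar> < \<epsilon>" "- \<epsilon> < -1 * G z"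
        using w \<open>0 < \<epsilon>\<close> unfolding weakly_signed_def by auto
      then show "\<exists>y>0. y < 4 \<and> \<bar>y - (4 - x')\<bar> < \<epsilon> \<and> - \<epsilon> < 1 * - G (4 - y)"
        using \<open>x' = 4\<close> by (intro exI[of _ "4 - z"]) auto
    qed (use w x in \<open>auto simp: weakly_signed_def\<close>)
  qed (use sg x in auto)
  then show ?thesis by simp
qed

text \<open>If \<open>- e * F'\<close> were nowhere positive, \<open>e * F\<close> would be
  nondecreasing, yet nonnegative because of the left end and nonpositive because of the right end.
  It would vanish in between, and so would \<open>F'\<close>.\<close>

lemma rolle_between:
  assumes D: "\<And>y. 0 < y \<Longrightarrow> y < 4 \<Longrightarrow> (F has_real_derivative F' y) (at y)"
    and nn: "nowhere_null F'" and x: "0 \<le> x" "x < x'" "x' \<le> 4"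
    and w: "weakly_signed F x e" "weakly_signed F x' (- e)" and "e \<noteq> 0"
  shows "\<exists>y. x < y \<and> y < x' \<and> 0 < - e * F' y"
proof (rule ccontr)
  assume "\<not> ?thesis"
  then have sg: "0 \<le> e * F' y" if "x < y" "y < x'" for y using that by (force simp: not_less)
  have De: "((\<lambda>y. e * F y) has_real_derivative e * F' y) (at y)" if "0 < y" "y < 4" for y
    using D[OF that] by (rule DERIV_cmult)
  have w': "weakly_signed (\<lambda>y. e * F y) x 1" "weakly_signed (\<lambda>y. e * F y) x' (-1)"
    using w by (auto simp: weakly_signed_def)
  have z: "e * F y = 0" if y: "y \<in> {x<..<x'}" for y
    using nonneg_between[OF De sg x(1) _ _ x(3) w'(1)] nonpos_between[OF De sg x(1) _ _ x(3) w'(2)] y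
    by (intro antisym) auto
  obtain y where y: "x < y" "y < x'" "F' y \<noteq> 0" using nn x unfolding nowhere_null_def by blast
  have "((\<lambda>y. e * F y) has_real_derivative 0) (at y)"
    by (rule has_field_derivative_transform_within_open[where f = "\<lambda>_. 0" and S = "{x<..<x'}"])
      (use y z in auto)
  with De[of y] y x have "e * F' y = 0" using DERIV_unique by fastforce
  with y \<open>e \<noteq> 0\<close> show False by simp
qed

text \<open>The clause on \<open>hd xs\<close> carries the induction: the new point lies below the
  second entry and hence before all points found for the tail.\<close>

lemma rolle_alternates:
  assumes D: "\<And>y. 0 < y \<Longrightarrow> y < 4 \<Longrightarrow> (F has_real_derivative F' y) (at y)"
    and nn: "nowhere_null F'" and "e \<noteq> 0" "xs \<noteq> []" "weakly_alternates F e xs"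
  shows "\<exists>ys. alternates F' (- e) ys \<and> Suc (length ys) = length xs \<and>
    (\<forall>y\<in>set ys. hd xs < y)"
  using assms(3-)
proof (induction xs arbitrary: e rule: induct_list012)
  case (3 x x' xs)
  have w: "weakly_alternates F (- e) (x' # xs)" and x: "0 \<le> x" "x < x'" "x' \<le> 4"
      "weakly_signed F x e" "weakly_signed F x' (- e)"
    using 3(5) by (auto simp: weakly_alternates_def)
  obtain ys where ys: "alternates F' e ys" "Suc (length ys) = length (x' # xs)"
      "\<forall>y\<in>set ys. x' < y"
    using "3.IH"(2)[OF _ _ w] 3(3) by auto
  obtain y where y: "x < y" "y < x'" "0 < - e * F' y"
    using rolle_between[OF D nn x 3(3)] by auto
  have "alternates F' (- e) (y # ys)"
    using ys y x unfolding alternates_def by force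
  then show ?case using ys y x by (intro exI[of _ "y # ys"]) force
qed (auto simp: alternates_def)

lemma weakly_alternates_of_alternates:
  assumes "alternates F e xs" shows "weakly_alternates F e xs"
proof -
  have a: "alternating (\<lambda>x e. 0 < e * F x) e xs" and s: "set xs \<subseteq> {0<..<4}"
    using assms by (simp_all add: alternates_def)
  have "alternating (weakly_signed F) e xs"
  proof (rule alternating_mono[OF a])
    fix x e assume "x \<in> set xs" "0 < e * F x"
    then show "weakly_signed F x e" using s by (auto simp: weakly_signed_def)
  qed
  then show ?thesis using assms by (force simp: alternates_def weakly_alternates_def)
qed

lemma weakly_signed_tendsto_left:
  assumes "(F \<longlongrightarrow> 0) (at_right 0)"
  shows "weakly_signed F 0 e"
proof -
  have "\<exists>y>0. y < 4 \<and> \<bar>y - 0\<bar> < \<epsilon> \<and> - \<epsilon> < e * F y" if "0 < \<epsilon>" for \<epsilon>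
  proof -
    have "((\<lambda>y. e * F y) \<longlongrightarrow> e * 0) (at_right 0)" by (intro tendsto_intros assms)
    then have "eventually (\<lambda>y. - \<epsilon> < e * F y) (at_right 0)"
      using that by (auto intro: order_tendstoD)
    moreover have "eventually (\<lambda>y. y \<in> {0<..<min \<epsilon> 4}) (at_right (0::real))"
      using that by (intro eventually_at_right_real) auto
    ultimately have "eventually (\<lambda>y. - \<epsilon> < e * F y \<and> y \<in> {0<..<min \<epsilon> 4}) (at_right 0)"
      by (rule eventually_conj)
    from eventually_happens'[OF _ this] show ?thesis by auto
  qed
  then show ?thesis by (auto simp: weakly_signed_def)
qed

lemma weakly_alternates_Cons:
  assumes "weakly_alternates F (- e) xs" "set xs \<subseteq> {0<..}" "(F \<longlongrightarrow> 0) (at_right 0)"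
  shows "weakly_alternates F e (0 # xs)"
  using assms weakly_signed_tendsto_left[OF assms(3)] by (auto simp: weakly_alternates_def)

lemma weakly_alternates_snoc:
  assumes "weakly_alternates F e xs" "set xs \<subseteq> {..<4}" "weakly_signed F 4 (e * (-1) ^ length xs)"
  shows "weakly_alternates F e (xs @ [4])"
  using assms by (auto simp: weakly_alternates_def alternating_append sorted_wrt_append)

lemma alternates_mult:
  assumes "alternates F e xs" "\<And>x. 0 < x \<Longrightarrow> x < 4 \<Longrightarrow> G x = c x * F x \<and> 0 < c x"
  shows "alternates G e xs"
proof -
  have a: "alternating (\<lambda>x e. 0 < e * F x) e xs" and s: "set xs \<subseteq> {0<..<4}"
    using assms(1) by (simp_all add: alternates_def)
  have "alternating (\<lambda>x e. 0 < e * G x) e xs"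
  proof (rule alternating_mono[OF a])
    fix x e assume "x \<in> set xs" "0 < e * F x"
    moreover from this have "G x = c x * F x \<and> 0 < c x" using s assms(2) by auto
    ultimately have "0 < c x * (e * F x)" "e * G x = c x * (e * F x)" by simp_all
    then show "0 < e * G x" by (simp only:)
  qed
  then show ?thesis using assms by (simp add: alternates_def)
qed

lemma alternates_uminus:
  assumes "alternates F e xs" shows "alternates (\<lambda>x. - F x) (- e) xs"
proof -
  have a: "alternating (\<lambda>x e. 0 < e * F x) e xs" using assms by (simp add: alternates_def)
  have "alternating (\<lambda>x e. 0 < e * - F x) (- e) xs"
    by (rule alternating_flip[OF a]) simp
  then show ?thesis using assms by (simp add: alternates_def)
qed

lemma weakly_signed_near_4:
  assumes "\<And>y0 \<epsilon>. y0 < 4 \<Longrightarrow> 0 < \<epsilon> \<Longrightarrow> \<exists>y>y0. y < 4 \<and> - \<epsilon> < e * F y"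
  shows "weakly_signed F 4 e"
proof -
  have "\<exists>y>0. y < 4 \<and> \<bar>y - 4\<bar> < \<epsilon> \<and> - \<epsilon> < e * F y" if "0 < \<epsilon>" for \<epsilon>
    using assms[of "max 0 (4 - \<epsilon>)" \<epsilon>] that by auto
  then show ?thesis by (auto simp: weakly_signed_def)
qed

lemma not_weakly_signed_4:
  assumes "\<not> weakly_signed F 4 e"
  shows "\<exists>\<epsilon>>0. \<exists>y0<4. 0 \<le> y0 \<and> (\<forall>y. y0 < y \<longrightarrow> y < 4 \<longrightarrow> e * F y \<le> - \<epsilon>)"
proof -
  obtain \<epsilon> y0 where "0 < \<epsilon>" "y0 < 4" "\<forall>y>y0. y < 4 \<longrightarrow> e * F y \<le> - \<epsilon>"
    using weakly_signed_near_4[of e F] assms by (force simp: not_less)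
  then show ?thesis by (intro exI[of _ \<epsilon>] exI[of _ "max 0 y0"] conjI) auto
qed

section \<open>Solutions regular at 0\<close>

definition eig :: "nat \<Rightarrow> real" where "eig k = (real k + 1/2)\<^sup>2"

definition shift_const :: "real \<Rightarrow> nat \<Rightarrow> real" where
  "shift_const \<nu> k = 4 * (real k + 1) * (real k + \<nu>)"

text \<open>With \<open>X = J + 1/4\<close>, where \<open>J\<close> is the Jacobi operator, these are, up to the factor \<open>\<gamma>\<close> below, the Taylor
  coefficients at 0 of a basis of the regular solutions of \<open>((X - m)\<^sup>2 + \<delta>) y = 0\<close>: the two
  components \<open>u\<close>, \<open>v\<close> satisfy \<open>(X - m) u = \<delta> v\<close> and \<open>(X - m) v = - u\<close>. For \<open>\<delta> = 0\<close>, \<open>u\<close> solves \<open>X u = m u\<close>.\<close>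

fun pair_seq :: "real \<Rightarrow> real \<Rightarrow> nat \<Rightarrow> real \<times> real" where
  "pair_seq m \<delta> 0 = (1, 0)"
| "pair_seq m \<delta> (Suc k) = ((eig k - m) * fst (pair_seq m \<delta> k) - \<delta> * snd (pair_seq m \<delta> k),
     (eig k - m) * snd (pair_seq m \<delta> k) + fst (pair_seq m \<delta> k))"

lemma pochhammer_fact_sums:
  fixes \<kappa> x :: real
  assumes "\<bar>x\<bar> < 1"
  shows "(\<lambda>k. pochhammer \<kappa> k / fact k * x ^ k) sums (1 - x) powr (- \<kappa>)"
proof -
  have "(- \<kappa> gchoose k) * (- x) ^ k = pochhammer \<kappa> k / fact k * x ^ k" for k
  proof -
    have "(- \<kappa> gchoose k) * (- x) ^ k = ((-1) ^ k * (-1) ^ k) * (pochhammer \<kappa> k / fact k * x ^ k)"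
      unfolding gbinomial_pochhammer power_minus[of x] by simp
    then show ?thesis by (simp flip: power_mult_distrib)
  qed
  then show ?thesis using gen_binomial_real[of "- x" "- \<kappa>"] assms by simp
qed

text \<open>The radius 4 is the distance from 0 to the other singular point of the operator, so that
  the series represent the solutions on all of [0, 4).\<close>

definition conv4 :: "real fps \<Rightarrow> bool" where "conv4 f \<longleftrightarrow> fps_conv_radius f \<ge> 4"

lemma conv4_radius: "conv4 f \<Longrightarrow> \<bar>y::real\<bar> < 4 \<Longrightarrow> ereal (norm y) < fps_conv_radius f"
  unfolding conv4_def by (rule less_le_trans[where y = "ereal 4"]) auto

lemma conv4_simps [simp, intro]:
  "conv4 (fps_const c)" "conv4 fps_X" "conv4 (numeral k)"
  "conv4 f \<Longrightarrow> conv4 g \<Longrightarrow> conv4 (f + g)" "conv4 f \<Longrightarrow> conv4 g \<Longrightarrow> conv4 (f - g)"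
  "conv4 f \<Longrightarrow> conv4 g \<Longrightarrow> conv4 (f * g)" "conv4 f \<Longrightarrow> conv4 (fps_deriv f)"
proof -
  show "conv4 (fps_const c)" "conv4 fps_X" "conv4 (numeral k)" by (simp_all add: conv4_def)
  have m: "min a b \<le> c \<Longrightarrow> 4 \<le> a \<Longrightarrow> 4 \<le> b \<Longrightarrow> 4 \<le> c" for a b c :: ereal
    using order_trans[of 4 "min a b" c] by simp
  show "conv4 f \<Longrightarrow> conv4 g \<Longrightarrow> conv4 (f + g)" "conv4 f \<Longrightarrow> conv4 g \<Longrightarrow> conv4 (f - g)"
    "conv4 f \<Longrightarrow> conv4 g \<Longrightarrow> conv4 (f * g)"
    unfolding conv4_def using m fps_conv_radius_add fps_conv_radius_diff fps_conv_radius_mult by blast+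
  show "conv4 f \<Longrightarrow> conv4 (fps_deriv f)"
    unfolding conv4_def using fps_conv_radius_deriv[of f] by (meson order_trans)
qed

lemma eval_conv4:
  assumes "\<bar>y\<bar> < 4"
  shows "conv4 f \<Longrightarrow> conv4 g \<Longrightarrow> eval_fps (f + g) y = eval_fps f y + eval_fps g y"
    "conv4 f \<Longrightarrow> conv4 g \<Longrightarrow> eval_fps (f - g) y = eval_fps f y - eval_fps g y"
    "conv4 f \<Longrightarrow> conv4 g \<Longrightarrow> eval_fps (f * g) y = eval_fps f y * eval_fps g y"
    "conv4 f \<Longrightarrow> (eval_fps f has_real_derivative eval_fps (fps_deriv f) y) (at y)"
  using assms by (auto intro!: eval_fps_add eval_fps_diff eval_fps_mult has_field_derivative_eval_fps conv4_radius)

lemma eval_fps_nonneg: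
  assumes "conv4 f" "0 \<le> y" "y < 4" "\<And>k. 0 \<le> fps_nth f k"
  shows "0 \<le> eval_fps f y"
  unfolding eval_fps_def using assms conv4_radius[of f y]
  by (intro suminf_nonneg summable_fps) auto

lemma eval_fps_pos:
  assumes "conv4 f" "0 < y" "y < 4" "\<And>k. 0 \<le> fps_nth f k" "0 < fps_nth f i"
  shows "0 < eval_fps f y"
  unfolding eval_fps_def using assms conv4_radius[of f y]
  by (intro suminf_pos2[of _ i] summable_fps) auto

lemma eval_fps_mono:
  assumes "conv4 f" "conv4 g" "0 \<le> y" "y < 4" "\<And>k. fps_nth f k \<le> fps_nth g k"
  shows "eval_fps f y \<le> eval_fps g y"
  using eval_fps_nonneg[of "g - f" y] eval_conv4(2)[of y g f] assms by simp

locale jacobi_series =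
  fixes \<nu> m \<delta> :: real
  assumes nu: "0 < \<nu>" "\<nu> < 2"
begin

definition "U k = fst (pair_seq m \<delta> k)"
definition "V k = snd (pair_seq m \<delta> k)"
definition "\<gamma> k = (\<Prod>j<k. 1 / shift_const \<nu> j)"

lemma U_0 [simp]: "U 0 = 1" and V_0 [simp]: "V 0 = 0"
  and U_Suc: "U (Suc k) = (eig k - m) * U k - \<delta> * V k"
  and V_Suc: "V (Suc k) = (eig k - m) * V k + U k"
  by (simp_all add: U_def V_def)

lemma shift_const_pos: "0 < shift_const \<nu> k"
  using nu by (simp add: shift_const_def add_nonneg_pos)

lemma \<gamma>_0 [simp]: "\<gamma> 0 = 1" and \<gamma>_Suc: "\<gamma> (Suc k) = \<gamma> k / shift_const \<nu> k"
  by (simp_all add: \<gamma>_def)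

lemma \<gamma>_pos: "0 < \<gamma> k"
  unfolding \<gamma>_def using shift_const_pos by (intro prod_pos) simp

text \<open>Growth exponent at 4. It has to exceed 0 and 1 - \<nu>, the exponent of the singular
  solution there, and to stay below 2 - \<nu>, so that \<open>s f\<close> tends to 0 and
  \<open>w f\<close> is integrable at 4. This is the midpoint of 0 and 2 - \<nu>.\<close>

definition "\<kappa> = 1 - \<nu> / 2"

lemma coeff_bound:
  obtains C where "0 \<le> C" "\<And>k. 4 ^ k * \<gamma> k * (\<bar>U k\<bar> + \<bar>V k\<bar>) \<le> C * (pochhammer \<kappa> k / fact k)"
proof -
  define a where "a k = 4 ^ k * \<gamma> k * (\<bar>U k\<bar> + \<bar>V k\<bar>)" for k
  define b where "b k = pochhammer \<kappa> k / fact k" for k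
  define M where "M = 1/4 + \<bar>m\<bar> + \<bar>\<delta>\<bar> + 1"
  have \<kappa>: "0 < \<kappa>" using nu by (simp add: \<kappa>_def)
  have b0: "0 < b k" for k using \<kappa> by (simp add: b_def pochhammer_pos)
  have bS: "b (Suc k) = b k * ((real k + \<kappa>) / (real k + 1))" for k
    by (simp add: b_def pochhammer_Suc field_simps)
  have a0: "0 \<le> a k" for k using \<gamma>_pos[of k] by (simp add: a_def)
  have aS: "a (Suc k) \<le> a k * (((real k)\<^sup>2 + real k + M) / ((real k + 1) * (real k + \<nu>)))" for k
  proof -
    have e: "\<bar>eig k - m\<bar> \<le> (real k)\<^sup>2 + real k + 1/4 + \<bar>m\<bar>"
    proof -
      have "eig k = (real k)\<^sup>2 + real k + 1/4" by (simp add: eig_def power2_eq_square algebra_simps)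
      moreover have "0 \<le> eig k" by (simp add: eig_def)
      ultimately show ?thesis by linarith
    qed
    have "\<bar>U (Suc k)\<bar> + \<bar>V (Suc k)\<bar> \<le> (\<bar>eig k - m\<bar> * \<bar>U k\<bar> + \<bar>\<delta>\<bar> * \<bar>V k\<bar>) + (\<bar>eig k - m\<bar> * \<bar>V k\<bar> + \<bar>U k\<bar>)"
      unfolding U_Suc V_Suc
      by (intro add_mono order_trans[OF abs_triangle_ineq4] order_trans[OF abs_triangle_ineq])
        (simp_all add: abs_mult)
    also have "\<dots> \<le> (\<bar>eig k - m\<bar> + \<bar>\<delta>\<bar> + 1) * (\<bar>U k\<bar> + \<bar>V k\<bar>)"
      by (simp add: algebra_simps)
    also have "\<dots> \<le> ((real k)\<^sup>2 + real k + M) * (\<bar>U k\<bar> + \<bar>V k\<bar>)"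
      using e by (intro mult_right_mono) (auto simp: M_def)
    finally have "a (Suc k) \<le> 4 ^ Suc k * \<gamma> (Suc k) * (((real k)\<^sup>2 + real k + M) * (\<bar>U k\<bar> + \<bar>V k\<bar>))"
      unfolding a_def using \<gamma>_pos[of "Suc k"] by (intro mult_left_mono) auto
    also have "\<dots> = a k * (((real k)\<^sup>2 + real k + M) / ((real k + 1) * (real k + \<nu>)))"
      using nu by (simp add: a_def \<gamma>_Suc shift_const_def divide_simps)
    finally show ?thesis .
  qed
  \<comment> \<open>From \<open>k0\<close> on, the terms \<open>a\<close> grow no faster than the
    binomial coefficients \<open>b\<close>, because (k + \<kappa>)(k + \<nu>) - (k^2 + k + M) = k
    \<nu>/2 + \<kappa> \<nu> - M. The constant \<open>C\<close> absorbs the terms before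
    that.\<close>
  obtain k0 :: nat where k0: "M \<le> real k0 * (\<nu> / 2)"
    using nu real_arch_simple[of "M / (\<nu> / 2)"] by (auto simp: field_simps)
  define C where "C = (\<Sum>k\<le>k0. a k / b k)"
  have C0: "0 \<le> C" unfolding C_def using a0 b0 by (intro sum_nonneg divide_nonneg_pos) auto
  have "a k \<le> C * b k" for k
  proof (induction k)
    case 0
    have "a 0 / b 0 \<le> C" unfolding C_def using a0 b0 by (intro member_le_sum) (auto intro: divide_nonneg_pos)
    then show ?case using b0[of 0] by (simp add: field_simps)
  next
    case (Suc k)
    show ?case
    proof (cases "Suc k \<le> k0")
      case True
      then have "a (Suc k) / b (Suc k) \<le> C"
        unfolding C_def using a0 b0 by (intro member_le_sum) (auto intro: divide_nonneg_pos)
      then show ?thesis using b0[of "Suc k"] by (simp add: pos_divide_le_eq)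
    next
      case False
      then have "real k0 * (\<nu> / 2) \<le> real k * (\<nu> / 2)"
        using nu by (intro mult_right_mono) auto
      with k0 have "M \<le> real k * (\<nu> / 2)" by linarith
      moreover have "0 \<le> \<kappa> * \<nu>" using \<kappa> nu by simp
      ultimately have "(real k)\<^sup>2 + real k + M \<le> (real k + \<kappa>) * (real k + \<nu>)"
        by (simp add: \<kappa>_def power2_eq_square algebra_simps add_divide_distrib)
      then have r: "((real k)\<^sup>2 + real k + M) / ((real k + 1) * (real k + \<nu>)) \<le> (real k + \<kappa>) / (real k + 1)"
        using nu divide_right_mono[of "(real k)\<^sup>2 + real k + M" "(real k + \<kappa>) * (real k + \<nu>)"
            "(real k + 1) * (real k + \<nu>)"] by (simp add: add_nonneg_eq_0_iff)
      have "a (Suc k) \<le> a k * ((real k + \<kappa>) / (real k + 1))"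
        using aS[of k] mult_left_mono[OF r a0[of k]] by linarith
      also have "\<dots> \<le> (C * b k) * ((real k + \<kappa>) / (real k + 1))"
        using Suc \<kappa> by (intro mult_right_mono) auto
      finally show ?thesis by (simp add: bS)
    qed
  qed
  with C0 that show ?thesis unfolding a_def b_def by blast
qed

definition "Uf = Abs_fps (\<lambda>k. \<gamma> k * U k)"
definition "Vf = Abs_fps (\<lambda>k. \<gamma> k * V k)"

lemma nth_Vf: "fps_nth Vf k = \<gamma> k * V k" and nth_Uf: "fps_nth Uf k = \<gamma> k * U k"
  by (simp_all add: Vf_def Uf_def)

lemma fps_bound:
  assumes "\<And>k. 4 ^ k * \<bar>fps_nth f k\<bar> \<le> C * (pochhammer \<kappa> k / fact k)"
  shows "conv4 f" "0 \<le> y \<Longrightarrow> y < 4 \<Longrightarrow> \<bar>eval_fps f y\<bar> \<le> C * (1 - y / 4) powr (- \<kappa>)"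
proof -
  have s: "(\<lambda>k. C * (pochhammer \<kappa> k / fact k * (y / 4) ^ k)) sums (C * (1 - y / 4) powr (- \<kappa>))"
    if "\<bar>y\<bar> < 4" for y
    using pochhammer_fact_sums[of "y / 4" \<kappa>] that by (intro sums_mult) auto
  have b: "norm (fps_nth f k * y ^ k) \<le> C * (pochhammer \<kappa> k / fact k * (y / 4) ^ k)" if "0 \<le> y" for k y
  proof -
    have "norm (fps_nth f k * y ^ k) = 4 ^ k * \<bar>fps_nth f k\<bar> * (y / 4) ^ k"
      using that by (simp add: abs_mult power_abs power_divide)
    also have "\<dots> \<le> C * (pochhammer \<kappa> k / fact k) * (y / 4) ^ k"
      using assms that by (intro mult_right_mono) auto
    finally show ?thesis by (simp add: mult.assoc)
  qed
  have "fps_conv_radius f \<ge> ereal 4" unfolding fps_conv_radius_def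
  proof (rule conv_radius_geI_ex')
    fix r :: real assume r: "0 < r" "ereal r < ereal 4"
    then show "summable (\<lambda>n. fps_nth f n * of_real r ^ n)"
      using s[of r] b[of r] by (intro summable_comparison_test[OF _ sums_summable[OF s[of r]]]) auto
  qed
  then show t: "conv4 f" by (simp add: conv4_def)
  assume y: "0 \<le> y" "y < 4"
  have ss: "summable (\<lambda>k. norm (fps_nth f k * y ^ k))"
    using t y by (intro norm_summable_fps conv4_radius) auto
  have "\<bar>eval_fps f y\<bar> \<le> (\<Sum>k. norm (fps_nth f k * y ^ k))"
    unfolding eval_fps_def using summable_norm[OF ss] by simp
  also have "\<dots> \<le> (\<Sum>k. C * (pochhammer \<kappa> k / fact k * (y / 4) ^ k))"
    using y by (intro suminf_le[OF _ ss] b sums_summable[OF s]) auto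
  also have "\<dots> = C * (1 - y / 4) powr (- \<kappa>)" using s[of y] y by (simp add: sums_iff)
  finally show "\<bar>eval_fps f y\<bar> \<le> C * (1 - y / 4) powr (- \<kappa>)" .
qed

lemma conv4_Uf [simp, intro]: "conv4 Uf" and conv4_Vf [simp, intro]: "conv4 Vf"
  and UV_bound: "\<exists>C\<ge>0. \<forall>y. 0 \<le> y \<longrightarrow> y < 4 \<longrightarrow> \<bar>eval_fps Uf y\<bar> \<le> C * (1 - y / 4) powr (- \<kappa>) \<and>
     \<bar>eval_fps Vf y\<bar> \<le> C * (1 - y / 4) powr (- \<kappa>)"
proof -
  obtain C where C: "0 \<le> C" "\<And>k. 4 ^ k * \<gamma> k * (\<bar>U k\<bar> + \<bar>V k\<bar>) \<le> C * (pochhammer \<kappa> k / fact k)"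
    using coeff_bound by blast
  have U: "4 ^ k * \<bar>fps_nth Uf k\<bar> \<le> C * (pochhammer \<kappa> k / fact k)" for k
    using \<gamma>_pos[of k] by (intro order_trans[OF _ C(2)[of k]]) (simp add: Uf_def abs_mult algebra_simps)
  have V: "4 ^ k * \<bar>fps_nth Vf k\<bar> \<le> C * (pochhammer \<kappa> k / fact k)" for k
    using \<gamma>_pos[of k] by (intro order_trans[OF _ C(2)[of k]]) (simp add: Vf_def abs_mult algebra_simps)
  show "conv4 Uf" "conv4 Vf" "\<exists>C\<ge>0. \<forall>y. 0 \<le> y \<longrightarrow> y < 4 \<longrightarrow> \<bar>eval_fps Uf y\<bar> \<le> C * (1 - y / 4) powr (- \<kappa>) \<and>
     \<bar>eval_fps Vf y\<bar> \<le> C * (1 - y / 4) powr (- \<kappa>)"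
    using fps_bound[OF U] fps_bound[OF V] C(1) by blast+
qed

text \<open>The operator \<open>X - m\<close> on power series.\<close>

definition "jop_fps f = fps_X * (fps_X * fps_deriv (fps_deriv f)) - fps_const 4 * (fps_X * fps_deriv (fps_deriv f))
   + (fps_const 2 * (fps_X * fps_deriv f) - fps_const (4 * \<nu>) * fps_deriv f) + fps_const (1/4 - m) * f"

lemma nth_jop_fps:
  "fps_nth (jop_fps f) k = (eig k - m) * fps_nth f k - shift_const \<nu> k * fps_nth f (Suc k)"
proof (cases k)
  case 0
  then show ?thesis by (simp add: jop_fps_def eig_def shift_const_def power2_eq_square algebra_simps)
next
  case (Suc j)
  then show ?thesis
    by (cases j) (simp_all add: jop_fps_def eig_def shift_const_def power2_eq_square algebra_simps)
qed

lemma jop_Uf: "jop_fps Uf = fps_const \<delta> * Vf" and jop_Vf: "jop_fps Vf = - Uf"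
proof -
  have s: "shift_const \<nu> k * (\<gamma> (Suc k) * z) = \<gamma> k * z" for k z
    using shift_const_pos[of k] by (simp add: \<gamma>_Suc)
  show "jop_fps Uf = fps_const \<delta> * Vf"
    by (rule fps_ext) (simp add: nth_jop_fps Uf_def Vf_def s, simp add: U_Suc algebra_simps)
  show "jop_fps Vf = - Uf"
    by (rule fps_ext) (simp add: nth_jop_fps Uf_def Vf_def s, simp add: V_Suc algebra_simps)
qed

definition "u = eval_fps Uf"
definition "u' = eval_fps (fps_deriv Uf)"
definition "u'' = eval_fps (fps_deriv (fps_deriv Uf))"
definition "v = eval_fps Vf"
definition "v' = eval_fps (fps_deriv Vf)"
definition "v'' = eval_fps (fps_deriv (fps_deriv Vf))"

lemma deriv_uv:
  assumes "\<bar>y\<bar> < 4"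
  shows "(u has_real_derivative u' y) (at y)" "(u' has_real_derivative u'' y) (at y)"
    "(v has_real_derivative v' y) (at y)" "(v' has_real_derivative v'' y) (at y)"
  unfolding u_def u'_def u''_def v_def v'_def v''_def using assms by (auto intro!: eval_conv4(4))

lemma eval_jop_fps:
  assumes "conv4 f" "\<bar>y\<bar> < 4"
  shows "eval_fps (jop_fps f) y = y * (y - 4) * eval_fps (fps_deriv (fps_deriv f)) y
     + (2 * y - 4 * \<nu>) * eval_fps (fps_deriv f) y + (1/4 - m) * eval_fps f y"
  unfolding jop_fps_def using assms
  by (simp add: eval_conv4 algebra_simps)

lemma ode_uv:
  assumes "\<bar>y\<bar> < 4"
  shows "y * (y - 4) * u'' y + (2 * y - 4 * \<nu>) * u' y + (1/4 - m) * u y = \<delta> * v y"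
    "y * (y - 4) * v'' y + (2 * y - 4 * \<nu>) * v' y + (1/4 - m) * v y = - u y"
  using eval_jop_fps[OF conv4_Uf assms] eval_jop_fps[OF conv4_Vf assms] assms
    eval_fps_minus[of y Uf] conv4_radius[OF conv4_Uf assms]
  unfolding jop_Uf jop_Vf
  by (simp_all add: u_def u'_def u''_def v_def v'_def v''_def eval_conv4)

lemma uv_at_0: "u 0 = 1" "v 0 = 0" "u' 0 = (1/4 - m) / (4 * \<nu>)" "v' 0 = 1 / (4 * \<nu>)"
  by (simp_all add: u_def v_def u'_def v'_def eval_fps_at_0 Uf_def Vf_def \<gamma>_Suc shift_const_def
      U_Suc V_Suc eig_def power2_eq_square)

end

section \<open>Behaviour at the singular endpoints\<close>

lemma antimono_bounded_tendsto_left: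
  fixes G :: "real \<Rightarrow> real"
  assumes ab: "a < b" and mono: "\<And>x y. a < x \<Longrightarrow> x \<le> y \<Longrightarrow> y < b \<Longrightarrow> G y \<le> G x"
    and bdd: "\<And>y. a < y \<Longrightarrow> y < b \<Longrightarrow> L \<le> G y"
  shows "\<exists>l. (G \<longlongrightarrow> l) (at_left b)"
proof -
  define I where "I = G ` {a<..<b}"
  have I: "I \<noteq> {}" "bdd_below I" using ab bdd by (auto simp: I_def bdd_below_def intro!: exI[of _ L])
  have "(G \<longlongrightarrow> Inf I) (at_left b)"
  proof (rule order_tendstoI)
    fix c assume "c < Inf I"
    have "eventually (\<lambda>y. y \<in> {a<..<b}) (at_left b)" using ab by (rule eventually_at_left_real)
    then show "eventually (\<lambda>y. c < G y) (at_left b)"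
    proof eventually_elim
      case (elim y)
      then have "Inf I \<le> G y" using I by (intro cInf_lower) (auto simp: I_def)
      with \<open>c < Inf I\<close> show ?case by simp
    qed
  next
    fix c assume "Inf I < c"
    then obtain x where x: "a < x" "x < b" "G x < c"
      using I cInf_less_iff[of I c] by (auto simp: I_def)
    have "eventually (\<lambda>y. y \<in> {x<..<b}) (at_left b)" using x by (intro eventually_at_left_real) auto
    then show "eventually (\<lambda>y. G y < c) (at_left b)"
    proof eventually_elim
      case (elim y)
      then have "G y \<le> G x" using x by (intro mono) auto
      with x show ?case by simp
    qed
  qed
  then show ?thesis by blast
qed

text \<open>The bound on \<open>F'\<close> is integrable. With \<open>B\<close>, whose derivative is
  minus that bound and which tends to 0, the function \<open>F + B\<close> is nonincreasing,
  \<open>F - B\<close> is nondecreasing, and the second bounds the first from below.\<close>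

lemma tendsto_left_of_deriv_bound:
  fixes F :: "real \<Rightarrow> real"
  assumes p: "p < 1" and K: "0 \<le> K" and a: "a < b"
    and D: "\<And>y. a < y \<Longrightarrow> y < b \<Longrightarrow> (F has_real_derivative F' y) (at y)"
    and bd: "\<And>y. a < y \<Longrightarrow> y < b \<Longrightarrow> \<bar>F' y\<bar> \<le> K * (b - y) powr (- p)"
  shows "\<exists>l. (F \<longlongrightarrow> l) (at_left b)"
proof -
  define B where "B y = K / (1 - p) * (b - y) powr (1 - p)" for y
  have dB: "(B has_real_derivative - (K * (b - y) powr (- p))) (at y)" if "y < b" for y
  proof -
    have "((\<lambda>y. (b - y) powr (1 - p)) has_real_derivative (1 - p) * (b - y) powr (1 - p - 1) * (- 1)) (at y)"
      using that by (intro DERIV_chain2[OF has_real_derivative_powr]) (auto intro!: derivative_eq_intros)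
    from DERIV_cmult[OF this, of "K / (1 - p)"] show ?thesis
      using p by (simp add: B_def[abs_def])
  qed
  have tB: "(B \<longlongrightarrow> 0) (at_left b)"
  proof -
    have "((\<lambda>y. (b - y) powr (1 - p)) \<longlongrightarrow> (b - b) powr (1 - p)) (at_left b)"
      using p by (intro tendsto_powr2 tendsto_intros)
        (auto simp: eventually_at_left_field intro!: exI[of _ "b - 1"])
    then have "((\<lambda>y. K / (1 - p) * (b - y) powr (1 - p)) \<longlongrightarrow> K / (1 - p) * 0) (at_left b)"
      by (intro tendsto_mult tendsto_const) simp
    then show ?thesis by (simp add: B_def[abs_def])
  qed
  have dec: "F y + B y \<le> F x + B x" if "a < x" "x \<le> y" "y < b" for x y
  proof (rule DERIV_nonpos_imp_nonincreasing[where f = "\<lambda>y. F y + B y"])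
    show "\<exists>l. ((\<lambda>y. F y + B y) has_real_derivative l) (at t) \<and> l \<le> 0" if "x \<le> t" "t \<le> y" for t
      using DERIV_add[OF D[of t] dB[of t]] bd[of t] that \<open>a < x\<close> \<open>y < b\<close>
      by (intro exI[of _ "F' t + - (K * (b - t) powr (- p))"]) auto
  qed fact
  have inc: "F x - B x \<le> F y - B y" if "a < x" "x \<le> y" "y < b" for x y
  proof (rule DERIV_nonneg_imp_nondecreasing[where f = "\<lambda>y. F y - B y"])
    show "\<exists>l. ((\<lambda>y. F y - B y) has_real_derivative l) (at t) \<and> 0 \<le> l" if "x \<le> t" "t \<le> y" for t
      using DERIV_diff[OF D[of t] dB[of t]] bd[of t] that \<open>a < x\<close> \<open>y < b\<close>
      by (intro exI[of _ "F' t - - (K * (b - t) powr (- p))"]) auto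
  qed fact
  have B0: "0 \<le> B y" for y using K p by (simp add: B_def)
  define c where "c = (a + b) / 2"
  have c: "a < c" "c < b" using a by (auto simp: c_def field_simps)
  have "\<exists>l. ((\<lambda>y. F y + B y) \<longlongrightarrow> l) (at_left b)"
  proof (rule antimono_bounded_tendsto_left[OF c(2), where L = "F c - B c"])
    show "F c - B c \<le> F y + B y" if "c < y" "y < b" for y
      using inc[of c y] that c B0[of y] by simp
  qed (use dec c in auto)
  then obtain l where "((\<lambda>y. F y + B y) \<longlongrightarrow> l) (at_left b)" by blast
  from tendsto_diff[OF this tB] show ?thesis by auto
qed

context jacobi_series
begin

definition "s y = y powr \<nu> * (4 - y) powr (2 - \<nu>)"
definition "w y = y powr (\<nu> - 1) * (4 - y) powr (1 - \<nu>)"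

lemma w_pos: "0 < y \<Longrightarrow> y < 4 \<Longrightarrow> 0 < w y" and s_pos: "0 < y \<Longrightarrow> y < 4 \<Longrightarrow> 0 < s y"
  by (simp_all add: w_def s_def)

lemma s_eq_w: "0 < y \<Longrightarrow> y < 4 \<Longrightarrow> s y = y * (4 - y) * w y"
  using powr_add[of y 1 "\<nu> - 1"] powr_add[of "4 - y" 1 "1 - \<nu>"] by (simp add: s_def w_def)

lemma deriv_s:
  assumes "0 < y" "y < 4"
  shows "(s has_real_derivative w y * (4 * \<nu> - 2 * y)) (at y)"
proof -
  have "(s has_real_derivative \<nu> * y powr (\<nu> - 1) * (4 - y) powr (2 - \<nu>)
      - (2 - \<nu>) * (4 - y) powr (1 - \<nu>) * y powr \<nu>) (at y)"
    unfolding s_def using assms by (auto intro!: derivative_eq_intros)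
  also have "y powr \<nu> = y * y powr (\<nu> - 1)" using powr_add[of y 1 "\<nu> - 1"] assms by simp
  also have "(4 - y) powr (2 - \<nu>) = (4 - y) * (4 - y) powr (1 - \<nu>)"
    using powr_add[of "4 - y" 1 "1 - \<nu>"] assms by simp
  finally show ?thesis by (simp add: w_def algebra_simps)
qed

text \<open>The Lagrange concomitant of the operator \<open>J f = - (s f')' / w\<close>; derivatives are passed as separate
  arguments.\<close>

definition conc :: "(real \<Rightarrow> real) \<Rightarrow> (real \<Rightarrow> real) \<Rightarrow> (real \<Rightarrow> real) \<Rightarrow> (real \<Rightarrow> real) \<Rightarrow> real \<Rightarrow> real" where
  "conc f f' k k' y = s y * (f' y * k y - f y * k' y)"

definition jac :: "(real \<Rightarrow> real) \<Rightarrow> (real \<Rightarrow> real) \<Rightarrow> real \<Rightarrow> real" where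
  "jac f' f'' y = y * (y - 4) * f'' y + (2 * y - 4 * \<nu>) * f' y"

lemma deriv_conc:
  assumes "0 < y" "y < 4" "(f has_real_derivative f' y) (at y)" "(f' has_real_derivative f'' y) (at y)"
    "(k has_real_derivative k' y) (at y)" "(k' has_real_derivative k'' y) (at y)"
  shows "(conc f f' k k' has_real_derivative - (w y * (k y * jac f' f'' y - f y * jac k' k'' y))) (at y)"
  unfolding conc_def using assms
  by (auto intro!: derivative_eq_intros deriv_s simp: jac_def s_eq_w algebra_simps)

lemma s_tendsto_0: "(s \<longlongrightarrow> 0) (at_right 0)"
proof -
  have "((\<lambda>y. y powr \<nu> * (4 - y) powr (2 - \<nu>)) \<longlongrightarrow> 0 powr \<nu> * (4 - 0) powr (2 - \<nu>)) (at_right 0)"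
    using nu by (intro tendsto_intros tendsto_powr2) (auto simp: eventually_at_right_field intro!: exI[of _ 1])
  then show ?thesis by (simp add: s_def[abs_def])
qed

lemma s_tendsto_4: "(s \<longlongrightarrow> 0) (at_left 4)"
proof -
  have "((\<lambda>y. y powr \<nu> * (4 - y) powr (2 - \<nu>)) \<longlongrightarrow> 4 powr \<nu> * (4 - 4) powr (2 - \<nu>)) (at_left 4)"
    using nu by (intro tendsto_intros tendsto_powr2) (auto simp: eventually_at_left_field intro!: exI[of _ 3])
  then show ?thesis by (simp add: s_def[abs_def])
qed

lemma bounded_powr_near_4:
  assumes "2 < y" "y < 4"
  shows "0 \<le> y powr (\<nu> - 1)" "y powr (\<nu> - 1) \<le> 4" "y powr \<nu> \<le> 16"
proof -
  show "y powr (\<nu> - 1) \<le> 4"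
  proof (cases "\<nu> \<le> 1")
    case True
    then have "y powr (\<nu> - 1) \<le> y powr 0" using assms by (intro powr_mono) auto
    then show ?thesis using assms by simp
  next
    case False
    then have "y powr (\<nu> - 1) \<le> y powr 1" using assms nu by (intro powr_mono) auto
    then show ?thesis using assms by simp
  qed
  have "y powr \<nu> \<le> y powr 2" using assms nu by (intro powr_mono) auto
  also have "\<dots> = y * y" using assms by (simp add: power2_eq_square)
  also have "\<dots> \<le> 4 * 4" using assms by (intro mult_mono) auto
  finally show "y powr \<nu> \<le> 16" by simp
  show "0 \<le> y powr (\<nu> - 1)" by simp
qed

lemma quarter_powr: "y < 4 \<Longrightarrow> (1 - y / 4) powr (- \<kappa>) = (4 powr \<kappa>) * (4 - y) powr (- \<kappa>)"
proof -
  assume "y < 4"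
  then have "(1 - y / 4) powr (- \<kappa>) = ((4 - y) / 4) powr (- \<kappa>)" by (simp add: diff_divide_distrib)
  also have "\<dots> = (4 - y) powr (- \<kappa>) / 4 powr (- \<kappa>)" by (rule powr_divide)
  also have "\<dots> = (4 powr \<kappa>) * (4 - y) powr (- \<kappa>)" by (simp add: powr_minus field_simps)
  finally show ?thesis .
qed

lemma s_mult_tendsto_4:
  assumes "0 \<le> C" "\<And>y. 0 \<le> y \<Longrightarrow> y < 4 \<Longrightarrow> \<bar>f y\<bar> \<le> C * (1 - y / 4) powr (- \<kappa>)"
  shows "((\<lambda>y. s y * f y) \<longlongrightarrow> 0) (at_left 4)"
proof (rule tendsto_0_le[where K = 1])
  have "((\<lambda>y. 16 * C * 4 powr \<kappa> * (4 - y) powr (1 - \<nu> / 2)) \<longlongrightarrow>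
      16 * C * 4 powr \<kappa> * (4 - 4) powr (1 - \<nu> / 2)) (at_left 4)"
    using nu by (intro tendsto_intros tendsto_powr2) (auto simp: eventually_at_left_field intro!: exI[of _ 3])
  then show "((\<lambda>y. 16 * C * 4 powr \<kappa> * (4 - y) powr (1 - \<nu> / 2)) \<longlongrightarrow> 0) (at_left 4)" by simp
  have "eventually (\<lambda>y::real. y \<in> {2<..<4}) (at_left 4)" by (intro eventually_at_left_real) auto
  then show "eventually (\<lambda>y. norm (s y * f y) \<le> norm (16 * C * 4 powr \<kappa> * (4 - y) powr (1 - \<nu> / 2)) * 1) (at_left 4)"
  proof eventually_elim
    case (elim y)
    then have y: "2 < y" "y < 4" by auto
    have e: "(4 - y) powr (2 - \<nu>) * (4 - y) powr (- \<kappa>) = (4 - y) powr (1 - \<nu> / 2)"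
      by (simp add: \<kappa>_def flip: powr_add)
    have "norm (s y * f y) = y powr \<nu> * (4 - y) powr (2 - \<nu>) * \<bar>f y\<bar>" by (simp add: s_def abs_mult)
    also have "\<dots> \<le> 16 * (4 - y) powr (2 - \<nu>) * (C * (4 powr \<kappa> * (4 - y) powr (- \<kappa>)))"
      using assms(2)[of y] y bounded_powr_near_4[OF y]
      by (intro mult_mono) (auto simp: quarter_powr[symmetric])
    also have "\<dots> = 16 * C * 4 powr \<kappa> * (4 - y) powr (1 - \<nu> / 2)"
      unfolding e[symmetric] by (simp add: algebra_simps)
    finally show ?case using assms(1) by simp
  qed
qed

lemma flux_limit:
  assumes C: "0 \<le> C" "\<And>y. 0 \<le> y \<Longrightarrow> y < 4 \<Longrightarrow> \<bar>jac f' f'' y\<bar> \<le> C * (1 - y / 4) powr (- \<kappa>)"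
    and D: "\<And>y. \<bar>y\<bar> < 4 \<Longrightarrow> (f has_real_derivative f' y) (at y)"
      "\<And>y. \<bar>y\<bar> < 4 \<Longrightarrow> (f' has_real_derivative f'' y) (at y)"
  shows "\<exists>l. ((\<lambda>y. s y * f' y) \<longlongrightarrow> l) (at_left 4)"
proof (rule tendsto_left_of_deriv_bound[where p = "\<nu> / 2" and K = "4 * (C * 4 powr \<kappa>)" and a = 2])
  fix y :: real assume y: "2 < y" "y < 4"
  have "(conc f f' (\<lambda>_. 1) (\<lambda>_. 0) has_real_derivative - (w y * (1 * jac f' f'' y - f y * jac (\<lambda>_. 0) (\<lambda>_. 0) y))) (at y)"
    using y D[of y] by (intro deriv_conc) auto
  then show "((\<lambda>y. s y * f' y) has_real_derivative - (w y * jac f' f'' y)) (at y)"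
    by (simp add: conc_def[abs_def] jac_def)
  have e: "(4 - y) powr (1 - \<nu>) * (4 - y) powr (- \<kappa>) = (4 - y) powr (- (\<nu> / 2))"
    by (simp add: \<kappa>_def flip: powr_add)
  have "\<bar>- (w y * jac f' f'' y)\<bar> = y powr (\<nu> - 1) * (4 - y) powr (1 - \<nu>) * \<bar>jac f' f'' y\<bar>"
    by (simp add: w_def abs_mult)
  also have "\<dots> \<le> 4 * (4 - y) powr (1 - \<nu>) * (C * (4 powr \<kappa> * (4 - y) powr (- \<kappa>)))"
    using C(2)[of y] y bounded_powr_near_4[OF y]
    by (intro mult_mono) (auto simp: quarter_powr[symmetric])
  also have "\<dots> = 4 * (C * 4 powr \<kappa>) * (4 - y) powr (- (\<nu> / 2))"
    unfolding e[symmetric] by (simp add: algebra_simps)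
  finally show "\<bar>- (w y * jac f' f'' y)\<bar> \<le> 4 * (C * 4 powr \<kappa>) * (4 - y) powr (- (\<nu> / 2))" .
qed (use nu C in auto)

lemma jac_uv:
  assumes "\<bar>y\<bar> < 4"
  shows "jac u' u'' y = (m - 1/4) * u y + \<delta> * v y" "jac v' v'' y = (m - 1/4) * v y - u y"
  using ode_uv[OF assms] by (simp_all add: jac_def algebra_simps)

lemma su_tendsto_4: "((\<lambda>y. s y * u y) \<longlongrightarrow> 0) (at_left 4)"
  and sv_tendsto_4: "((\<lambda>y. s y * v y) \<longlongrightarrow> 0) (at_left 4)"
  and su'_convergent: "\<exists>l. ((\<lambda>y. s y * u' y) \<longlongrightarrow> l) (at_left 4)"
  and sv'_convergent: "\<exists>l. ((\<lambda>y. s y * v' y) \<longlongrightarrow> l) (at_left 4)"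
proof -
  obtain C where C: "0 \<le> C" "\<And>y. 0 \<le> y \<Longrightarrow> y < 4 \<Longrightarrow> \<bar>u y\<bar> \<le> C * (1 - y / 4) powr (- \<kappa>)"
    "\<And>y. 0 \<le> y \<Longrightarrow> y < 4 \<Longrightarrow> \<bar>v y\<bar> \<le> C * (1 - y / 4) powr (- \<kappa>)"
    using UV_bound unfolding u_def v_def by blast
  show "((\<lambda>y. s y * u y) \<longlongrightarrow> 0) (at_left 4)" "((\<lambda>y. s y * v y) \<longlongrightarrow> 0) (at_left 4)"
    using C by (auto intro: s_mult_tendsto_4)
  define K where "K = (\<bar>m - 1/4\<bar> + \<bar>\<delta>\<bar> + 1) * C"
  have K: "0 \<le> K" using C by (simp add: K_def)
  have uv: "\<bar>jac u' u'' y\<bar> \<le> K * (1 - y / 4) powr (- \<kappa>)" "\<bar>jac v' v'' y\<bar> \<le> K * (1 - y / 4) powr (- \<kappa>)"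
    if y: "0 \<le> y" "y < 4" for y
  proof -
    define P where "P = C * (1 - y / 4) powr (- \<kappa>)"
    have P: "\<bar>u y\<bar> \<le> P" "\<bar>v y\<bar> \<le> P" "0 \<le> P" using C y by (auto simp: P_def)
    have i: "\<bar>c\<bar> * \<bar>u y\<bar> \<le> \<bar>c\<bar> * P" "\<bar>c\<bar> * \<bar>v y\<bar> \<le> \<bar>c\<bar> * P" for c
      using P by (auto intro: mult_left_mono)
    have "\<bar>jac u' u'' y\<bar> \<le> \<bar>m - 1/4\<bar> * P + \<bar>\<delta>\<bar> * P"
      using y abs_triangle_ineq[of "(m - 1/4) * u y" "\<delta> * v y"] i(1)[of "m - 1/4"] i(2)[of \<delta>]
      by (simp add: jac_uv abs_mult)
    also have "\<dots> \<le> (\<bar>m - 1/4\<bar> + \<bar>\<delta>\<bar> + 1) * P" using P by (simp add: algebra_simps)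
    finally show "\<bar>jac u' u'' y\<bar> \<le> K * (1 - y / 4) powr (- \<kappa>)" by (simp add: K_def P_def mult.assoc)
    have "\<bar>jac v' v'' y\<bar> \<le> \<bar>m - 1/4\<bar> * P + P"
      using y abs_triangle_ineq4[of "(m - 1/4) * v y" "u y"] i(2)[of "m - 1/4"] P
      by (simp add: jac_uv abs_mult)
    also have "\<dots> \<le> (\<bar>m - 1/4\<bar> + \<bar>\<delta>\<bar> + 1) * P" using P by (simp add: algebra_simps)
    finally show "\<bar>jac v' v'' y\<bar> \<le> K * (1 - y / 4) powr (- \<kappa>)" by (simp add: K_def P_def mult.assoc)
  qed
  show "\<exists>l. ((\<lambda>y. s y * u' y) \<longlongrightarrow> l) (at_left 4)" "\<exists>l. ((\<lambda>y. s y * v' y) \<longlongrightarrow> l) (at_left 4)"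
    using flux_limit[OF K uv(1)] flux_limit[OF K uv(2)] deriv_uv by blast+
qed

text \<open>The fluxes of \<open>u\<close> and \<open>v\<close> at 4. Values of \<open>u\<close> and
  \<open>v\<close> need not exist there, so all boundary information at 4 is expressed through these
  two numbers.\<close>

definition "\<sigma>u = (SOME l. ((\<lambda>y. s y * u' y) \<longlongrightarrow> l) (at_left 4))"
definition "\<sigma>v = (SOME l. ((\<lambda>y. s y * v' y) \<longlongrightarrow> l) (at_left 4))"

lemma \<sigma>u: "((\<lambda>y. s y * u' y) \<longlongrightarrow> \<sigma>u) (at_left 4)" and \<sigma>v: "((\<lambda>y. s y * v' y) \<longlongrightarrow> \<sigma>v) (at_left 4)"
  unfolding \<sigma>u_def \<sigma>v_def using su'_convergent sv'_convergent by (auto intro: someI_ex)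

lemma poly_conc_tendsto_4:
  "(conc (poly f) (poly (pderiv f)) u u' \<longlongrightarrow> - (poly f 4 * \<sigma>u)) (at_left 4)"
  "(conc (poly f) (poly (pderiv f)) v v' \<longlongrightarrow> - (poly f 4 * \<sigma>v)) (at_left 4)"
proof -
  have c: "(poly p \<longlongrightarrow> poly p 4) (at_left 4)" for p :: "real poly"
    using DERIV_isCont[OF poly_DERIV[of p 4]] unfolding isCont_def by (rule tendsto_mono[OF at_le, rotated]) simp
  have "((\<lambda>y. poly (pderiv f) y * (s y * u y) - poly f y * (s y * u' y)) \<longlongrightarrow>
      poly (pderiv f) 4 * 0 - poly f 4 * \<sigma>u) (at_left 4)"
    by (intro tendsto_diff tendsto_mult c su_tendsto_4 \<sigma>u)
  then show "(conc (poly f) (poly (pderiv f)) u u' \<longlongrightarrow> - (poly f 4 * \<sigma>u)) (at_left 4)"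
    by (simp add: conc_def[abs_def] algebra_simps)
  have "((\<lambda>y. poly (pderiv f) y * (s y * v y) - poly f y * (s y * v' y)) \<longlongrightarrow>
      poly (pderiv f) 4 * 0 - poly f 4 * \<sigma>v) (at_left 4)"
    by (intro tendsto_diff tendsto_mult c sv_tendsto_4 \<sigma>v)
  then show "(conc (poly f) (poly (pderiv f)) v v' \<longlongrightarrow> - (poly f 4 * \<sigma>v)) (at_left 4)"
    by (simp add: conc_def[abs_def] algebra_simps)
qed

lemma uv_tendsto_0:
  "(u \<longlongrightarrow> 1) (at_right 0)" "(v \<longlongrightarrow> 0) (at_right 0)"
  "(u' \<longlongrightarrow> u' 0) (at_right 0)" "(v' \<longlongrightarrow> v' 0) (at_right 0)"
  using deriv_uv[of 0, THEN DERIV_isCont] uv_at_0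
  by (auto simp: isCont_def intro: tendsto_mono[OF at_le])

end

section \<open>Two factors at once\<close>

text \<open>Covers \<open>(X - t) (X - t')\<close> for a pair \<open>t, t'\<close> of conjugate squares of zeros in the strip of half-width 1
  (\<open>\<delta> > 0\<close>) and for two numbers in \<open>(1/4, 1]\<close> (\<open>\<delta> \<le> 0\<close>); here \<open>t, t' = m \<plusminus> sqrt (- \<delta>)\<close>.\<close>

locale jacobi_pair = jacobi_series +
  assumes m_le: "m \<le> 1" and \<delta>_le: "\<delta> \<le> 4 * (1 - m)"
    and \<delta>_cases: "0 < \<delta> \<or> (1/4 < m \<and> - ((1 - m)\<^sup>2) \<le> \<delta> \<and> - ((m - 1/4)\<^sup>2) < \<delta>)"
begin

lemma eig_gap: "1 \<le> k \<Longrightarrow> 1 - m < eig k - m"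
proof -
  assume "1 \<le> k"
  then have "(3/2)\<^sup>2 \<le> (real k + 1/2)\<^sup>2" by (intro power_mono) auto
  then show ?thesis by (simp add: eig_def power2_eq_square)
qed

lemma quad_pos: "0 < (eig k - m)\<^sup>2 + \<delta>"
proof (cases "k = 0")
  case True
  have "(eig 0 - m)\<^sup>2 = (m - 1/4)\<^sup>2" by (simp add: eig_def power2_eq_square algebra_simps)
  with \<delta>_cases True show ?thesis by (auto intro: add_nonneg_pos)
next
  case False
  then have "(1 - m)\<^sup>2 < (eig k - m)\<^sup>2"
    using eig_gap[of k] m_le by (intro power_strict_mono) auto
  then show ?thesis using \<delta>_cases by (auto simp: add_nonneg_pos)
qed

text \<open>For \<theta>^2 = - \<delta>, the number U k + \<theta> V k is the product of
  \<open>eig j - m + \<theta>\<close> over j < k. The expression here is the norm of that product,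
  hence a product of the positive numbers in \<open>quad_pos\<close>.\<close>

lemma UV_norm_pos: "0 < (U k)\<^sup>2 + \<delta> * (V k)\<^sup>2"
proof (induction k)
  case (Suc k)
  have "(U (Suc k))\<^sup>2 + \<delta> * (V (Suc k))\<^sup>2 = ((eig k - m)\<^sup>2 + \<delta>) * ((U k)\<^sup>2 + \<delta> * (V k)\<^sup>2)"
    by (simp add: U_Suc V_Suc power2_eq_square algebra_simps)
  then show ?case using quad_pos[of k] Suc by simp
qed simp

text \<open>The lower bound for \<open>U / V\<close> is attained for \<open>\<delta> = 4 (1 - m)\<close>, that is, for zeros on the
  boundary of the strip of half-width 1.\<close>

lemma V_pos_aux: "0 < V (Suc j) \<and>
  0 \<le> (real j + 1) * U (Suc j) + ((real j + 1)\<^sup>2 - (5/4 - m)) * V (Suc j)"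
proof (induction j)
  case 0
  show ?case by (simp add: U_Suc V_Suc eig_def power2_eq_square)
next
  case (Suc j)
  define k where "k = real j + 1"
  define \<mu> where "\<mu> = eig (Suc j) - m"
  define c where "c = 5/4 - m"
  have k: "1 \<le> k" by (simp add: k_def)
  have \<mu>: "\<mu> = k\<^sup>2 + k - 1 + c" by (simp add: \<mu>_def k_def c_def eig_def power2_eq_square algebra_simps)
  have c: "1/4 \<le> c" using m_le by (simp add: c_def)
  have IH: "0 < V (Suc j)" "0 \<le> k * U (Suc j) + (k\<^sup>2 - c) * V (Suc j)"
    using Suc by (simp_all add: k_def c_def)
  have V': "V (Suc (Suc j)) = \<mu> * V (Suc j) + U (Suc j)" and U': "U (Suc (Suc j)) = \<mu> * U (Suc j) - \<delta> * V (Suc j)"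
    by (simp_all add: U_Suc[of "Suc j"] V_Suc[of "Suc j"] \<mu>_def)
  have kk: "k \<le> k\<^sup>2" "k\<^sup>2 \<le> k ^ 3" using k by (simp_all add: power2_eq_square power3_eq_cube)
  have "k * V (Suc (Suc j)) = (k * U (Suc j) + (k\<^sup>2 - c) * V (Suc j)) + (k * \<mu> - k\<^sup>2 + c) * V (Suc j)"
    by (simp add: V' algebra_simps)
  moreover have "0 < k * \<mu> - k\<^sup>2 + c"
  proof -
    have "k * \<mu> - k\<^sup>2 + c = k ^ 3 - k + c * k + c" by (simp add: \<mu> power2_eq_square power3_eq_cube algebra_simps)
    moreover have "0 \<le> c * k" using c k by simp
    ultimately show ?thesis using kk c by linarith
  qed
  ultimately have "0 < k * V (Suc (Suc j))" using IH by (simp add: add_nonneg_pos)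
  then have Vp: "0 < V (Suc (Suc j))" using k by (simp add: zero_less_mult_iff)
  define P where "P = (k + 1) * \<mu> + (k + 1)\<^sup>2 - c"
  have P: "0 \<le> P"
  proof -
    have "P = k ^ 3 + 3 * k\<^sup>2 + 2 * k + c * k" by (simp add: P_def \<mu> power2_eq_square power3_eq_cube algebra_simps)
    then show ?thesis using kk c k by simp
  qed
  \<comment> \<open>\<open>P\<close> is the coefficient that matches the terms with
    \<open>U\<close>. The remaining coefficient of \<open>V\<close> contains 4 (1 - m) - \<delta>,
    which for t = (x + i y)^2 equals 4 (1 - x^2)(1 + y^2).\<close>
  have "k * ((k + 1) * U (Suc (Suc j)) + ((k + 1)\<^sup>2 - c) * V (Suc (Suc j)))
      = P * (k * U (Suc j) + (k\<^sup>2 - c) * V (Suc j)) + k * (k + 1) * (4 * (1 - m) - \<delta>) * V (Suc j)"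
    unfolding U' V' P_def \<mu> c_def by (simp add: power2_eq_square field_simps)
  moreover have "0 \<le> P * (k * U (Suc j) + (k\<^sup>2 - c) * V (Suc j))" by (rule mult_nonneg_nonneg[OF P IH(2)])
  moreover have "0 \<le> k * (k + 1) * (4 * (1 - m) - \<delta>) * V (Suc j)"
    using k \<delta>_le IH(1) by (intro mult_nonneg_nonneg) auto
  ultimately have "0 \<le> k * ((k + 1) * U (Suc (Suc j)) + ((k + 1)\<^sup>2 - c) * V (Suc (Suc j)))" by linarith
  then have "0 \<le> (k + 1) * U (Suc (Suc j)) + ((k + 1)\<^sup>2 - c) * V (Suc (Suc j))"
    using k by (simp add: zero_le_mult_iff)
  with Vp show ?case by (simp add: k_def c_def algebra_simps)
qed

lemma V_pos: "1 \<le> k \<Longrightarrow> 0 < V k"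
  using V_pos_aux[of "k - 1"] by simp

lemma V_nonneg: "0 \<le> V k"
  using V_pos[of k] by (cases "k = 0") auto

text \<open>The quotients U / V decrease strictly, since for neighbours the cross difference is U^2
  + \<delta> V^2. The case j = 0 is separate because \<open>V 0 = 0\<close>.\<close>

lemma UV_cross: "j < k \<Longrightarrow> 0 < U j * V k - U k * V j"
proof (cases "j = 0")
  case False
  assume "j < k"
  have dec: "U (Suc i) / V (Suc i) < U i / V i" if "1 \<le> i" for i
  proof -
    have "U i * V (Suc i) - U (Suc i) * V i = (U i)\<^sup>2 + \<delta> * (V i)\<^sup>2"
      by (simp add: U_Suc V_Suc power2_eq_square algebra_simps)
    with UV_norm_pos[of i] V_pos[of i] V_pos[of "Suc i"] that show ?thesis
      by (simp add: field_simps)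
  qed
  have "U k / V k < U j / V j"
    using \<open>j < k\<close>
  proof (induction k)
    case (Suc k)
    show ?case
    proof (cases "j = k")
      case True
      then show ?thesis using dec[of k] False by simp
    next
      case False
      then show ?thesis using Suc dec[of k] \<open>j \<noteq> 0\<close> by fastforce
    qed
  qed simp
  then show ?thesis using V_pos[of j] V_pos[of k] False \<open>j < k\<close> by (simp add: field_simps)
qed (use V_pos in simp)

definition "\<omega> y = u y * v' y - u' y * v y"

definition "Wf = Uf * fps_deriv Vf - fps_deriv Uf * Vf"

text \<open>Averaging the convolution sum for the Wronskian with its reversal gives the terms (N -
  2i)(a_i b_(N-i) - a_(N-i) b_i), all nonnegative by \<open>UV_cross\<close>. The terms i = 0 and i
  = N alone yield the derivative of \<open>Vf\<close>. Keeping i = 1 and i = N - 1 as well gives the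
  sharper bound, which is needed when the flux of \<open>v\<close> at 4 vanishes.\<close>

lemma nth_Wf_lower:
  "fps_nth (fps_deriv Vf) n + (real n - 1) * (fps_nth Uf 1 * fps_nth Vf n - fps_nth Vf 1 * (if n = 0 then 0 else fps_nth Uf n))
     \<le> fps_nth Wf n" (is "_ + ?extra \<le> _")
  "fps_nth (fps_deriv Vf) n \<le> fps_nth Wf n"
proof -
  define a where "a = fps_nth Uf"
  define b where "b = fps_nth Vf"
  define N where "N = Suc n"
  define T where "T i = (real N - 2 * real i) * (a i * b (N - i) - a (N - i) * b i)" for i
  have ab: "0 < a i * b j - a j * b i" if "i < j" for i j
  proof -
    have "a i * b j - a j * b i = \<gamma> i * \<gamma> j * (U i * V j - U j * V i)"
      by (simp add: a_def b_def Uf_def Vf_def algebra_simps)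
    then show ?thesis using UV_cross[OF that] \<gamma>_pos by simp
  qed
  have a0: "a 0 = 1" "b 0 = 0" by (simp_all add: a_def b_def Uf_def Vf_def)
  have T0: "0 \<le> T i" if "i \<le> N" for i
  proof (cases "i = N - i")
    case False
    then consider "i < N - i" | "N - i < i" by linarith
    then show ?thesis
    proof cases
      case 1
      then show ?thesis using ab[of i "N - i"] by (auto simp: T_def intro!: mult_nonneg_nonneg)
    next
      case 2
      then show ?thesis using ab[of "N - i" i] that
        by (auto simp: T_def of_nat_diff intro!: mult_nonpos_nonpos)
    qed
  qed (simp add: T_def)
  have "fps_nth Wf n = (\<Sum>i\<le>n. a i * (real (N - i) * b (N - i))) - (\<Sum>i\<le>n. real (Suc i) * a (Suc i) * b (N - Suc i))"
    by (simp add: Wf_def fps_mult_nth a_def b_def N_def Suc_diff_le atLeast0AtMost)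
  also have "(\<Sum>i\<le>n. a i * (real (N - i) * b (N - i))) = (\<Sum>i\<le>N. (real N - real i) * (a i * b (N - i)))"
    unfolding N_def sum.atMost_Suc by (simp add: of_nat_diff algebra_simps)
  also have "(\<Sum>i\<le>n. real (Suc i) * a (Suc i) * b (N - Suc i)) = (\<Sum>i\<le>N. real i * (a i * b (N - i)))"
    unfolding N_def sum.atMost_Suc_shift by (simp add: mult.assoc)
  also have "(\<Sum>i\<le>N. (real N - real i) * (a i * b (N - i))) - (\<Sum>i\<le>N. real i * (a i * b (N - i)))
      = (\<Sum>i\<le>N. (real N - 2 * real i) * (a i * b (N - i)))" (is "_ = ?S")
    by (simp add: sum_subtractf[symmetric] algebra_simps)
  finally have W: "fps_nth Wf n = ?S" .
  have "?S = (\<Sum>i\<le>N. (2 * real i - real N) * (a (N - i) * b i))"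
    by (rule sum.reindex_bij_witness[of _ "\<lambda>i. N - i" "\<lambda>i. N - i"]) (auto simp: of_nat_diff)
  then have "2 * fps_nth Wf n = ?S + (\<Sum>i\<le>N. (2 * real i - real N) * (a (N - i) * b i))"
    using W by simp
  then have W2: "2 * fps_nth Wf n = (\<Sum>i\<le>N. T i)"
    unfolding sum.distrib[symmetric] T_def by (simp add: algebra_simps)
  have T0N: "T 0 = real N * b N" "T N = real N * b N" using a0 by (simp_all add: T_def algebra_simps)
  have "sum T {0, N} \<le> (\<Sum>i\<le>N. T i)" using T0 by (intro sum_mono2) auto
  then show l: "fps_nth (fps_deriv Vf) n \<le> fps_nth Wf n"
    using W2 T0N by (simp add: N_def b_def)
  show "fps_nth (fps_deriv Vf) n + ?extra \<le> fps_nth Wf n"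
  proof (cases "n \<le> 1")
    case True
    then consider "n = 0" | "n = 1" by linarith
    then show ?thesis using l a0 by cases (auto simp: a_def b_def)
  next
    case False
    have "sum T {0, N, 1, n} \<le> (\<Sum>i\<le>N. T i)" using T0 False by (intro sum_mono2) (auto simp: N_def)
    moreover have "T 1 = (real n - 1) * (a 1 * b n - a n * b 1)" "T n = (real n - 1) * (a 1 * b n - a n * b 1)"
      using False by (simp_all add: T_def N_def algebra_simps)
    ultimately show ?thesis using W2 T0N False by (simp add: N_def a_def b_def algebra_simps)
  qed
qed

lemma conv4_Wf [simp, intro]: "conv4 Wf"
  by (auto simp: Wf_def)

lemma eval_Wf: "\<bar>y\<bar> < 4 \<Longrightarrow> eval_fps Wf y = \<omega> y"
  by (simp add: Wf_def \<omega>_def u_def u'_def v_def v'_def eval_conv4)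

lemma v_pos: "0 < y \<Longrightarrow> y < 4 \<Longrightarrow> 0 < v y"
  unfolding v_def by (rule eval_fps_pos[of Vf y 1])
    (use \<gamma>_pos V_nonneg V_pos[of 1] in \<open>auto simp: nth_Vf less_imp_le\<close>)

lemma v'_pos: "0 \<le> y \<Longrightarrow> y < 4 \<Longrightarrow> 0 < v' y"
proof (cases "y = 0")
  case False
  assume "0 \<le> y" "y < 4"
  then show ?thesis unfolding v'_def using False
    by (intro eval_fps_pos[of "fps_deriv Vf" y 0])
      (use \<gamma>_pos V_nonneg V_pos[of 1] in \<open>auto simp: nth_Vf less_imp_le simp del: V_0\<close>)
qed (use nu in \<open>simp add: uv_at_0\<close>)

lemma \<omega>_ge_v': "0 \<le> y \<Longrightarrow> y < 4 \<Longrightarrow> v' y \<le> \<omega> y"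
  using eval_fps_mono[of "fps_deriv Vf" Wf y] nth_Wf_lower(2) by (simp add: eval_Wf v'_def)

lemma \<omega>_pos: "0 \<le> y \<Longrightarrow> y < 4 \<Longrightarrow> 0 < \<omega> y"
  using \<omega>_ge_v'[of y] v'_pos[of y] by simp

lemma \<omega>_lower:
  assumes "0 \<le> y" "y < 4"
  shows "v' y + (u' 0 * (y * v' y - v y) - v' 0 * (y * u' y - u y + 1)) \<le> \<omega> y"
proof -
  \<comment> \<open>The last \<open>fps_const 1\<close> cancels the constant term of
    \<open>Uf\<close>; it corresponds to the case \<open>n = 0\<close> in
    \<open>nth_Wf_lower\<close>.\<close>
  define Z where "Z = fps_deriv Vf + (fps_const (fps_nth Uf 1) * (fps_X * fps_deriv Vf - Vf)
      - fps_const (fps_nth Vf 1) * (fps_X * fps_deriv Uf - Uf + fps_const 1))"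
  have "fps_nth Z n \<le> fps_nth Wf n" for n
  proof -
    have "fps_nth Z n = fps_nth (fps_deriv Vf) n + (real n - 1) * (fps_nth Uf 1 * fps_nth Vf n - fps_nth Vf 1 * (if n = 0 then 0 else fps_nth Uf n))"
      by (cases n) (simp_all add: Z_def nth_Uf nth_Vf algebra_simps)
    with nth_Wf_lower(1)[of n] show ?thesis by simp
  qed
  moreover have "conv4 Z" unfolding Z_def by (intro conv4_simps conv4_Uf conv4_Vf)
  ultimately have "eval_fps Z y \<le> eval_fps Wf y"
    using assms by (intro eval_fps_mono) auto
  moreover have "u' 0 = fps_nth Uf 1" "v' 0 = fps_nth Vf 1"
    by (simp_all add: u'_def v'_def eval_fps_at_0)
  moreover have "eval_fps Z y = v' y + (fps_nth Uf 1 * (y * v' y - v y) - fps_nth Vf 1 * (y * u' y - u y + 1))"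
    using assms unfolding Z_def u_def v_def u'_def v'_def
    by (simp add: eval_conv4 del: fps_const_1_eq_1)
  ultimately show ?thesis using assms by (simp add: eval_Wf)
qed

end

section \<open>Boundary data at 4 for a pair\<close>

context jacobi_pair
begin

lemma eventually_near_4: "a < 4 \<Longrightarrow> eventually (\<lambda>y::real. a < y \<and> y < 4) (at_left 4)"
  using eventually_at_left_real[of a 4] by (auto elim: eventually_mono)

lemma \<sigma>v_nonneg: "0 \<le> \<sigma>v"
proof (rule tendsto_lowerbound[OF \<sigma>v])
  show "eventually (\<lambda>y. 0 \<le> s y * v' y) (at_left 4)"
    using eventually_near_4[of 0, simplified]
    by eventually_elim (use s_pos v'_pos in \<open>auto intro!: mult_nonneg_nonneg less_imp_le\<close>)
qed simp

lemma deriv_ratio: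
  assumes "0 < y" "y < 4"
  shows "((\<lambda>y. u y / v y) has_real_derivative - (\<omega> y / (v y)\<^sup>2)) (at y)"
  using assms v_pos[of y] deriv_uv[of y]
  by (auto intro!: derivative_eq_intros simp: \<omega>_def power2_eq_square field_simps)

text \<open>As \<omega> > 0, the quotient u / v decreases and dominates u' / v'. Hence u' <= r v'
  near 4 with a constant r, and the factor \<open>s\<close> turns this into an inequality of
  fluxes.\<close>

lemma \<sigma>u_le: "\<sigma>v = 0 \<Longrightarrow> \<sigma>u \<le> 0"
proof -
  assume z: "\<sigma>v = 0"
  define r where "r = u 2 / v 2"
  have ev: "eventually (\<lambda>y. 0 \<le> r * (s y * v' y) - s y * u' y) (at_left 4)"
    using eventually_near_4[of 2, simplified]
  proof eventually_elim
    case (elim y)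
    have "u y / v y \<le> r" unfolding r_def
    proof (rule DERIV_nonpos_imp_nonincreasing[where f = "\<lambda>y. u y / v y"])
      show "\<exists>l. ((\<lambda>y. u y / v y) has_real_derivative l) (at t) \<and> l \<le> 0" if "2 \<le> t" "t \<le> y" for t
        using deriv_ratio[of t] \<omega>_pos[of t] that elim
        by (intro exI[of _ "- (\<omega> t / (v t)\<^sup>2)"]) (auto intro!: divide_nonneg_nonneg)
    qed (use elim in simp)
    then have uv: "u y \<le> r * v y" using v_pos[of y] elim by (simp add: field_simps)
    have "u' y * v y \<le> u y * v' y" using \<omega>_pos[of y] elim by (simp add: \<omega>_def)
    also have "\<dots> \<le> (r * v y) * v' y"
      using uv v'_pos[of y] elim by (intro mult_right_mono) auto
    finally have "u' y * v y \<le> (r * v' y) * v y" by (simp add: mult_ac)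
    then have "u' y \<le> r * v' y" using v_pos[of y] elim by (simp add: mult_le_cancel_right)
    then have "0 \<le> s y * (r * v' y - u' y)" using s_pos[of y] elim by simp
    then show ?case by (simp add: algebra_simps)
  qed
  have "((\<lambda>y. r * (s y * v' y) - s y * u' y) \<longlongrightarrow> r * \<sigma>v - \<sigma>u) (at_left 4)"
    by (intro tendsto_intros \<sigma>u \<sigma>v)
  from tendsto_lowerbound[OF this ev] z show ?thesis by simp
qed

text \<open>u + d v is the solution for the single parameter m - d in (1/4, 1]. In the products of
  \<open>eig j - (m - d)\<close> the factor with j = 0 is negative and all others are positive, so
  every Taylor coefficient after the first is negative.\<close>

lemma real_branch:
  assumes "\<delta> \<le> 0" "d = sqrt (- \<delta>) \<or> d = - sqrt (- \<delta>)" "0 \<le> y" "y < 4"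
  shows "u' y + d * v' y < 0"
proof -
  have d2: "d * d = - \<delta>" using assms by auto
  have mb: "1/4 < m" "sqrt (- \<delta>) \<le> 1 - m" "sqrt (- \<delta>) < m - 1/4"
  proof -
    show "1/4 < m" using \<delta>_cases assms by auto
    have "- \<delta> \<le> (1 - m)\<^sup>2" "- \<delta> < (m - 1/4)\<^sup>2" using \<delta>_cases assms by auto
    then have "sqrt (- \<delta>) \<le> sqrt ((1 - m)\<^sup>2)" "sqrt (- \<delta>) < sqrt ((m - 1/4)\<^sup>2)"
      by (simp_all only: real_sqrt_le_iff real_sqrt_less_iff)
    then show "sqrt (- \<delta>) \<le> 1 - m" "sqrt (- \<delta>) < m - 1/4" using m_le \<open>1/4 < m\<close> by simp_all
  qed
  have q: "0 \<le> sqrt (- \<delta>)" using assms(1) by simp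
  have t: "1/4 < m - d" "m - d \<le> 1"
    by (rule disjE[OF assms(2)]; use mb q in linarith)+
  have step: "U (Suc k) + d * V (Suc k) = (eig k - (m - d)) * (U k + d * V k)" for k
  proof -
    have "\<delta> = - (d * d)" using d2 by simp
    then show ?thesis unfolding U_Suc V_Suc by (simp add: algebra_simps)
  qed
  have neg: "U (Suc k) + d * V (Suc k) < 0" for k
  proof (induction k)
    case 0
    then show ?case using t by (simp add: step eig_def power2_eq_square)
  next
    case (Suc k)
    have "0 < eig (Suc k) - (m - d)" using eig_gap[of "Suc k"] t by (simp add: eig_def power2_eq_square algebra_simps add_nonneg_pos)
    then show ?case unfolding step[of "Suc k"] using Suc by (rule mult_pos_neg)
  qed
  define f where "f = fps_deriv (fps_const (-1) * (Uf + fps_const d * Vf))"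
  have "conv4 f" by (simp add: f_def)
  have f: "fps_nth f k = (real k + 1) * \<gamma> (Suc k) * - (U (Suc k) + d * V (Suc k))" for k
    by (simp add: f_def nth_Uf nth_Vf algebra_simps)
  have fp: "0 < fps_nth f k" for k
    unfolding f using \<gamma>_pos[of "Suc k"] neg[of k] by (intro mult_pos_pos) auto
  have "0 < eval_fps f y"
  proof (cases "y = 0")
    case False
    then show ?thesis using fp assms by (intro eval_fps_pos[OF \<open>conv4 f\<close>, of y 0]) (auto intro: less_imp_le)
  qed (use fp in \<open>simp add: eval_fps_at_0\<close>)
  moreover have "f = fps_const (-1) * (fps_deriv Uf + fps_const d * fps_deriv Vf)"
    by (simp add: f_def)
  then have "eval_fps f y = - (u' y + d * v' y)"
    using assms by (simp add: eval_conv4 u'_def v'_def)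
  ultimately show ?thesis by simp
qed

text \<open>For \<delta> < 0 the form splits into (\<sigma>u + d \<sigma>v)(\<sigma>u - d \<sigma>v)
  with d^2 = - \<delta>, and by \<open>real_branch\<close> neither factor is positive.\<close>

lemma \<sigma>_form_nonneg: "0 \<le> \<delta> * \<sigma>v\<^sup>2 + \<sigma>u\<^sup>2"
proof (cases "0 \<le> \<delta>")
  case False
  define d where "d = sqrt (- \<delta>)"
  have le: "\<sigma>u + c * \<sigma>v \<le> 0" if "c = d \<or> c = - d" for c
  proof (rule tendsto_upperbound)
    show "((\<lambda>y. s y * u' y + c * (s y * v' y)) \<longlongrightarrow> \<sigma>u + c * \<sigma>v) (at_left 4)"
      by (intro tendsto_intros \<sigma>u \<sigma>v)
    show "eventually (\<lambda>y. s y * u' y + c * (s y * v' y) \<le> 0) (at_left 4)"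
      using eventually_near_4[of 0, simplified]
    proof eventually_elim
      case (elim y)
      then have "s y * (u' y + c * v' y) \<le> 0"
        using real_branch[of c y] that False s_pos[of y] by (intro mult_nonneg_nonpos) (auto simp: d_def)
      then show ?case by (simp add: algebra_simps)
    qed
  qed simp
  have "0 \<le> (\<sigma>u + d * \<sigma>v) * (\<sigma>u + - d * \<sigma>v)"
    using le[of d] le[of "- d"] by (intro mult_nonpos_nonpos) auto
  also have "\<dots> = \<delta> * \<sigma>v\<^sup>2 + \<sigma>u\<^sup>2"
  proof -
    have "\<delta> = - (d * d)" using False by (simp add: d_def)
    then show ?thesis by (simp add: power2_eq_square algebra_simps)
  qed
  finally show ?thesis .
qed simp

text \<open>Otherwise an eigenfunction with eigenvalue between those of \<open>P\<^sub>0\<close> and \<open>P\<^sub>1\<close> and with one sign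
  change would be orthogonal to both.\<close>

lemma \<sigma>_not_both_0:
  assumes "\<delta> \<le> 0"
  shows "\<not> (\<sigma>u = 0 \<and> \<sigma>v = 0)"
proof
  assume z: "\<sigma>u = 0 \<and> \<sigma>v = 0"
  define d where "d = sqrt (- \<delta>)"
  have d2: "d * d = - \<delta>" and d0: "0 \<le> d" using assms by (simp_all add: d_def)
  define \<phi> where "\<phi> y = u y + d * v y" for y
  define \<phi>' where "\<phi>' y = u' y + d * v' y" for y
  define \<phi>'' where "\<phi>'' y = u'' y + d * v'' y" for y
  define \<tau> where "\<tau> = m - d - 1/4"
  have \<tau>: "0 < \<tau>" "\<tau> < 2"
  proof -
    have "- \<delta> < (m - 1/4)\<^sup>2" "1/4 < m" using \<delta>_cases assms by auto
    then have "sqrt (- \<delta>) < sqrt ((m - 1/4)\<^sup>2)" by (simp only: real_sqrt_less_iff)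
    then show "0 < \<tau>" using \<open>1/4 < m\<close> by (simp add: \<tau>_def d_def)
    show "\<tau> < 2" using m_le d0 by (simp add: \<tau>_def)
  qed
  have D: "(\<phi> has_real_derivative \<phi>' y) (at y)" "(\<phi>' has_real_derivative \<phi>'' y) (at y)" if "\<bar>y\<bar> < 4" for y
    unfolding \<phi>_def[abs_def] \<phi>'_def[abs_def] \<phi>''_def using deriv_uv[OF that]
    by (auto intro!: derivative_eq_intros)
  have J: "jac \<phi>' \<phi>'' y = \<tau> * \<phi> y" if "\<bar>y\<bar> < 4" for y
  proof -
    have "jac \<phi>' \<phi>'' y = jac u' u'' y + d * jac v' v'' y"
      by (simp add: jac_def \<phi>'_def \<phi>''_def algebra_simps)
    also have "\<dots> = (m - 1/4) * \<phi> y - d * u y + \<delta> * v y"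
      by (simp only: jac_uv[OF that]) (simp add: \<phi>_def algebra_simps)
    also have "\<delta> * v y = - (d * (d * v y))" using arg_cong[OF d2, of "\<lambda>x. x * v y"] by simp
    finally show ?thesis by (simp add: \<tau>_def \<phi>_def algebra_simps)
  qed
  have neg: "\<phi>' y < 0" if "0 \<le> y" "y < 4" for y
    using real_branch[of d y] assms that by (simp add: \<phi>'_def d_def)
  have dec: "\<phi> b < \<phi> a" if "0 \<le> a" "a < b" "b < 4" for a b
    using DERIV_neg_imp_decreasing[of a b \<phi>] D neg that by fastforce
  have \<phi>0: "\<phi> 0 = 1" by (simp add: \<phi>_def uv_at_0)
  \<comment> \<open>The sign change of the decreasing function \<open>\<phi>\<close>; the value 4
    stands for none.\<close>
  obtain y1 where y1: "0 < y1" "y1 \<le> 4" "\<And>y. 0 < y \<Longrightarrow> y < y1 \<Longrightarrow> 0 < \<phi> y"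
    "\<And>y. y1 < y \<Longrightarrow> y < 4 \<Longrightarrow> \<phi> y < 0"
  proof (cases "\<exists>b>0. b < 4 \<and> \<phi> b \<le> 0")
    case True
    then obtain b where b: "0 < b" "b < 4" "\<phi> b \<le> 0" by blast
    have "\<exists>x. 0 \<le> x \<and> x \<le> b \<and> \<phi> x = 0"
    proof (rule IVT2)
      show "\<forall>x. 0 \<le> x \<and> x \<le> b \<longrightarrow> isCont \<phi> x" using b D DERIV_isCont by force
    qed (use b \<phi>0 in auto)
    then obtain x where x: "0 \<le> x" "x \<le> b" "\<phi> x = 0" by blast
    with \<phi>0 have "0 < x" by (cases "x = 0") auto
    show ?thesis
    proof (rule that[of x])
      show "0 < \<phi> y" if "0 < y" "y < x" for y using dec[of y x] that x b by simp
      show "\<phi> y < 0" if "x < y" "y < 4" for y using dec[of x y] that x by simp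
    qed (use \<open>0 < x\<close> x b in auto)
  next
    case False
    then show ?thesis using that[of 4] by force
  qed
  \<comment> \<open>\<open>y - 2 * \<nu>\<close> is the monic eigenpolynomial of degree 1, with
    J-eigenvalue 2. The constant \<theta> is the one for which the concomitant of \<phi> with y -
    2\<nu> + \<theta> has a derivative proportional to w \<phi> (y - y1), an expression of one
    sign.\<close>
  define \<theta> where "\<theta> = (2 - \<tau>) * (y1 - 2 * \<nu>) / \<tau>"
  define H where "H y = conc \<phi> \<phi>' (\<lambda>y. y - 2 * \<nu>) (\<lambda>_. 1) y + \<theta> * conc \<phi> \<phi>' (\<lambda>_. 1) (\<lambda>_. 0) y" for y
  define H' where "H' y = (2 - \<tau>) * (w y * (\<phi> y * (y - y1)))" for y
  have DH: "(H has_real_derivative H' y) (at y)" if y: "0 < y" "y < 4" for y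
  proof -
    have A: "(conc \<phi> \<phi>' (\<lambda>y. y - 2 * \<nu>) (\<lambda>_. 1) has_real_derivative
        - (w y * ((y - 2 * \<nu>) * jac \<phi>' \<phi>'' y - \<phi> y * jac (\<lambda>_. 1) (\<lambda>_. 0) y))) (at y)"
      using y D[of y] by (intro deriv_conc) (auto intro!: derivative_eq_intros)
    have B: "(conc \<phi> \<phi>' (\<lambda>_. 1) (\<lambda>_. 0) has_real_derivative
        - (w y * (1 * jac \<phi>' \<phi>'' y - \<phi> y * jac (\<lambda>_. 0) (\<lambda>_. 0) y))) (at y)"
      using y D[of y] by (intro deriv_conc) auto
    have j: "jac (\<lambda>_. 1) (\<lambda>_. 0) y = 2 * y - 4 * \<nu>" "jac (\<lambda>_. 0) (\<lambda>_. 0) y = 0"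
      by (simp_all add: jac_def)
    have "(H has_real_derivative - (w y * ((y - 2 * \<nu>) * (\<tau> * \<phi> y) - \<phi> y * (2 * y - 4 * \<nu>)))
        + \<theta> * - (w y * (\<tau> * \<phi> y))) (at y)"
      unfolding H_def[abs_def] using DERIV_add[OF A DERIV_cmult[OF B, of \<theta>]] J[of y] y by (simp add: j)
    also have "- (w y * ((y - 2 * \<nu>) * (\<tau> * \<phi> y) - \<phi> y * (2 * y - 4 * \<nu>))) + \<theta> * - (w y * (\<tau> * \<phi> y))
        = w y * \<phi> y * ((2 - \<tau>) * (y - 2 * \<nu>) - \<theta> * \<tau>)" by (simp add: algebra_simps)
    also have "\<theta> * \<tau> = (2 - \<tau>) * (y1 - 2 * \<nu>)" using \<tau> by (simp add: \<theta>_def)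
    finally show ?thesis by (simp add: H'_def algebra_simps)
  qed
  have H'n: "H' y \<le> 0" if "0 < y" "y < 4" for y
  proof -
    have "\<phi> y * (y - y1) \<le> 0"
      using y1(3)[of y] y1(4)[of y] that by (cases y y1 rule: linorder_cases) (auto simp: mult_le_0_iff)
    then have "w y * (\<phi> y * (y - y1)) \<le> 0"
      by (rule mult_nonneg_nonpos[OF less_imp_le[OF w_pos[OF that]]])
    with \<tau> show ?thesis unfolding H'_def by (rule_tac mult_nonneg_nonpos) auto
  qed
  have Hd: "H b \<le> H a" if "0 < a" "a \<le> b" "b < 4" for a b
    using DERIV_nonpos_imp_nonincreasing[of a b H] DH H'n that by fastforce
  have H0: "(H \<longlongrightarrow> 0) (at_right 0)"
  proof -
    have "((\<lambda>y. s y * ((u' y + d * v' y) * (y - 2 * \<nu>) - (u y + d * v y) * 1) + \<theta> * (s y * (u' y + d * v' y)))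
        \<longlongrightarrow> 0 * ((u' 0 + d * v' 0) * (0 - 2 * \<nu>) - (1 + d * 0) * 1) + \<theta> * (0 * (u' 0 + d * v' 0))) (at_right 0)"
      by (intro tendsto_intros s_tendsto_0 uv_tendsto_0)
    then show ?thesis by (simp add: H_def[abs_def] conc_def \<phi>_def \<phi>'_def)
  qed
  have H4: "(H \<longlongrightarrow> 0) (at_left 4)"
  proof -
    have "((\<lambda>y. (s y * u' y + d * (s y * v' y)) * (y - 2 * \<nu>) - (s y * u y + d * (s y * v y)) + \<theta> * (s y * u' y + d * (s y * v' y)))
        \<longlongrightarrow> (\<sigma>u + d * \<sigma>v) * (4 - 2 * \<nu>) - (0 + d * 0) + \<theta> * (\<sigma>u + d * \<sigma>v)) (at_left 4)"
      by (intro tendsto_intros \<sigma>u \<sigma>v su_tendsto_4 sv_tendsto_4)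
    then show ?thesis using z by (simp add: H_def[abs_def] conc_def \<phi>_def \<phi>'_def algebra_simps)
  qed
  define a where "a = y1 / 3"
  define b where "b = y1 / 2"
  have ab: "0 < a" "a < b" "b < y1" "b < 4" using y1 by (auto simp: a_def b_def)
  have "H b < H a"
  proof (rule DERIV_neg_imp_decreasing[where f = H])
    show "\<exists>l. (H has_real_derivative l) (at t) \<and> l < 0" if "a \<le> t" "t \<le> b" for t
    proof (intro exI conjI)
      show "(H has_real_derivative H' t) (at t)" using that ab by (intro DH) auto
      have "0 < \<phi> t" using y1(3)[of t] that ab by auto
      then show "H' t < 0" using that ab w_pos[of t] \<tau>
        by (auto simp: H'_def mult_less_0_iff zero_less_mult_iff)
    qed
  qed fact
  moreover have "H a \<le> 0"
  proof (rule tendsto_lowerbound[OF H0])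
    show "eventually (\<lambda>y. H a \<le> H y) (at_right 0)"
      using eventually_at_right_real[OF ab(1)] by eventually_elim (use Hd ab in auto)
  qed simp
  moreover have "0 \<le> H b"
  proof (rule tendsto_upperbound[OF H4])
    show "eventually (\<lambda>y. H y \<le> H b) (at_left 4)"
      using eventually_near_4[OF ab(4)] by eventually_elim (use Hd ab in auto)
  qed simp
  ultimately show False by simp
qed

lemma deriv_s\<omega>:
  assumes "0 < y" "y < 4"
  shows "((\<lambda>y. s y * \<omega> y) has_real_derivative w y * ((u y)\<^sup>2 + \<delta> * (v y)\<^sup>2)) (at y)"
proof -
  have "(conc v v' u u' has_real_derivative - (w y * (u y * jac v' v'' y - v y * jac u' u'' y))) (at y)"
    using assms deriv_uv[of y] by (intro deriv_conc) auto
  then show ?thesis using assms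
    by (simp add: conc_def[abs_def] \<omega>_def[abs_def] jac_uv power2_eq_square algebra_simps)
qed

text \<open>\<open>s y * \<omega> y\<close> is the denominator of \<open>F\<close> in
  \<open>sign_changes_pair\<close>, and this bound lets the sign of the numerator at 4 pass to
  \<open>F\<close>. For \<delta> > 0 the product is nondecreasing. Otherwise it is compared with s
  v', or, if \<sigma>v = 0, with the bound of \<open>\<omega>_lower\<close>, whose limit is then - 4
  v'(0) \<sigma>u > 0.\<close>

lemma s\<omega>_lower: "\<exists>\<epsilon>>0. eventually (\<lambda>y. \<epsilon> \<le> s y * \<omega> y) (at_left 4)"
proof (cases "0 < \<delta>")
  case True
  have "eventually (\<lambda>y. s 2 * \<omega> 2 \<le> s y * \<omega> y) (at_left 4)"
    using eventually_near_4[of 2, simplified]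
  proof eventually_elim
    case (elim y)
    show ?case
    proof (rule DERIV_nonneg_imp_nondecreasing[where f = "\<lambda>y. s y * \<omega> y"])
      show "\<exists>l. ((\<lambda>y. s y * \<omega> y) has_real_derivative l) (at t) \<and> 0 \<le> l" if "2 \<le> t" "t \<le> y" for t
      proof (intro exI conjI)
        show "((\<lambda>y. s y * \<omega> y) has_real_derivative w t * ((u t)\<^sup>2 + \<delta> * (v t)\<^sup>2)) (at t)"
          using that elim by (intro deriv_s\<omega>) auto
        show "0 \<le> w t * ((u t)\<^sup>2 + \<delta> * (v t)\<^sup>2)"
          using that elim w_pos[of t] True by simp
      qed
    qed (use elim in simp)
  qed
  moreover have "0 < s 2 * \<omega> 2" using s_pos[of 2] \<omega>_pos[of 2] by simp
  ultimately show ?thesis by blast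
next
  case False
  define l where "l = \<sigma>v + (u' 0 * (4 * \<sigma>v - 0) - v' 0 * (4 * \<sigma>u - 0 + 0))"
  have lim: "((\<lambda>y. s y * v' y + (u' 0 * (y * (s y * v' y) - s y * v y) - v' 0 * (y * (s y * u' y) - s y * u y + s y)))
      \<longlongrightarrow> l) (at_left 4)"
    unfolding l_def by (intro tendsto_intros \<sigma>u \<sigma>v su_tendsto_4 sv_tendsto_4 s_tendsto_4)
  show ?thesis
  proof (cases "\<sigma>v = 0")
    case True
    then have "\<sigma>u < 0" using \<sigma>u_le \<sigma>_not_both_0 False by force
    then have l: "0 < l" using True v'_pos[of 0] by (simp add: l_def mult_pos_neg)
    have "eventually (\<lambda>y. l / 2 < s y * v' y + (u' 0 * (y * (s y * v' y) - s y * v y) - v' 0 * (y * (s y * u' y) - s y * u y + s y))) (at_left 4)"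
      using l by (intro order_tendstoD(1)[OF lim]) simp
    then have "eventually (\<lambda>y. l / 2 \<le> s y * \<omega> y) (at_left 4)"
      using eventually_near_4[of 0, simplified]
    proof eventually_elim
      case (elim y)
      have "s y * (v' y + (u' 0 * (y * v' y - v y) - v' 0 * (y * u' y - u y + 1))) \<le> s y * \<omega> y"
        using \<omega>_lower[of y] s_pos[of y] elim by (intro mult_left_mono) auto
      then show ?case using elim(1) by (simp add: algebra_simps)
    qed
    with l show ?thesis by (intro exI[of _ "l / 2"]) auto
  next
    case False
    then have p: "0 < \<sigma>v" using \<sigma>v_nonneg by simp
    then have "eventually (\<lambda>y. \<sigma>v / 2 < s y * v' y) (at_left 4)" by (intro order_tendstoD(1)[OF \<sigma>v]) simp
    then have "eventually (\<lambda>y. \<sigma>v / 2 \<le> s y * \<omega> y) (at_left 4)"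
      using eventually_near_4[of 0, simplified]
    proof eventually_elim
      case (elim y)
      have "s y * v' y \<le> s y * \<omega> y" using \<omega>_ge_v'[of y] s_pos[of y] elim by (intro mult_left_mono) auto
      then show ?case using elim(1) by simp
    qed
    with p show ?thesis by (intro exI[of _ "\<sigma>v / 2"]) auto
  qed
qed

end

section \<open>Factors do not decrease the number of sign changes\<close>

definition jop :: "real \<Rightarrow> real poly \<Rightarrow> real poly" where
  "jop \<nu> p = jacobi_op \<nu> p + smult (1/4) p"

lemma coeff_jop: "coeff (jop \<nu> p) k = eig k * coeff p k - shift_const \<nu> k * coeff p (Suc k)"
  by (simp add: jop_def coeff_jacobi_op eig_def shift_const_def power2_eq_square algebra_simps)

lemma weakly_signed_4_eventually:
  assumes "\<And>\<epsilon>. 0 < \<epsilon> \<Longrightarrow> eventually (\<lambda>y. - \<epsilon> < e * F y) (at_left 4)"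
  shows "weakly_signed F 4 e"
proof (rule weakly_signed_near_4)
  fix y0 \<epsilon> :: real assume "y0 < 4" "0 < \<epsilon>"
  then have "eventually (\<lambda>y. - \<epsilon> < e * F y \<and> y \<in> {y0<..<4}) (at_left 4)"
    by (intro eventually_conj assms eventually_at_left_real)
  from eventually_happens'[OF _ this] show "\<exists>y>y0. y < 4 \<and> - \<epsilon> < e * F y" by auto
qed

lemma weakly_signed_4_tendsto:
  assumes "(F \<longlongrightarrow> l) (at_left 4)" "0 \<le> e * l"
  shows "weakly_signed F 4 e"
proof (rule weakly_signed_4_eventually)
  fix \<epsilon> :: real assume "0 < \<epsilon>"
  have "((\<lambda>y. e * F y) \<longlongrightarrow> e * l) (at_left 4)" by (intro tendsto_intros assms)
  then show "eventually (\<lambda>y. - \<epsilon> < e * F y) (at_left 4)"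
    using assms(2) \<open>0 < \<epsilon>\<close> by (intro order_tendstoD(1)) auto
qed

lemma weakly_alternates_scale:
  assumes "weakly_alternates F e xs" "set xs \<subseteq> {0<..<4}"
    "\<And>x. 0 < x \<Longrightarrow> x < 4 \<Longrightarrow> G x = c x * F x \<and> 0 < c x"
  shows "weakly_alternates G e xs"
proof -
  have a: "alternating (weakly_signed F) e xs" using assms(1) by (simp add: weakly_alternates_def)
  have "alternating (weakly_signed G) e xs"
  proof (rule alternating_mono[OF a])
    fix x e assume "x \<in> set xs" "weakly_signed F x e"
    then have x: "0 < x" "x < 4" "0 \<le> e * F x" using assms(2) by (auto simp: weakly_signed_def)
    then have "0 \<le> c x * (e * F x)" "e * G x = c x * (e * F x)" using assms(3)[of x] by simp_all
    then have "0 \<le> e * G x" by (simp only:)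
    then show "weakly_signed G x e" using x by (simp add: weakly_signed_def)
  qed
  then show ?thesis using assms(1) by (simp add: weakly_alternates_def)
qed

lemma alternates_interior: "alternates F e xs \<Longrightarrow> set xs \<subseteq> {0<..<4}"
  by (simp add: alternates_def)

lemma rolle_both_ends:
  assumes D: "\<And>y. 0 < y \<Longrightarrow> y < 4 \<Longrightarrow> (F has_real_derivative F' y) (at y)"
    and nn: "nowhere_null F'" and e: "e \<noteq> 0" and a: "alternates F e xs"
    and "(F \<longlongrightarrow> 0) (at_right 0)" and "weakly_signed F 4 (e * (-1) ^ length xs)"
  shows "\<exists>ys. alternates F' e ys \<and> length ys = Suc (length xs)"
proof -
  note s = alternates_interior[OF a]
  have 1: "weakly_alternates F (- e) (0 # xs)"
    using a s assms(5) by (intro weakly_alternates_Cons) (auto intro: weakly_alternates_of_alternates)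
  have "weakly_alternates F (- e) ((0 # xs) @ [4])"
    using s assms(6) by (intro weakly_alternates_snoc[OF 1]) auto
  from rolle_alternates[OF D nn _ _ this] e obtain ys where
    "alternates F' (- (- e)) ys" "Suc (length ys) = length ((0 # xs) @ [4])" by auto
  then show ?thesis by auto
qed

lemma rolle_left_end:
  assumes D: "\<And>y. 0 < y \<Longrightarrow> y < 4 \<Longrightarrow> (F has_real_derivative F' y) (at y)"
    and nn: "nowhere_null F'" and e: "e \<noteq> 0" and a: "alternates F e xs"
    and "(F \<longlongrightarrow> 0) (at_right 0)"
  shows "\<exists>ys. alternates F' e ys \<and> length ys = length xs"
proof -
  have "weakly_alternates F (- e) (0 # xs)"
    using a alternates_interior[OF a] assms(5)
    by (intro weakly_alternates_Cons) (auto intro: weakly_alternates_of_alternates)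
  from rolle_alternates[OF D nn _ _ this] e show ?thesis by auto
qed

lemma rolle_right_end:
  assumes D: "\<And>y. 0 < y \<Longrightarrow> y < 4 \<Longrightarrow> (F has_real_derivative F' y) (at y)"
    and nn: "nowhere_null F'" and e: "e \<noteq> 0" and a: "alternates F e xs"
    and "weakly_signed F 4 (e * (-1) ^ length xs)"
  shows "\<exists>ys. alternates F' (- e) ys \<and> length ys = length xs"
proof -
  have "weakly_alternates F e (xs @ [4])"
    using a alternates_interior[OF a] assms(5)
    by (intro weakly_alternates_snoc) (auto intro: weakly_alternates_of_alternates)
  from rolle_alternates[OF D nn _ _ this] e show ?thesis by auto
qed

lemma tendsto_poly_right_0: "(poly p \<longlongrightarrow> coeff p 0) (at_right 0)" for p :: "real poly"
proof -
  have "isCont (poly p) 0" by (rule DERIV_isCont[OF poly_DERIV])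
  then show ?thesis unfolding isCont_def poly_0_coeff_0 by (rule tendsto_mono[OF at_le, rotated]) simp
qed

lemma tendsto_quotient_right_0:
  fixes f k :: "real \<Rightarrow> real"
  assumes "(f has_real_derivative D) (at 0)" "f 0 = 0" "(k has_real_derivative D') (at 0)" "k 0 = 0" "D' \<noteq> 0"
  shows "((\<lambda>y. f y / k y) \<longlongrightarrow> D / D') (at_right 0)"
proof -
  have 1: "((\<lambda>h. f h / h) \<longlongrightarrow> D) (at_right 0)" "((\<lambda>h. k h / h) \<longlongrightarrow> D') (at_right 0)"
    using assms(1,3) unfolding DERIV_def assms(2,4)
    by (auto simp: assms intro: tendsto_mono[OF at_le])
  have "((\<lambda>h. (f h / h) / (k h / h)) \<longlongrightarrow> D / D') (at_right 0)"
    by (rule tendsto_divide[OF 1 assms(5)])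
  moreover have "eventually (\<lambda>h. (f h / h) / (k h / h) = f h / k h) (at_right (0::real))"
    using eventually_at_right_less[of 0] by eventually_elim simp
  ultimately show ?thesis by (rule Lim_transform_eventually)
qed

text \<open>If \<open>poly g 4\<close> has the sign demanded of a further entry, a point just below
  4 can be appended. Either way the value at 4 ends up on the side of the last entry, which makes
  the boundary terms at 4 fit.\<close>

lemma extend_alternation_to_4:
  fixes g :: "real poly"
  assumes "weakly_alternates (poly g) e xs" "set xs \<subseteq> {0<..<4}" "xs \<noteq> []" "e = 1 \<or> e = -1"
  shows "\<exists>ys. weakly_alternates (poly g) e ys \<and> set ys \<subseteq> {0<..<4} \<and> ys \<noteq> [] \<and> length xs \<le> length ys \<and>
    0 \<le> - (e * (-1) ^ length ys) * poly g 4"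
proof (cases "0 \<le> - (e * (-1) ^ length xs) * poly g 4")
  case False
  let ?E = "e * (-1) ^ length xs"
  have "isCont (poly g) 4" by (rule DERIV_isCont[OF poly_DERIV])
  then have "((\<lambda>y. ?E * poly g y) \<longlongrightarrow> ?E * poly g 4) (at_left 4)"
    unfolding isCont_def by (intro tendsto_mult tendsto_const) (auto intro: tendsto_mono[OF at_le])
  then have "eventually (\<lambda>y. 0 < ?E * poly g y) (at_left 4)"
    using False by (intro order_tendstoD(1)) auto
  moreover have "Max (set xs) \<in> set xs" using assms(3) by (intro Max_in) auto
  then have "Max (set xs) < 4" "0 < Max (set xs)" using assms(2) by auto
  then have "eventually (\<lambda>y. y \<in> {Max (set xs)<..<4}) (at_left 4)" by (intro eventually_at_left_real)
  ultimately have "eventually (\<lambda>y. 0 < ?E * poly g y \<and> y \<in> {Max (set xs)<..<4}) (at_left 4)"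
    by (rule eventually_conj)
  from eventually_happens'[OF _ this] obtain z where
    z: "0 < ?E * poly g z" "Max (set xs) < z" "z < 4" by auto
  have "x < z" if "x \<in> set xs" for x using z that by (meson List.finite_set Max_ge le_less_trans)
  moreover have "0 < z" using z \<open>0 < Max (set xs)\<close> by simp
  ultimately have "weakly_alternates (poly g) e (xs @ [z])"
    using assms z by (auto simp: weakly_alternates_def sorted_wrt_append alternating_append weakly_signed_def)
  then show ?thesis using False \<open>0 < z\<close> z assms by (intro exI[of _ "xs @ [z]"]) auto
qed (use assms in blast)

context jacobi_series
begin

lemma jac_poly: "jac (poly (pderiv p)) (poly (pderiv (pderiv p))) y = poly (jop \<nu> p) y - poly p y / 4"
  by (simp add: jac_def jop_def jacobi_op_def algebra_simps)

lemma deriv_conc_poly: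
  assumes "0 < y" "y < 4"
  shows "(conc (poly p) (poly (pderiv p)) u u' has_real_derivative
      - (w y * (u y * (poly (jop \<nu> p) y - poly p y / 4) - poly p y * ((m - 1/4) * u y + \<delta> * v y)))) (at y)"
    "(conc (poly p) (poly (pderiv p)) v v' has_real_derivative
      - (w y * (v y * (poly (jop \<nu> p) y - poly p y / 4) - poly p y * ((m - 1/4) * v y - u y)))) (at y)"
proof -
  have "\<bar>y\<bar> < 4" using assms by simp
  note d = deriv_uv[OF this] and j = jac_uv[OF this]
  show "(conc (poly p) (poly (pderiv p)) u u' has_real_derivative
      - (w y * (u y * (poly (jop \<nu> p) y - poly p y / 4) - poly p y * ((m - 1/4) * u y + \<delta> * v y)))) (at y)"
    unfolding j(1)[symmetric] jac_poly[symmetric] using assms d by (intro deriv_conc poly_DERIV)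
  show "(conc (poly p) (poly (pderiv p)) v v' has_real_derivative
      - (w y * (v y * (poly (jop \<nu> p) y - poly p y / 4) - poly p y * ((m - 1/4) * v y - u y)))) (at y)"
    unfolding j(2)[symmetric] jac_poly[symmetric] using assms d by (intro deriv_conc poly_DERIV)
qed

lemma conc_poly_tendsto_0:
  "(conc (poly p) (poly (pderiv p)) u u' \<longlongrightarrow> 0) (at_right 0)"
  "(conc (poly p) (poly (pderiv p)) v v' \<longlongrightarrow> 0) (at_right 0)"
proof -
  have "((\<lambda>y. s y * (poly (pderiv p) y * u y - poly p y * u' y)) \<longlongrightarrow>
      0 * (coeff (pderiv p) 0 * 1 - coeff p 0 * u' 0)) (at_right 0)"
    "((\<lambda>y. s y * (poly (pderiv p) y * v y - poly p y * v' y)) \<longlongrightarrow>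
      0 * (coeff (pderiv p) 0 * 0 - coeff p 0 * v' 0)) (at_right 0)"
    by (intro tendsto_intros s_tendsto_0 tendsto_poly_right_0 uv_tendsto_0)+
  then show "(conc (poly p) (poly (pderiv p)) u u' \<longlongrightarrow> 0) (at_right 0)"
    "(conc (poly p) (poly (pderiv p)) v v' \<longlongrightarrow> 0) (at_right 0)"
    by (simp_all add: conc_def[abs_def])
qed

end

section \<open>A single real factor with t at most 1/4\<close>

locale jacobi_single = jacobi_series \<nu> m 0 for \<nu> m +
  assumes m_le: "m \<le> 1/4"
begin

lemma U_nonneg: "0 \<le> U k"
proof (induction k)
  case (Suc k)
  have "(1/2)\<^sup>2 \<le> (real k + 1/2)\<^sup>2" by (intro power_mono) auto
  then have "0 \<le> eig k - m" using m_le by (simp add: eig_def power2_eq_square)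
  with Suc show ?case by (simp add: U_Suc)
qed simp

lemma u_pos: "0 \<le> y \<Longrightarrow> y < 4 \<Longrightarrow> 0 < u y"
proof (cases "y = 0")
  case False
  assume "0 \<le> y" "y < 4"
  then show ?thesis unfolding u_def using False U_nonneg \<gamma>_pos
    by (intro eval_fps_pos[of Uf y 0]) (auto simp: nth_Uf less_imp_le)
qed (simp add: uv_at_0)

lemma u'_nonneg: "0 \<le> y \<Longrightarrow> y < 4 \<Longrightarrow> 0 \<le> u' y"
  unfolding u'_def using U_nonneg \<gamma>_pos
  by (intro eval_fps_nonneg) (auto simp: nth_Uf less_imp_le)

lemma \<sigma>u_nonneg: "0 \<le> \<sigma>u"
proof (rule tendsto_lowerbound[OF \<sigma>u])
  show "eventually (\<lambda>y. 0 \<le> s y * u' y) (at_left 4)"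
    using eventually_at_left_real[of 0 4, simplified]
    by eventually_elim (auto intro!: mult_nonneg_nonneg[OF less_imp_le[OF s_pos] u'_nonneg])
qed simp

text \<open>With the positive solution \<open>u\<close> the operator factors as (g / u)' = C / (s
  u^2), C' = - w u G. The first application of Rolle's theorem loses one point unless
  \<open>g\<close> vanishes at 0. The second gains one, because \<open>C\<close> tends to 0 at 0 and
  has a fitting limit at 4.\<close>

theorem sign_changes_single:
  fixes g :: "real poly"
  defines "G \<equiv> jop \<nu> g - smult m g"
  assumes G: "G \<noteq> 0" and wa: "weakly_alternates (poly g) e xs" "set xs \<subseteq> {0<..<4}" "xs \<noteq> []" "e = 1 \<or> e = -1"
    and o: "\<And>i. i < ord \<Longrightarrow> coeff g i = 0"
  shows "\<exists>ys e'. alternates (poly G) e' ys \<and> (e' = 1 \<or> e' = -1) \<and> length xs + min ord 1 \<le> length ys"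
proof -
  obtain zs where zs: "weakly_alternates (poly g) e zs" "set zs \<subseteq> {0<..<4}" "zs \<noteq> []" "length xs \<le> length zs"
    and E: "0 \<le> - (e * (-1) ^ length zs) * poly g 4"
    using extend_alternation_to_4[OF wa] by blast
  define C where "C = conc (poly g) (poly (pderiv g)) u u'"
  define C' where "C' y = - (w y * u y * poly G y)" for y
  have DC: "(C has_real_derivative C' y) (at y)" if "0 < y" "y < 4" for y
  proof -
    have "C' y = - (w y * (u y * (poly (jop \<nu> g) y - poly g y / 4) - poly g y * ((m - 1/4) * u y + 0 * v y)))"
      by (simp add: C'_def G_def algebra_simps)
    with deriv_conc_poly(1)[OF that, of g] show ?thesis by (simp add: C_def)
  qed
  define q where "q y = poly g y / u y" for y
  define q' where "q' y = C y / (s y * (u y)\<^sup>2)" for y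
  have Dq: "(q has_real_derivative q' y) (at y)" if "0 < y" "y < 4" for y
    unfolding q_def[abs_def] q'_def C_def conc_def using that u_pos[of y] s_pos[of y] deriv_uv(1)[of y]
    by (auto intro!: derivative_eq_intros simp: power2_eq_square)
  have nC': "nowhere_null C'"
  proof (rule nowhere_null_mult[OF nowhere_null_poly[OF G]])
    fix y :: real assume "0 < y" "y < 4" "poly G y \<noteq> 0"
    then show "C' y \<noteq> 0" using w_pos[of y] u_pos[of y] by (simp add: C'_def)
  qed
  then have nC: "nowhere_null C" by (rule nowhere_null_antiderivative) (rule DC)
  then have nq: "nowhere_null q'"
    apply (rule nowhere_null_mult)
    subgoal for y using s_pos[of y] u_pos[of y] by (simp add: q'_def)
    done
  have wq: "weakly_alternates q e zs"
    by (rule weakly_alternates_scale[OF zs(1,2), of _ "\<lambda>y. 1 / u y"]) (use u_pos in \<open>auto simp: q_def\<close>)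
  have e: "e \<noteq> 0" using wa(4) by auto
  obtain e1 ys where ys: "alternates q' e1 ys" "e1 = 1 \<or> e1 = -1" "e1 * (-1) ^ length ys = e * (-1) ^ length zs"
    "length ys + 1 = length zs + min ord 1"
  proof (cases "ord = 0")
    case True
    obtain ys where "alternates q' (- e) ys" "Suc (length ys) = length zs"
      using rolle_alternates[OF Dq nq e zs(3) wq] by auto
    then show ?thesis using that[of "- e" ys] wa(4) True by (auto simp flip: \<open>Suc (length ys) = length zs\<close>)
  next
    case False
    have "((\<lambda>y. poly g y / u y) \<longlongrightarrow> coeff g 0 / 1) (at_right 0)"
      by (intro tendsto_divide tendsto_poly_right_0 uv_tendsto_0) simp
    then have "(q \<longlongrightarrow> 0) (at_right 0)" using o[of 0] False by (simp add: q_def[abs_def])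
    then have "weakly_alternates q (- e) (0 # zs)" using wq zs(2) by (intro weakly_alternates_Cons) auto
    from rolle_alternates[OF Dq nq _ _ this] e obtain ys where "alternates q' e ys" "length ys = length zs" by auto
    then show ?thesis using that[of e ys] wa(4) False by auto
  qed
  have aC: "alternates C e1 ys"
    apply (rule alternates_mult[OF ys(1), of _ "\<lambda>y. s y * (u y)\<^sup>2"])
    subgoal for y using s_pos[of y] u_pos[of y] by (simp add: q'_def)
    done
  have w4: "weakly_signed C 4 (e1 * (-1) ^ length ys)"
  proof (rule weakly_signed_4_tendsto)
    show "(C \<longlongrightarrow> - (poly g 4 * \<sigma>u)) (at_left 4)" unfolding C_def by (rule poly_conc_tendsto_4)
    show "0 \<le> e1 * (-1) ^ length ys * - (poly g 4 * \<sigma>u)"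
      using mult_nonneg_nonneg[OF E \<sigma>u_nonneg] unfolding ys(3) by (simp add: mult_ac)
  qed
  obtain ts where ts: "alternates C' e1 ts" "length ts = Suc (length ys)"
    using rolle_both_ends[OF DC nC' _ aC _ w4] ys(2) conc_poly_tendsto_0(1)[of g] by (auto simp: C_def)
  have "alternates (\<lambda>y. - poly G y) e1 ts"
    apply (rule alternates_mult[OF ts(1), of _ "\<lambda>y. 1 / (w y * u y)"])
    subgoal for y using w_pos[of y] u_pos[of y] by (simp add: C'_def)
    done
  from alternates_uminus[OF this] have "alternates (poly G) (- e1) ts" by simp
  then show ?thesis using ys(2,4) ts(2) zs(4) by (intro exI[of _ ts] exI[of _ "- e1"]) auto
qed

end

section \<open>A pair of factors\<close>

context jacobi_pair
begin

text \<open>Polya's factorization of \<open>(X - m)\<^sup>2 + \<delta>\<close> into first-order operators: up to positive factors, the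
  derivatives of \<open>g / v\<close>, \<open>F\<close>, \<open>Y\<close> and \<open>Cv\<close> are \<open>F\<close>, \<open>- Y\<close>, \<open>Cv\<close> and \<open>- G\<close>. The sign changes that the four
  applications of Rolle's theorem lose in the interior are regained at the endpoints.\<close>

theorem sign_changes_pair:
  fixes g :: "real poly"
  defines "F1 \<equiv> jop \<nu> g - smult m g"
  defines "G \<equiv> jop \<nu> F1 - smult m F1 + smult \<delta> g"
  assumes G: "G \<noteq> 0" and wa: "weakly_alternates (poly g) e xs" "set xs \<subseteq> {0<..<4}" "xs \<noteq> []" "e = 1 \<or> e = -1"
    and o: "\<And>i. i < ord \<Longrightarrow> coeff g i = 0"
  shows "\<exists>ys e'. alternates (poly G) e' ys \<and> (e' = 1 \<or> e' = -1) \<and> length xs + min ord 2 \<le> length ys"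
proof -
  obtain zs where zs: "weakly_alternates (poly g) e zs" "set zs \<subseteq> {0<..<4}" "zs \<noteq> []" "length xs \<le> length zs"
    and E0: "0 \<le> - (e * (-1) ^ length zs) * poly g 4"
    using extend_alternation_to_4[OF wa] by blast
  define E where "E = - (e * (-1) ^ length zs)"
  have E: "0 \<le> E * poly g 4" using E0 by (simp add: E_def)
  define Hv where "Hv = conc (poly g) (poly (pderiv g)) v v'"
  define Hu where "Hu = conc (poly g) (poly (pderiv g)) u u'"
  define Kv where "Kv = conc (poly F1) (poly (pderiv F1)) v v'"
  define Ku where "Ku = conc (poly F1) (poly (pderiv F1)) u u'"
  \<comment> \<open>\<open>Cu\<close> and \<open>Cv\<close> are the concomitants of \<open>g\<close>
    with \<open>u\<close> and \<open>v\<close> for the fourth-order operator: their derivatives are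
    - w u G and - w v G. In the derivative of \<open>Y\<close> the terms with \<open>G\<close>
    cancel.\<close>
  define Cu where "Cu y = Ku y + \<delta> * Hv y" for y
  define Cv where "Cv y = Kv y - Hu y" for y
  define Cv' where "Cv' y = - (w y * v y * poly G y)" for y
  define Y where "Y y = Cu y - u y / v y * Cv y" for y
  define Y' where "Y' y = \<omega> y * Cv y / (v y)\<^sup>2" for y
  define F where "F y = Hv y / (s y * \<omega> y)" for y
  define F' where "F' y = - (w y * (v y)\<^sup>2 * Y y / (s y * \<omega> y)\<^sup>2)" for y
  define q where "q y = poly g y / v y" for y
  define q' where "q' y = Hv y / (s y * (v y)\<^sup>2)" for y

  have DHv: "(Hv has_real_derivative - (w y * (v y * poly F1 y + poly g y * u y))) (at y)"
    and DHu: "(Hu has_real_derivative - (w y * (u y * poly F1 y - \<delta> * poly g y * v y))) (at y)"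
    and DKv: "(Kv has_real_derivative - (w y * (v y * (poly G y - \<delta> * poly g y) + poly F1 y * u y))) (at y)"
    and DKu: "(Ku has_real_derivative - (w y * (u y * (poly G y - \<delta> * poly g y) - \<delta> * poly F1 y * v y))) (at y)"
    if "0 < y" "y < 4" for y
  proof -
    have f: "poly (jop \<nu> g) y = poly F1 y + m * poly g y"
      "poly (jop \<nu> F1) y = poly G y - \<delta> * poly g y + m * poly F1 y"
      by (simp_all add: G_def F1_def)
    show "(Hv has_real_derivative - (w y * (v y * poly F1 y + poly g y * u y))) (at y)"
      using deriv_conc_poly(2)[OF that, of g] unfolding Hv_def f by (simp add: algebra_simps)
    show "(Hu has_real_derivative - (w y * (u y * poly F1 y - \<delta> * poly g y * v y))) (at y)"
      using deriv_conc_poly(1)[OF that, of g] unfolding Hu_def f by (simp add: algebra_simps)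
    show "(Kv has_real_derivative - (w y * (v y * (poly G y - \<delta> * poly g y) + poly F1 y * u y))) (at y)"
      using deriv_conc_poly(2)[OF that, of F1] unfolding Kv_def f by (simp add: algebra_simps)
    show "(Ku has_real_derivative - (w y * (u y * (poly G y - \<delta> * poly g y) - \<delta> * poly F1 y * v y))) (at y)"
      using deriv_conc_poly(1)[OF that, of F1] unfolding Ku_def f by (simp add: algebra_simps)
  qed
  have DCv: "(Cv has_real_derivative Cv' y) (at y)" if "0 < y" "y < 4" for y
    unfolding Cv_def[abs_def] using DERIV_diff[OF DKv[OF that] DHu[OF that]]
    by (simp add: Cv'_def algebra_simps)
  have DCu: "(Cu has_real_derivative - (w y * u y * poly G y)) (at y)" if "0 < y" "y < 4" for y
    unfolding Cu_def[abs_def] using DERIV_add[OF DKu[OF that] DERIV_cmult[OF DHv[OF that], of \<delta>]]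
    by (simp add: algebra_simps)
  have DY: "(Y has_real_derivative Y' y) (at y)" if "0 < y" "y < 4" for y
    unfolding Y_def[abs_def]
    using DERIV_diff[OF DCu[OF that] DERIV_mult[OF deriv_ratio[OF that] DCv[OF that]]] v_pos[OF that]
    by (simp add: Y'_def Cv'_def)
  have DF: "(F has_real_derivative F' y) (at y)" if y: "0 < y" "y < 4" for y
  proof -
    have p: "0 < s y * \<omega> y" using s_pos[OF y] \<omega>_pos[of y] y by simp
    have key: "- (v y * poly F1 y + poly g y * u y) * (s y * \<omega> y) - Hv y * ((u y)\<^sup>2 + \<delta> * (v y)\<^sup>2) = - ((v y)\<^sup>2 * Y y)"
    proof -
      have "(v y)\<^sup>2 * Y y = v y * (v y * Cu y - u y * Cv y)"
        using v_pos[OF y] by (simp add: Y_def power2_eq_square algebra_simps)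
      also have "\<dots> = (v y * poly F1 y + poly g y * u y) * (s y * \<omega> y) + Hv y * ((u y)\<^sup>2 + \<delta> * (v y)\<^sup>2)"
        by (simp add: Cu_def Cv_def Hu_def Hv_def Ku_def Kv_def conc_def \<omega>_def power2_eq_square algebra_simps)
      finally show ?thesis unfolding minus_mult_left[symmetric] by linarith
    qed
    have "(F has_real_derivative (- (w y * (v y * poly F1 y + poly g y * u y)) * (s y * \<omega> y)
        - Hv y * (w y * ((u y)\<^sup>2 + \<delta> * (v y)\<^sup>2))) / (s y * \<omega> y * (s y * \<omega> y))) (at y)"
      unfolding F_def[abs_def] using p by (intro DERIV_divide DHv deriv_s\<omega> y) auto
    also have "- (w y * (v y * poly F1 y + poly g y * u y)) * (s y * \<omega> y)
        - Hv y * (w y * ((u y)\<^sup>2 + \<delta> * (v y)\<^sup>2)) = w y * (- (v y * poly F1 y + poly g y * u y) * (s y * \<omega> y) - Hv y * ((u y)\<^sup>2 + \<delta> * (v y)\<^sup>2))"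
      by (simp add: algebra_simps)
    finally show ?thesis unfolding key by (simp add: F'_def power2_eq_square mult.assoc)
  qed
  have Dq: "(q has_real_derivative q' y) (at y)" if "0 < y" "y < 4" for y
    unfolding q_def[abs_def] q'_def Hv_def conc_def using that v_pos[of y] s_pos[of y] deriv_uv(3)[of y]
    by (auto intro!: derivative_eq_intros simp: power2_eq_square)

  have nCv': "nowhere_null Cv'"
    using nowhere_null_poly[OF G] by (rule nowhere_null_mult) (use w_pos v_pos in \<open>force simp: Cv'_def\<close>)
  then have nCv: "nowhere_null Cv" by (rule nowhere_null_antiderivative) (rule DCv)
  have nY': "nowhere_null Y'"
  proof (rule nowhere_null_mult[OF nCv])
    fix y :: real assume "0 < y" "y < 4" "Cv y \<noteq> 0"
    then show "Y' y \<noteq> 0" using \<omega>_pos[of y] v_pos[of y] by (simp add: Y'_def)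
  qed
  then have nY: "nowhere_null Y" by (rule nowhere_null_antiderivative) (rule DY)
  then have nF': "nowhere_null F'"
    apply (rule nowhere_null_mult)
    subgoal for y using w_pos[of y] s_pos[of y] \<omega>_pos[of y] v_pos[of y] by (simp add: F'_def)
    done
  then have nF: "nowhere_null F" by (rule nowhere_null_antiderivative) (rule DF)
  then have nq: "nowhere_null q'"
    apply (rule nowhere_null_mult)
    subgoal for y using s_pos[of y] \<omega>_pos[of y] v_pos[of y] by (simp add: F_def q'_def)
    done

  have Cv0: "(Cv \<longlongrightarrow> 0) (at_right 0)"
    using tendsto_diff[OF conc_poly_tendsto_0(2)[of F1] conc_poly_tendsto_0(1)[of g]]
    by (simp add: Cv_def[abs_def] Kv_def Hu_def)
  \<comment> \<open>u / v has a simple pole at 0. It is compensated because Cv = s B with B 0 = 0,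
    which is the equation for \<open>coeff F1 0\<close> in disguise.\<close>
  have Y0: "(Y \<longlongrightarrow> 0) (at_right 0)"
  proof -
    define B where "B y = poly (pderiv F1) y * v y - poly F1 y * v' y - (poly (pderiv g) y * u y - poly g y * u' y)" for y
    note d = deriv_uv[of 0, simplified]
    have "\<exists>D. (B has_real_derivative D) (at 0)"
      unfolding B_def[abs_def]
      by (rule exI, rule DERIV_diff[OF
            DERIV_diff[OF DERIV_mult[OF poly_DERIV d(3)] DERIV_mult[OF poly_DERIV d(4)]]
            DERIV_diff[OF DERIV_mult[OF poly_DERIV d(1)] DERIV_mult[OF poly_DERIV d(2)]]])
    then obtain D where D: "(B has_real_derivative D) (at 0)" by blast
    have "coeff F1 0 = (1/4 - m) * coeff g 0 - 4 * \<nu> * coeff g 1"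
      by (simp add: F1_def coeff_jop eig_def shift_const_def power2_eq_square algebra_simps)
    then have B0: "B 0 = 0" using nu
      by (simp add: B_def uv_at_0 poly_0_coeff_0 coeff_pderiv field_simps)
    have "((\<lambda>y. B y / v y) \<longlongrightarrow> D / v' 0) (at_right 0)"
      using tendsto_quotient_right_0[OF D B0, of v "v' 0"] deriv_uv(3)[of 0] uv_at_0 v'_pos[of 0] by auto
    then have "((\<lambda>y. Cu y - u y * (s y * (B y / v y))) \<longlongrightarrow> (0 + \<delta> * 0) - 1 * (0 * (D / v' 0))) (at_right 0)"
      unfolding Cu_def[abs_def] Ku_def Hv_def
      by (intro tendsto_diff tendsto_add tendsto_mult tendsto_const uv_tendsto_0 s_tendsto_0 conc_poly_tendsto_0)
    moreover have "Cv y = s y * B y" for y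
      by (simp add: Cv_def Kv_def Hu_def conc_def B_def algebra_simps)
    then have "Y = (\<lambda>y. Cu y - u y * (s y * (B y / v y)))" by (simp add: Y_def fun_eq_iff)
    ultimately show ?thesis by simp
  qed

  have Hv4: "(Hv \<longlongrightarrow> - (poly g 4 * \<sigma>v)) (at_left 4)" and Hu4: "(Hu \<longlongrightarrow> - (poly g 4 * \<sigma>u)) (at_left 4)"
    and Kv4: "(Kv \<longlongrightarrow> - (poly F1 4 * \<sigma>v)) (at_left 4)" and Ku4: "(Ku \<longlongrightarrow> - (poly F1 4 * \<sigma>u)) (at_left 4)"
    unfolding Hv_def Hu_def Kv_def Ku_def by (rule poly_conc_tendsto_4)+
  have F4: "weakly_signed F 4 (- E)"
  proof (rule weakly_signed_4_eventually)
    fix \<epsilon> :: real assume \<epsilon>: "0 < \<epsilon>"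
    obtain \<eta> where \<eta>: "0 < \<eta>" "eventually (\<lambda>y. \<eta> \<le> s y * \<omega> y) (at_left 4)" using s\<omega>_lower by blast
    have "((\<lambda>y. E * Hv y) \<longlongrightarrow> E * - (poly g 4 * \<sigma>v)) (at_left 4)" by (intro tendsto_intros Hv4)
    moreover have "E * - (poly g 4 * \<sigma>v) < \<epsilon> * \<eta>"
    proof -
      have "0 \<le> (E * poly g 4) * \<sigma>v" by (rule mult_nonneg_nonneg[OF E \<sigma>v_nonneg])
      moreover have "0 < \<epsilon> * \<eta>" using \<epsilon> \<eta> by simp
      ultimately show ?thesis by (simp add: mult.assoc)
    qed
    ultimately have "eventually (\<lambda>y. E * Hv y < \<epsilon> * \<eta>) (at_left 4)" by (rule order_tendstoD(2))
    with \<eta>(2) show "eventually (\<lambda>y. - \<epsilon> < - E * F y) (at_left 4)"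
    proof eventually_elim
      case (elim y)
      then have "E * Hv y < \<epsilon> * (s y * \<omega> y)" using \<epsilon> by (meson less_le_trans mult_left_mono less_imp_le)
      then have "E * Hv y / (s y * \<omega> y) < \<epsilon>" using elim(1) \<eta>(1) by (subst pos_divide_less_eq) auto
      then show ?case by (simp add: F_def)
    qed
  qed
  \<comment> \<open>\<open>Cv\<close> and \<open>Y\<close> are consecutive in the chain, and
    regaining the endpoint 4 for one of them suffices. If it fails for \<open>Cv\<close>, then
    \<sigma>v > 0 and E Cv > 0 near 4. There u / v may be replaced by the smaller u' / v', which
    does have a limit; in the resulting limit the terms with F1(4) cancel and the form of
    \<open>\<sigma>_form_nonneg\<close> remains.\<close>
  have end4: "weakly_signed Cv 4 (- E) \<or> weakly_signed Y 4 (- E)"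
  proof (cases "weakly_signed Cv 4 (- E)")
    case False
    obtain \<epsilon> y0 where \<epsilon>: "0 < \<epsilon>" "y0 < 4" "0 \<le> y0" "\<And>y. y0 < y \<Longrightarrow> y < 4 \<Longrightarrow> \<epsilon> \<le> E * Cv y"
      using not_weakly_signed_4[OF False] by auto
    have near: "eventually (\<lambda>y. y0 < y \<and> y < 4) (at_left 4)" by (rule eventually_near_4[OF \<epsilon>(2)])
    have Cv4: "(Cv \<longlongrightarrow> - (poly F1 4 * \<sigma>v) - - (poly g 4 * \<sigma>u)) (at_left 4)"
      unfolding Cv_def[abs_def] by (intro tendsto_diff Kv4 Hu4)
    have Cu4: "(Cu \<longlongrightarrow> - (poly F1 4 * \<sigma>u) + \<delta> * - (poly g 4 * \<sigma>v)) (at_left 4)"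
      unfolding Cu_def[abs_def] by (intro tendsto_add tendsto_mult tendsto_const Ku4 Hv4)
    have "\<sigma>v \<noteq> 0"
    proof
      assume z: "\<sigma>v = 0"
      have "((\<lambda>y. E * Cv y) \<longlongrightarrow> E * (- (poly F1 4 * \<sigma>v) - - (poly g 4 * \<sigma>u))) (at_left 4)"
        by (intro tendsto_mult tendsto_const Cv4)
      then have "\<epsilon> \<le> E * (- (poly F1 4 * \<sigma>v) - - (poly g 4 * \<sigma>u))"
        by (rule tendsto_lowerbound) (use near \<epsilon> in \<open>auto elim: eventually_mono\<close>)
      moreover have "(E * poly g 4) * \<sigma>u \<le> 0" using E \<sigma>u_le[OF z] by (rule mult_nonneg_nonpos)
      ultimately show False using z \<epsilon>(1) by (simp add: mult.assoc)
    qed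
    then have \<sigma>: "0 < \<sigma>v" using \<sigma>v_nonneg by simp
    define R where "R y = E * ((s y * v' y) * Cu y - (s y * u' y) * Cv y)" for y
    have "weakly_signed Y 4 (- E)"
    proof (rule weakly_signed_4_eventually)
      fix \<epsilon>' :: real assume \<epsilon>': "0 < \<epsilon>'"
      have "((\<lambda>y. R y / (s y * v' y)) \<longlongrightarrow> E * (\<sigma>v * (- (poly F1 4 * \<sigma>u) + \<delta> * - (poly g 4 * \<sigma>v))
          - \<sigma>u * (- (poly F1 4 * \<sigma>v) - - (poly g 4 * \<sigma>u))) / \<sigma>v) (at_left 4)"
        unfolding R_def by (intro tendsto_divide tendsto_mult tendsto_diff tendsto_const \<sigma>u \<sigma>v Cu4 Cv4) (use \<sigma> in simp)
      also have "E * (\<sigma>v * (- (poly F1 4 * \<sigma>u) + \<delta> * - (poly g 4 * \<sigma>v))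
          - \<sigma>u * (- (poly F1 4 * \<sigma>v) - - (poly g 4 * \<sigma>u))) = - ((E * poly g 4) * (\<delta> * \<sigma>v\<^sup>2 + \<sigma>u\<^sup>2))"
        by (simp add: power2_eq_square algebra_simps)
      finally have lim: "((\<lambda>y. R y / (s y * v' y)) \<longlongrightarrow> - ((E * poly g 4) * (\<delta> * \<sigma>v\<^sup>2 + \<sigma>u\<^sup>2)) / \<sigma>v) (at_left 4)" .
      have "- ((E * poly g 4) * (\<delta> * \<sigma>v\<^sup>2 + \<sigma>u\<^sup>2)) / \<sigma>v \<le> 0"
        using mult_nonneg_nonneg[OF E \<sigma>_form_nonneg] \<sigma> by (simp add: divide_nonpos_pos)
      with \<epsilon>' have "eventually (\<lambda>y. R y / (s y * v' y) < \<epsilon>') (at_left 4)"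
        by (intro order_tendstoD(2)[OF lim]) simp
      with near show "eventually (\<lambda>y. - \<epsilon>' < - E * Y y) (at_left 4)"
      proof eventually_elim
        case (elim y)
        then have y: "0 < y" "y < 4" using \<epsilon>(3) by auto
        have ec: "0 \<le> E * Cv y" using \<epsilon>(1) \<epsilon>(4)[of y] elim by simp
        have "u' y \<le> u y / v y * v' y"
          using \<omega>_pos[of y] v_pos[OF y] y by (simp add: \<omega>_def field_simps)
        then have "s y * u' y * (E * Cv y) \<le> s y * (u y / v y * v' y) * (E * Cv y)"
          using s_pos[OF y] ec by (intro mult_right_mono mult_left_mono) auto
        then have "(E * Y y) * (s y * v' y) \<le> R y" by (simp add: R_def Y_def algebra_simps)
        moreover have "0 < s y * v' y" using s_pos[OF y] v'_pos[of y] y by simp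
        ultimately have "E * Y y \<le> R y / (s y * v' y)" by (simp add: pos_le_divide_eq)
        with elim show ?case by simp
      qed
    qed
    then show ?thesis ..
  qed simp

  have e: "e \<noteq> 0" using wa(4) by auto
  have wq: "weakly_alternates q e zs"
    by (rule weakly_alternates_scale[OF zs(1,2), of _ "\<lambda>y. 1 / v y"]) (use v_pos in \<open>auto simp: q_def\<close>)
  \<comment> \<open>As \<open>v\<close> has a simple zero at 0, g / v tends to 0 there if
    \<open>g\<close> vanishes to second order, whereas for \<open>F\<close> first order suffices.
    Together these two steps contribute \<open>min ord 2\<close>.\<close>
  obtain e1 ys where ys: "alternates q' e1 ys" "e1 = 1 \<or> e1 = -1" "e1 * (-1) ^ length ys = - E"
    "length ys + 1 = length zs + (if 2 \<le> ord then 1 else 0)"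
  proof (cases "2 \<le> ord")
    case False
    obtain ys where "alternates q' (- e) ys" "Suc (length ys) = length zs"
      using rolle_alternates[OF Dq nq e zs(3) wq] by auto
    then show ?thesis using that[of "- e" ys] wa(4) False
      by (auto simp: E_def simp flip: \<open>Suc (length ys) = length zs\<close>)
  next
    case True
    have "((\<lambda>y. poly g y / v y) \<longlongrightarrow> poly (pderiv g) 0 / v' 0) (at_right 0)"
      using poly_DERIV[of g 0] deriv_uv(3)[of 0] o[of 0] True uv_at_0 v'_pos[of 0]
      by (intro tendsto_quotient_right_0) (auto simp: poly_0_coeff_0)
    then have "(q \<longlongrightarrow> 0) (at_right 0)"
      using o[of 1] True by (simp add: q_def[abs_def] poly_0_coeff_0 coeff_pderiv)
    then have "weakly_alternates q (- e) (0 # zs)" using wq zs(2) by (intro weakly_alternates_Cons) auto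
    from rolle_alternates[OF Dq nq _ _ this] e obtain ys where "alternates q' e ys" "length ys = length zs" by auto
    then show ?thesis using that[of e ys] wa(4) True by (auto simp: E_def)
  qed
  have aF: "alternates F e1 ys"
    apply (rule alternates_mult[OF ys(1), of _ "\<lambda>y. (v y)\<^sup>2 / \<omega> y"])
    subgoal for y using s_pos[of y] \<omega>_pos[of y] v_pos[of y] by (simp add: q'_def F_def)
    done
  have wF: "weakly_signed F 4 (e1 * (-1) ^ length ys)" using F4 ys(3) by simp
  obtain e2 ts where ts: "alternates F' e2 ts" "e2 = 1 \<or> e2 = -1" "e2 * (-1) ^ length ts = E"
    "length ts + 1 = length zs + min ord 2"
  proof (cases "ord = 0")
    case True
    obtain ts where "alternates F' (- e1) ts" "length ts = length ys"
      using rolle_right_end[OF DF nF' _ aF wF] ys(2) by auto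
    then show ?thesis using that[of "- e1" ts] ys True by auto
  next
    case False
    have "((\<lambda>y. (poly (pderiv g) y * v y - poly g y * v' y) / (u y * v' y - u' y * v y)) \<longlongrightarrow>
        (coeff (pderiv g) 0 * 0 - coeff g 0 * v' 0) / (1 * v' 0 - u' 0 * 0)) (at_right 0)"
      by (intro tendsto_intros tendsto_poly_right_0 uv_tendsto_0) (use v'_pos[of 0] in simp)
    then have "((\<lambda>y. (poly (pderiv g) y * v y - poly g y * v' y) / \<omega> y) \<longlongrightarrow> 0) (at_right 0)"
      using o[of 0] False by (simp add: \<omega>_def)
    moreover have "eventually (\<lambda>y. (poly (pderiv g) y * v y - poly g y * v' y) / \<omega> y = F y) (at_right 0)"
      using eventually_at_right_real[of 0 4, simplified]
      by eventually_elim (use s_pos in \<open>force simp: F_def Hv_def conc_def\<close>)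
    ultimately have "(F \<longlongrightarrow> 0) (at_right 0)" by (rule Lim_transform_eventually)
    then obtain ts where "alternates F' e1 ts" "length ts = Suc (length ys)"
      using rolle_both_ends[OF DF nF' _ aF _ wF] ys(2) by auto
    then show ?thesis using that[of e1 ts] ys False by (auto simp: min_def split: if_splits)
  qed
  have "alternates (\<lambda>y. - Y y) e2 ts"
    apply (rule alternates_mult[OF ts(1), of _ "\<lambda>y. (s y * \<omega> y)\<^sup>2 / (w y * (v y)\<^sup>2)"])
    subgoal for y using s_pos[of y] \<omega>_pos[of y] v_pos[of y] w_pos[of y] by (simp add: F'_def)
    done
  from alternates_uminus[OF this] have aY: "alternates Y (- e2) ts" by simp
  have e2: "- e2 \<noteq> 0" using ts(2) by auto
  have scale: "alternates Cv e' xs" if "alternates Y' e' xs" for e' xs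
    apply (rule alternates_mult[OF that, of _ "\<lambda>y. (v y)\<^sup>2 / \<omega> y"])
    subgoal for y using \<omega>_pos[of y] v_pos[of y] by (simp add: Y'_def)
    done
  obtain rs where rs: "alternates Cv' (- e2) rs" "length rs = Suc (length ts)"
  proof (cases "weakly_signed Cv 4 (- E)")
    case True
    obtain ps where ps: "alternates Y' (- e2) ps" "length ps = length ts"
      using rolle_left_end[OF DY nY' e2 aY Y0] by auto
    then have "weakly_signed Cv 4 (- e2 * (-1) ^ length ps)" using True ts(3) by simp
    then show ?thesis using rolle_both_ends[OF DCv nCv' e2 scale[OF ps(1)] Cv0] ps(2) that by auto
  next
    case False
    then have "weakly_signed Y 4 (- e2 * (-1) ^ length ts)" using end4 ts(3) by simp
    then obtain ps where ps: "alternates Y' (- e2) ps" "length ps = Suc (length ts)"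
      using rolle_both_ends[OF DY nY' e2 aY Y0] by auto
    then show ?thesis using rolle_left_end[OF DCv nCv' e2 scale[OF ps(1)] Cv0] that by auto
  qed
  have "alternates (\<lambda>y. - poly G y) (- e2) rs"
    apply (rule alternates_mult[OF rs(1), of _ "\<lambda>y. 1 / (w y * v y)"])
    subgoal for y using w_pos[of y] v_pos[of y] by (simp add: Cv'_def)
    done
  from alternates_uminus[OF this] have "alternates (poly G) e2 rs" by simp
  then show ?thesis using ts(2,4) rs(2) zs(4) by (intro exI[of _ rs] exI[of _ e2]) auto
qed

end

section \<open>Multipliers and counting of zeros\<close>

text \<open>The multiplier with an arbitrary eigenvalue sequence. The floor sends r + 1/2 to r, so
  the definition is an instance of \<open>jacobi_multiplier\<close> and inherits its existence and
  uniqueness; the function inserted is not entire.\<close>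

definition jmul :: "real \<Rightarrow> (nat \<Rightarrow> real) \<Rightarrow> real poly \<Rightarrow> real poly" where
  "jmul \<nu> e = jacobi_multiplier (\<lambda>u. complex_of_real (e (nat \<lfloor>Re u\<rfloor>))) \<nu>"

abbreviation "lin_poly T \<equiv> Vector_Spaces.linear (smult :: real \<Rightarrow> real poly \<Rightarrow> real poly) smult T"

lemma lin_poly_iff:
  "lin_poly T \<longleftrightarrow> (\<forall>p q. T (p + q) = T p + T q) \<and> (\<forall>c p. T (smult c p) = smult c (T p))"
  unfolding Vector_Spaces.linear_iff using vector_space_smult by simp

lemma nat_floor_half: "nat \<lfloor>real r + 1/2\<rfloor> = r"
proof -
  have "\<lfloor>real r + 1/2\<rfloor> = int r" by (rule floor_unique) auto
  then show ?thesis by simp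
qed

lemma jmul_char: "lin_poly T \<and> (\<forall>r. T (jacobi_P \<nu> r) = smult (e r) (jacobi_P \<nu> r)) \<longleftrightarrow> T = jmul \<nu> e"
proof -
  let ?E = "\<lambda>u. complex_of_real (e (nat \<lfloor>Re u\<rfloor>))"
  let ?P = "\<lambda>T. lin_poly T \<and> (\<forall>r. T (jacobi_P \<nu> r) = smult (e r) (jacobi_P \<nu> r))"
  have e: "Re (?E (of_nat r + 1 / 2)) = e r" for r using nat_floor_half[of r] by simp
  have ex1: "\<exists>!T. ?P T" using jacobi_multiplier_unique[of \<nu> ?E] unfolding e .
  have "jmul \<nu> e = (THE T. ?P T)" unfolding jmul_def jacobi_multiplier_def e ..
  then show ?thesis using theI'[OF ex1] ex1 by metis
qed

lemma jmul_linear: "jmul \<nu> e (p + q) = jmul \<nu> e p + jmul \<nu> e q" "jmul \<nu> e (smult c p) = smult c (jmul \<nu> e p)"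
  and jmul_P: "jmul \<nu> e (jacobi_P \<nu> r) = smult (e r) (jacobi_P \<nu> r)"
  using jmul_char[of "jmul \<nu> e" \<nu> e] by (simp_all add: lin_poly_iff)

lemma jmul_0 [simp]: "jmul \<nu> e 0 = 0"
  using jmul_linear(2)[of \<nu> e 0 0] by simp

lemma jacobi_multiplier_eq_jmul:
  "jacobi_multiplier E \<nu> = jmul \<nu> (\<lambda>r. Re (E (of_nat r + 1 / 2)))"
  unfolding jmul_char[symmetric] jacobi_multiplier_def
  by (rule theI'[OF jacobi_multiplier_unique])

lemma jmul_jmul: "jmul \<nu> e (jmul \<nu> e' p) = jmul \<nu> (\<lambda>r. e r * e' r) p"
proof -
  have "(\<lambda>p. jmul \<nu> e (jmul \<nu> e' p)) = jmul \<nu> (\<lambda>r. e r * e' r)"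
    unfolding jmul_char[symmetric] by (simp add: lin_poly_iff jmul_linear jmul_P mult.commute)
  then show ?thesis by metis
qed

lemma jmul_add: "jmul \<nu> e p + jmul \<nu> e' p = jmul \<nu> (\<lambda>r. e r + e' r) p"
proof -
  have "(\<lambda>p. jmul \<nu> e p + jmul \<nu> e' p) = jmul \<nu> (\<lambda>r. e r + e' r)"
    unfolding jmul_char[symmetric]
    by (simp add: lin_poly_iff jmul_linear jmul_P smult_add_right smult_add_left algebra_simps)
  then show ?thesis by metis
qed

lemma jmul_const: "smult c p = jmul \<nu> (\<lambda>_. c) p"
proof -
  have "smult c = jmul \<nu> (\<lambda>_. c)"
    unfolding jmul_char[symmetric] by (simp add: lin_poly_iff smult_add_right mult.commute)
  then show ?thesis by metis
qed

lemma jop_jmul: "jop \<nu> p = jmul \<nu> eig p"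
proof -
  have "jop \<nu> = jmul \<nu> eig"
    unfolding jmul_char[symmetric]
  proof (intro conjI allI)
    show "lin_poly (jop \<nu>)"
      unfolding lin_poly_iff by (auto intro!: poly_eqI simp: coeff_jop algebra_simps)
    show "jop \<nu> (jacobi_P \<nu> r) = smult (eig r) (jacobi_P \<nu> r)" for r
      unfolding jop_def jacobi_op_jacobi_P
      by (simp add: eig_def power2_eq_square algebra_simps flip: smult_add_left)
  qed
  then show ?thesis by simp
qed

lemma smult_diff_jmul: "jop \<nu> p - smult t p = jmul \<nu> (\<lambda>r. eig r - t) p"
proof -
  have "jop \<nu> p - smult t p = jop \<nu> p + smult (- t) p" by simp
  then show ?thesis unfolding jmul_const[of "- t" p \<nu>] jop_jmul jmul_add by simp
qed

lemma quad_jmul: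
  "jop \<nu> (jop \<nu> p - smult m p) - smult m (jop \<nu> p - smult m p) + smult \<delta> p
     = jmul \<nu> (\<lambda>r. (eig r - m)\<^sup>2 + \<delta>) p"
  unfolding smult_diff_jmul jmul_jmul jmul_const[of \<delta> p \<nu>] jmul_add by (simp add: power2_eq_square)

lemma poly_split_P:
  fixes p :: "real poly"
  assumes "degree p \<le> N"
  obtains q where "p = smult (coeff p N) (jacobi_P \<nu> N) + q" "q = 0 \<or> degree q < N"
proof
  let ?q = "p - smult (coeff p N) (jacobi_P \<nu> N)"
  show "p = smult (coeff p N) (jacobi_P \<nu> N) + ?q" by simp
  have "degree ?q \<le> N"
    using assms by (intro degree_diff_le) (auto intro: order_trans[OF degree_smult_le] simp: degree_jacobi_P)
  moreover have "coeff ?q N = 0" by (simp add: lead_coeff_jacobi_P)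
  ultimately show "?q = 0 \<or> degree ?q < N"
    by (metis leading_coeff_0_iff le_neq_implies_less)
qed

lemma jmul_coeff:
  assumes "degree p \<le> N"
  shows "degree (jmul \<nu> e p) \<le> N \<and> coeff (jmul \<nu> e p) N = e N * coeff p N"
  using assms
proof (induction N arbitrary: p rule: less_induct)
  case (less N)
  obtain q where q: "p = smult (coeff p N) (jacobi_P \<nu> N) + q" "q = 0 \<or> degree q < N"
    using poly_split_P[OF less.prems] by blast
  have m: "jmul \<nu> e p = smult (coeff p N * e N) (jacobi_P \<nu> N) + jmul \<nu> e q"
    by (subst q(1)) (simp add: jmul_linear jmul_P)
  have d: "degree (jmul \<nu> e q) < N \<or> jmul \<nu> e q = 0"
    using q(2) less.IH[of "degree q" q] by auto
  then have "coeff (jmul \<nu> e q) N = 0" by (auto simp: coeff_eq_0)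
  moreover have "degree (jmul \<nu> e q) \<le> N" using d by auto
  ultimately show ?case unfolding m
    by (auto intro!: degree_add_le order_trans[OF degree_smult_le] simp: degree_jacobi_P lead_coeff_jacobi_P)
qed

text \<open>Convergence of each eigenvalue separately suffices, since \<open>p\<close> is a finite
  combination of the eigenpolynomials.\<close>

lemma jmul_tendsto:
  assumes "\<And>r. ((\<lambda>m. e m r) \<longlongrightarrow> 1) F"
  shows "((\<lambda>m. poly (jmul \<nu> (e m) p) x) \<longlongrightarrow> poly p x) F"
proof (induction "degree p" arbitrary: p rule: less_induct)
  case less
  let ?N = "degree p"
  obtain q where q: "p = smult (coeff p ?N) (jacobi_P \<nu> ?N) + q" "q = 0 \<or> degree q < ?N"
    using poly_split_P[OF order_refl] by blast
  have m: "poly (jmul \<nu> (e m) p) x = coeff p ?N * e m ?N * poly (jacobi_P \<nu> ?N) x + poly (jmul \<nu> (e m) q) x" for m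
    by (subst q(1)) (simp add: jmul_linear jmul_P)
  have "((\<lambda>m. poly (jmul \<nu> (e m) q) x) \<longlongrightarrow> poly q x) F"
    using q(2) less[of q] by auto
  then have "((\<lambda>m. poly (jmul \<nu> (e m) p) x) \<longlongrightarrow> coeff p ?N * 1 * poly (jacobi_P \<nu> ?N) x + poly q x) F"
    unfolding m by (intro tendsto_intros assms)
  also have "coeff p ?N * 1 * poly (jacobi_P \<nu> ?N) x + poly q x = poly p x"
    using arg_cong[OF q(1), of "\<lambda>p. poly p x"] by simp
  finally show ?case .
qed

text \<open>The contribution of a zero \<open>\<rho>\<close> of \<open>E\<close>, with \<open>t = \<rho>\<^sup>2\<close>, at \<open>u = r + 1/2\<close>; a nonreal \<open>t\<close> comes with
  its conjugate.\<close>

definition factor :: "complex \<Rightarrow> real \<Rightarrow> real" where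
  "factor t x = (if Im t = 0 then x - Re t else (x - Re t)\<^sup>2 + (Im t)\<^sup>2)"

definition factors :: "complex list \<Rightarrow> nat \<Rightarrow> real" where
  "factors ts r = (\<Prod>t\<leftarrow>ts. factor t (eig r))"

section \<open>Counting zeros at 0 together with sign changes\<close>

definition vanishing :: "real poly \<Rightarrow> nat \<Rightarrow> bool" where
  "vanishing g ord \<longleftrightarrow> (\<forall>i<ord. coeff g i = 0)"

text \<open>Zeros at 0 and sign changes in \<open>(0, 4)\<close> together number at least \<open>n\<close>; at most \<open>b\<close> zeros are
  still counted at 0.\<close>

definition weak_count :: "nat \<Rightarrow> real poly \<Rightarrow> nat \<Rightarrow> bool" where
  "weak_count n g b \<longleftrightarrow> (\<exists>ord xs e. weakly_alternates (poly g) e xs \<and> set xs \<subseteq> {0<..<4} \<and> xs \<noteq> [] \<and>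
     (e = 1 \<or> e = -1) \<and> vanishing g ord \<and> n + 1 \<le> ord + length xs \<and> ord \<le> b \<and> 1 \<le> degree g)"

definition strict_count :: "nat \<Rightarrow> real poly \<Rightarrow> nat \<Rightarrow> bool" where
  "strict_count n g b \<longleftrightarrow> (\<exists>ord xs e. alternates (poly g) e xs \<and> xs \<noteq> [] \<and>
     (e = 1 \<or> e = -1) \<and> vanishing g ord \<and> n + 1 \<le> ord + length xs \<and> ord \<le> b \<and> 1 \<le> degree g)"

lemma weak_count_of_strict: "strict_count n g b \<Longrightarrow> weak_count n g b"
  unfolding strict_count_def weak_count_def
  using weakly_alternates_of_alternates alternates_interior by blast

lemma vanishing_jop:
  "vanishing g ord \<Longrightarrow> vanishing (jop \<nu> g - smult t g) (ord - 1)"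
  by (simp add: vanishing_def coeff_jop)

lemma degree_jmul_ge_1:
  assumes "1 \<le> degree g" "\<And>r. 1 \<le> r \<Longrightarrow> e r \<noteq> 0"
  shows "1 \<le> degree (jmul \<nu> e g)"
proof -
  have "g \<noteq> 0" using assms by auto
  then have "coeff (jmul \<nu> e g) (degree g) \<noteq> 0"
    using jmul_coeff[OF order_refl, of \<nu> e g] assms by simp
  then show ?thesis using assms(1) le_degree order_trans by blast
qed

lemma eig_ge: "1 \<le> r \<Longrightarrow> 9/4 \<le> eig r"
  using power_mono[of "3/2" "real r + 1/2" 2] by (simp add: eig_def power2_eq_square)

lemma single_step:
  assumes nu: "0 < \<nu>" "\<nu> < 2" and t: "t \<le> 1/4" and wc: "weak_count n g b"
  shows "strict_count n (jop \<nu> g - smult t g) (b - 1)"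
proof -
  interpret jacobi_single \<nu> t by unfold_locales (use nu t in auto)
  obtain ord xs e where a: "weakly_alternates (poly g) e xs" "set xs \<subseteq> {0<..<4}" "xs \<noteq> []" "e = 1 \<or> e = -1"
    and o: "vanishing g ord" "n + 1 \<le> ord + length xs" "ord \<le> b" "1 \<le> degree g"
    using wc unfolding weak_count_def by blast
  define G where "G = jop \<nu> g - smult t g"
  have "eig r - t \<noteq> 0" if "1 \<le> r" for r using eig_ge[OF that] t by simp
  then have dG: "1 \<le> degree G"
    unfolding G_def smult_diff_jmul using o(4) by (intro degree_jmul_ge_1)
  then have "G \<noteq> 0" by auto
  then obtain ys e' where ys: "alternates (poly G) e' ys" "e' = 1 \<or> e' = -1" "length xs + min ord 1 \<le> length ys"
    using sign_changes_single[OF _ a, of ord] o(1) unfolding G_def vanishing_def by blast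
  have "ys \<noteq> []" using ys(3) a(3) by auto
  moreover have "vanishing G (ord - 1)" using vanishing_jop[OF o(1)] by (simp add: G_def)
  moreover have "n + 1 \<le> (ord - 1) + length ys" using o(2) ys(3) by auto
  moreover have "ord - 1 \<le> b - 1" using o(3) by simp
  ultimately show ?thesis unfolding strict_count_def G_def[symmetric] using ys(1,2) dG by blast
qed

lemma pair_step:
  assumes nu: "0 < \<nu>" "\<nu> < 2" and m: "m \<le> 1" "\<delta> \<le> 4 * (1 - m)"
    and \<delta>: "0 < \<delta> \<or> (1/4 < m \<and> - ((1 - m)\<^sup>2) \<le> \<delta> \<and> - ((m - 1/4)\<^sup>2) < \<delta>)"
    and wc: "weak_count n g b"
  shows "strict_count n (jmul \<nu> (\<lambda>r. (eig r - m)\<^sup>2 + \<delta>) g) (b - 2)"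
proof -
  interpret jacobi_pair \<nu> m \<delta> by unfold_locales (use nu m \<delta> in auto)
  obtain ord xs e where a: "weakly_alternates (poly g) e xs" "set xs \<subseteq> {0<..<4}" "xs \<noteq> []" "e = 1 \<or> e = -1"
    and o: "vanishing g ord" "n + 1 \<le> ord + length xs" "ord \<le> b" "1 \<le> degree g"
    using wc unfolding weak_count_def by blast
  define F1 where "F1 = jop \<nu> g - smult m g"
  define G where "G = jop \<nu> F1 - smult m F1 + smult \<delta> g"
  have Gm: "G = jmul \<nu> (\<lambda>r. (eig r - m)\<^sup>2 + \<delta>) g" unfolding G_def F1_def by (rule quad_jmul)
  have "1 \<le> degree G" unfolding Gm
    using o(4) quad_pos by (intro degree_jmul_ge_1) (auto simp: less_imp_neq[symmetric])
  then have dG: "1 \<le> degree G" .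
  then have "G \<noteq> 0" by auto
  then obtain ys e' where ys: "alternates (poly G) e' ys" "e' = 1 \<or> e' = -1" "length xs + min ord 2 \<le> length ys"
    using sign_changes_pair[OF _ a, of ord] o(1) unfolding G_def F1_def vanishing_def by blast
  have "ys \<noteq> []" using ys(3) a(3) by auto
  moreover have "vanishing G (ord - 2)"
  proof -
    have "vanishing F1 (ord - 1)" unfolding F1_def using o(1) by (rule vanishing_jop)
    then have "vanishing (jop \<nu> F1 - smult m F1) (ord - 1 - 1)" by (rule vanishing_jop)
    then show ?thesis using o(1) unfolding G_def vanishing_def by auto
  qed
  moreover have "n + 1 \<le> (ord - 2) + length ys" using o(2) ys(3) by auto
  moreover have "ord - 2 \<le> b - 2" using o(3) by simp
  ultimately show ?thesis unfolding strict_count_def Gm[symmetric] using ys(1,2) dG by blast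
qed

lemma count_mono: "strict_count n g b \<Longrightarrow> b \<le> b' \<Longrightarrow> strict_count n g b'"
  unfolding strict_count_def by (blast intro: order_trans)

text \<open>Values of t whose factors can be applied in any number and order. The nonreal condition
  describes the squares of points of the strip of half-width 1; real t in (1/4, 1] is excluded
  because it needs a partner.\<close>

definition tame_zero :: "complex \<Rightarrow> bool" where
  "tame_zero t \<longleftrightarrow> (if Im t = 0 then Re t \<le> 1/4 else Re t \<le> 1 \<and> (Im t)\<^sup>2 \<le> 4 * (1 - Re t))"

lemma factor_step:
  assumes nu: "0 < \<nu>" "\<nu> < 2" and t: "tame_zero t" and wc: "weak_count n g b"
  shows "strict_count n (jmul \<nu> (\<lambda>r. factor t (eig r)) g) (b - 1)"
proof (cases "Im t = 0")
  case True
  then show ?thesis using single_step[OF nu _ wc, of "Re t"] t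
    by (simp add: factor_def tame_zero_def smult_diff_jmul)
next
  case False
  then have "strict_count n (jmul \<nu> (\<lambda>r. (eig r - Re t)\<^sup>2 + (Im t)\<^sup>2) g) (b - 2)"
    using t by (intro pair_step[OF nu _ _ _ wc]) (auto simp: tame_zero_def)
  then show ?thesis using False by (auto simp: factor_def intro: count_mono)
qed

lemma jmul_factors_Cons: "jmul \<nu> (factors (t # ts)) g = jmul \<nu> (\<lambda>r. factor t (eig r)) (jmul \<nu> (factors ts) g)"
  by (simp add: jmul_jmul factors_def[abs_def])

lemma jmul_factors_Nil: "jmul \<nu> (factors []) g = g"
  using jmul_const[of 1 g \<nu>] by (simp add: factors_def[abs_def])

text \<open>Each factor lowers the bound on the zeros counted at 0 by one and makes the alternation
  strict. An empty list does neither, hence the last assumption.\<close>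

lemma tame_factors:
  assumes nu: "0 < \<nu>" "\<nu> < 2" and t: "\<forall>t\<in>set ts. tame_zero t" and wc: "weak_count n g b"
    and "ts \<noteq> [] \<or> strict_count n g b"
  shows "strict_count n (jmul \<nu> (factors ts) g) (b - length ts)"
  using t assms(5)
proof (induction ts)
  case Nil
  then show ?case by (simp add: jmul_factors_Nil)
next
  case (Cons t ts)
  have "weak_count n (jmul \<nu> (factors ts) g) (b - length ts)"
  proof (cases "ts = []")
    case True
    then show ?thesis using wc by (simp add: jmul_factors_Nil)
  next
    case False
    then show ?thesis using Cons by (intro weak_count_of_strict) auto
  qed
  from factor_step[OF nu _ this, of t] Cons.prems show ?case by (simp add: jmul_factors_Cons)
qed

lemma large_pairs:
  assumes nu: "0 < \<nu>" "\<nu> < 2" and t: "\<forall>t\<in>set ts. Im t = 0 \<and> 1/4 < Re t \<and> Re t \<le> 1"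
    and wc: "weak_count n g b" and ev: "even (length ts)" and "ts \<noteq> [] \<or> strict_count n g b"
  shows "strict_count n (jmul \<nu> (factors ts) g) (b - length ts)"
  using t ev assms(6)
proof (induction ts rule: induct_list012)
  case 1
  then show ?case by (simp add: jmul_factors_Nil)
next
  case (3 s t ts)
  have wc': "weak_count n (jmul \<nu> (factors ts) g) (b - length ts)"
  proof (cases "ts = []")
    case True
    then show ?thesis using wc by (simp add: jmul_factors_Nil)
  next
    case False
    then show ?thesis using 3 by (intro weak_count_of_strict) auto
  qed
  \<comment> \<open>(X - s)(X - t) = (X - m)^2 - d^2, so here \<delta> = - d^2. That both numbers
    lie in (1/4, 1] gives |d| <= 1 - m and |d| < m - 1/4.\<close>
  define m where "m = (Re s + Re t) / 2"
  define d where "d = (Re s - Re t) / 2"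
  have st: "Im s = 0" "Im t = 0" "1/4 < Re s" "Re s \<le> 1" "1/4 < Re t" "Re t \<le> 1" using 3(3) by auto
  have md: "Re s = m + d" "Re t = m - d" by (simp_all add: m_def d_def field_simps)
  have "d\<^sup>2 \<le> (1 - m)\<^sup>2" using st md by (intro power2_le_iff_abs_le[THEN iffD2]) auto
  moreover have "d\<^sup>2 < (m - 1/4)\<^sup>2"
  proof -
    have "\<bar>d\<bar> < m - 1/4" using st md by auto
    then have "\<bar>d\<bar>\<^sup>2 < (m - 1/4)\<^sup>2" by (intro power_strict_mono) auto
    then show ?thesis by simp
  qed
  moreover have "m \<le> 1" "1/4 < m" using st md by auto
  moreover have "- d\<^sup>2 \<le> 4 * (1 - m)" by (rule order_trans[of _ 0]) (use \<open>m \<le> 1\<close> in auto)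
  ultimately have "strict_count n (jmul \<nu> (\<lambda>r. (eig r - m)\<^sup>2 + (- d\<^sup>2)) (jmul \<nu> (factors ts) g)) (b - length ts - 2)"
    by (intro pair_step[OF nu _ _ _ wc']) auto
  also have "(\<lambda>r. (eig r - m)\<^sup>2 + (- d\<^sup>2)) = (\<lambda>r. factor s (eig r) * factor t (eig r))"
    by (simp add: factor_def st(1,2) md fun_eq_iff power2_eq_square algebra_simps)
  finally show ?case by (simp add: jmul_factors_Cons jmul_jmul mult.assoc)
qed auto

text \<open>The n zeros at 0 and a list of one point already make n + 1.\<close>

lemma weak_count_start:
  assumes "1 \<le> n" "(\<alpha>, \<beta>) \<noteq> (0, 0)"
  shows "weak_count n (monom \<alpha> (n + 1) + monom \<beta> n) n"
proof -
  let ?f = "monom \<alpha> (n + 1) + monom \<beta> n"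
  have "coeff ?f n \<noteq> 0 \<or> coeff ?f (n + 1) \<noteq> 0" using assms by auto
  then have "1 \<le> degree ?f" using assms(1) le_degree[of ?f n] le_degree[of ?f "n + 1"] by auto
  moreover have "vanishing ?f n" by (simp add: vanishing_def)
  moreover have "weakly_alternates (poly ?f) (if 0 \<le> poly ?f 1 then 1 else - 1) [1]"
    by (simp add: weakly_alternates_def weakly_signed_def)
  ultimately show ?thesis unfolding weak_count_def
    by (intro exI[of _ n] exI[of _ "[1]"] exI[of _ "if 0 \<le> poly ?f 1 then 1 else - 1"]) auto
qed

lemma weak_count_uminus:
  assumes "weak_count n (- g) b" shows "weak_count n g b"
proof -
  obtain ord xs e where a: "weakly_alternates (poly (- g)) e xs" "set xs \<subseteq> {0<..<4}" "xs \<noteq> []" "e = 1 \<or> e = -1"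
    and o: "vanishing (- g) ord" "n + 1 \<le> ord + length xs" "ord \<le> b" "1 \<le> degree (- g)"
    using assms unfolding weak_count_def by blast
  have al: "alternating (weakly_signed (poly (- g))) e xs" using a(1) by (simp add: weakly_alternates_def)
  have "alternating (weakly_signed (poly g)) (- e) xs"
    by (rule alternating_flip[OF al]) (simp only: weakly_signed_def poly_minus mult_minus_right mult_minus_left)
  then have "weakly_alternates (poly g) (- e) xs" using a(1) by (simp add: weakly_alternates_def)
  then show ?thesis unfolding weak_count_def using a o by (intro exI[of _ ord] exI[of _ xs] exI[of _ "- e"]) (auto simp: vanishing_def)
qed

text \<open>A single factor with \<open>t > 1/4\<close> may lose sign changes in general, but not on \<open>y\<^sup>n (\<alpha> y + \<beta>)\<close>: the image is
  \<open>y\<^sup>n\<^sup>-\<^sup>1\<close> times a quadratic, and \<open>t \<le> 1/4 + e\<close> says exactly that the quadratic has the sign of \<open>- \<alpha>\<close> (or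
  vanishes) at \<open>K / A\<close>.\<close>

lemma leftover_step_pos:
  assumes nu: "0 < \<nu>" "\<nu> < 2" and n: "1 \<le> n" and t: "1/4 < t" "t \<le> 1" "t \<le> 1/4 + e_const n \<nu>"
    and \<alpha>: "0 < \<alpha> \<or> (\<alpha> = 0 \<and> 0 < \<beta>)"
  shows "weak_count n (jop \<nu> (monom \<alpha> (n + 1) + monom \<beta> n) - smult t (monom \<alpha> (n + 1) + monom \<beta> n)) n"
proof -
  define f where "f = monom \<alpha> (n + 1) + monom \<beta> n"
  define G where "G = jop \<nu> f - smult t f"
  define A where "A = eig n - t"
  define A' where "A' = eig (n + 1) - t"
  define K where "K = shift_const \<nu> (n - 1)"
  define K' where "K' = shift_const \<nu> n"
  have K: "K = 4 * real n * (real n - 1 + \<nu>)" using n by (simp add: K_def shift_const_def)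
  have K': "K' = 4 * (real n + 1) * (real n + \<nu>)" by (simp add: K'_def shift_const_def)
  have n1: "1 \<le> real n" using n by simp
  have pos: "0 < K" "0 < A" "0 < A'"
    using n1 nu eig_ge[of n] eig_ge[of "n + 1"] t n by (auto simp: K A_def A'_def)
  have e: "A = real n * (real n + 1) + (1/4 - t)" "A' = (real n + 1) * (real n + 2) + (1/4 - t)"
    by (simp_all add: A_def A'_def eig_def power2_eq_square algebra_simps)
  have ec: "(t - 1/4) * (2 * real n + \<nu>) \<le> real n * (real n + 1) * (2 - \<nu>)"
  proof -
    have "t - 1/4 \<le> real n * (real n + 1) * (2 - \<nu>) / (2 * real n + \<nu>)" using t(3) by (simp add: e_const_def)
    then show ?thesis using nu n1 by (simp add: pos_le_divide_eq)
  qed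
  have cross: "A' * K \<le> K' * A"
  proof -
    have "K' * A - A' * K = 4 * (real n * (real n + 1) * (2 - \<nu>) - (t - 1/4) * (2 * real n + \<nu>))"
      unfolding K K' e by (simp add: algebra_simps)
    with ec show ?thesis by simp
  qed
  \<comment> \<open>This places \<open>y1 = K / A\<close> to the left of 4, where it can serve as a
    point of the alternation.\<close>
  have K4: "K < 4 * A"
  proof -
    have "(t - 1/4) * (2 * real n + \<nu>) < real n * (2 - \<nu>) * (2 * real n + \<nu>)"
    proof -
      have "real n + 1 < 2 * real n + \<nu>" using n1 nu by simp
      then have "real n * (2 - \<nu>) * (real n + 1) < real n * (2 - \<nu>) * (2 * real n + \<nu>)"
        using n1 nu by (intro mult_strict_left_mono) auto
      with ec show ?thesis by (simp add: mult_ac)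
    qed
    then have "t - 1/4 < real n * (2 - \<nu>)" using nu n1 by (simp add: mult_less_cancel_right)
    then show ?thesis unfolding K e by (simp add: algebra_simps)
  qed
  have G: "G = monom (\<alpha> * A') (n + 1) + monom (\<beta> * A - \<alpha> * K') n + monom (- \<beta> * K) (n - 1)"
  proof (rule poly_eqI)
    fix i
    consider "i = n + 1" | "i = n" | "Suc i = n" | "i \<noteq> n + 1" "i \<noteq> n" "Suc i \<noteq> n" by blast
    then show "coeff G i = coeff (monom (\<alpha> * A') (n + 1) + monom (\<beta> * A - \<alpha> * K') n + monom (- \<beta> * K) (n - 1)) i"
      by cases (use n in \<open>auto simp: G_def f_def coeff_jop A_def A'_def K_def K'_def algebra_simps\<close>)
  qed
  define Q where "Q y = \<alpha> * A' * y\<^sup>2 + (\<beta> * A - \<alpha> * K') * y - \<beta> * K" for y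
  have pG: "poly G y = y ^ (n - 1) * Q y" for y
  proof -
    obtain k where k: "n = Suc k" using n by (cases n) auto
    show ?thesis unfolding G Q_def k by (simp add: poly_monom power2_eq_square algebra_simps)
  qed
  have dG: "1 \<le> degree G"
  proof -
    have "coeff f n \<noteq> 0 \<or> coeff f (n + 1) \<noteq> 0" using \<alpha> by (auto simp: f_def)
    then have "1 \<le> degree f" using n le_degree[of f n] le_degree[of f "n + 1"] by auto
    then show ?thesis unfolding G_def smult_diff_jmul
      by (rule degree_jmul_ge_1) (use eig_ge t in force)
  qed
  have vG: "vanishing G (n - 1)" unfolding G_def by (rule vanishing_jop) (simp add: f_def vanishing_def)
  \<comment> \<open>The n - 1 zeros at 0 that remain and two points of opposite weak sign make n +
    1. One of the points will be \<open>y1\<close>, the other lies near 0 or near 4, according to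
    the sign of \<beta>.\<close>
  have two: "weak_count n G n" if "0 < x" "x < y" "y < 4" "e = 1 \<or> e = -1" "0 \<le> e * Q x" "e * Q y \<le> 0" for x y e
  proof -
    have s: "0 \<le> e * poly G z \<longleftrightarrow> 0 \<le> e * Q z" if "0 < z" for z e
    proof -
      have eq: "e * poly G z = z ^ (n - 1) * (e * Q z)" by (simp add: pG)
      have "0 < z ^ (n - 1)" using that by simp
      from mult_le_cancel_left_pos[OF this, of 0 "e * Q z"] show ?thesis
        unfolding eq by (simp only: mult_zero_right)
    qed
    have "0 \<le> - e * Q y" using that(6) by simp
    then have "weakly_alternates (poly G) e [x, y]"
      using that s[of x e] s[of y "- e"] by (simp add: weakly_alternates_def weakly_signed_def)
    then show ?thesis unfolding weak_count_def using that vG dG n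
      by (intro exI[of _ "n - 1"] exI[of _ "[x, y]"] exI[of _ e]) auto
  qed
  have cont: "isCont Q z" for z unfolding Q_def[abs_def] by (intro continuous_intros)
  define y1 where "y1 = K / A"
  have y1: "0 < y1" "y1 < 4" using pos K4 by (simp_all add: y1_def field_simps)
  have Qy1: "Q y1 \<le> 0" if "0 \<le> \<alpha>"
  proof -
    have "Q y1 = \<alpha> * (y1 * (A' * y1 - K'))"
      using pos by (simp add: Q_def y1_def power2_eq_square field_simps)
    moreover have "A' * y1 \<le> K'" using cross pos by (simp add: y1_def field_simps)
    ultimately show ?thesis using that y1 by (simp add: mult_nonneg_nonpos)
  qed
  have Q0: "Q 0 = - \<beta> * K" by (simp add: Q_def)
  consider "\<beta> = 0" | "\<beta> < 0" | "0 < \<beta>" by linarith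
  then have "weak_count n G n"
  proof cases
    case 1
    have "vanishing G n" using 1 n by (auto simp: vanishing_def G)
    moreover have "weakly_alternates (poly G) (if 0 \<le> poly G 1 then 1 else - 1) [1]"
      by (simp add: weakly_alternates_def weakly_signed_def)
    ultimately show ?thesis unfolding weak_count_def using dG
      by (intro exI[of _ n] exI[of _ "[1]"] exI[of _ "if 0 \<le> poly G 1 then 1 else - 1"]) auto
  next
    case 2
    then have "0 < Q 0" using pos by (simp add: Q0 mult_neg_pos)
    with cont[of 0] have "eventually (\<lambda>y. 0 < Q y) (at_right 0)"
      unfolding isCont_def by (intro order_tendstoD(1)) (auto intro: tendsto_mono[OF at_le])
    then have "eventually (\<lambda>y. 0 < Q y \<and> y \<in> {0<..<y1}) (at_right 0)"
      using y1 by (intro eventually_conj eventually_at_right_real)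
    from eventually_happens'[OF _ this] obtain x where "0 < Q x" "0 < x" "x < y1" by auto
    then show ?thesis using two[of x y1 1] y1 Qy1 \<alpha> by auto
  next
    case 3
    have "0 < Q 4"
    proof -
      have "Q 4 = 4 * \<alpha> * (4 * A' - K') + \<beta> * (4 * A - K)" by (simp add: Q_def power2_eq_square algebra_simps)
      moreover have "0 \<le> 4 * A' - K'"
      proof -
        have "K' * A \<le> 4 * A' * A"
        proof -
          have "4 * A' - K' = 4 * ((real n + 1) * (2 - \<nu>) - (t - 1/4))" unfolding e K' by (simp add: algebra_simps)
          moreover have "t - 1/4 < real n * (2 - \<nu>)" using K4 unfolding K e by (simp add: algebra_simps)
          ultimately have "0 \<le> 4 * A' - K'" using nu by (simp add: algebra_simps)
          then show ?thesis using pos by (simp add: mult_right_mono)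
        qed
        then show ?thesis using pos by (simp add: mult_le_cancel_right)
      qed
      then have "0 \<le> 4 * \<alpha> * (4 * A' - K')" using \<alpha> by auto
      moreover have "0 < \<beta> * (4 * A - K)" using 3 K4 by simp
      ultimately show ?thesis by linarith
    qed
    with cont[of 4] have "eventually (\<lambda>y. 0 < Q y) (at_left 4)"
      unfolding isCont_def by (intro order_tendstoD(1)) (auto intro: tendsto_mono[OF at_le])
    then have "eventually (\<lambda>y. 0 < Q y \<and> y \<in> {y1<..<4}) (at_left 4)"
      using y1 by (intro eventually_conj eventually_at_left_real)
    from eventually_happens'[OF _ this] obtain x where "0 < Q x" "y1 < x" "x < 4" by auto
    then show ?thesis using two[of y1 x "- 1"] y1 Qy1 \<alpha> by auto
  qed
  then show ?thesis by (simp add: G_def f_def)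
qed

section \<open>Factorization of even entire functions\<close>

lemma entire_eq_off_finite:
  fixes f g :: "complex \<Rightarrow> complex"
  assumes "f holomorphic_on UNIV" "g holomorphic_on UNIV" "finite S" "\<And>u. u \<notin> S \<Longrightarrow> f u = g u"
  shows "f u = g u"
proof -
  have "closed {u. f u = g u}"
    using assms(1,2) by (intro closed_Collect_eq holomorphic_on_imp_continuous_on)
  moreover have "- S \<subseteq> {u. f u = g u}" using assms(4) by auto
  ultimately have "closure (- S) \<subseteq> {u. f u = g u}" by (intro closure_minimal)
  moreover have "closure (- S) = UNIV"
    using empty_interior_finite[OF assms(3)] by (simp add: closure_complement)
  ultimately show ?thesis by auto
qed

definition even_entire :: "(complex \<Rightarrow> complex) \<Rightarrow> bool" where
  "even_entire f \<longleftrightarrow> f holomorphic_on UNIV \<and> (\<forall>u. f (- u) = f u)"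

lemma finite_square_roots: "finite {u::complex. u\<^sup>2 = t}"
  by (rule finite_nth_roots) simp

lemma holomorphic_reflect:
  assumes "f holomorphic_on UNIV" shows "(\<lambda>u::complex. f (- u)) holomorphic_on UNIV"
proof -
  have "(\<lambda>u::complex. - u) holomorphic_on UNIV" by (intro holomorphic_intros)
  from holomorphic_on_compose_gen[OF this assms] show ?thesis by (simp add: o_def)
qed

lemma entire_divide_zero:
  assumes "f holomorphic_on UNIV" "f a = 0"
  obtains g where "g holomorphic_on UNIV" "\<And>u. f u = (u - a) * g u"
proof
  show "(\<lambda>z. if z = a then deriv f a else (f z - f a) / (z - a)) holomorphic_on UNIV"
    using assms by (intro pole_lemma) auto
qed (use assms in auto)

text \<open>A zero \<rho> of an even function comes with - \<rho>. For \<rho> = 0 it is at least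
  double, because the first quotient is odd.\<close>

lemma even_entire_divide:
  assumes "even_entire f" "f \<rho> = 0"
  obtains g where "even_entire g" "\<And>u. f u = (u\<^sup>2 - \<rho>\<^sup>2) * g u"
proof -
  have f: "f holomorphic_on UNIV" "\<And>u. f (- u) = f u" using assms by (auto simp: even_entire_def)
  obtain k where k: "k holomorphic_on UNIV" "\<And>u. f u = (u - \<rho>) * k u"
    using entire_divide_zero[OF f(1) assms(2)] by blast
  have "k (- \<rho>) = 0"
  proof (cases "\<rho> = 0")
    case False
    then show ?thesis using k(2)[of "- \<rho>"] f(2)[of \<rho>] assms(2) by auto
  next
    case True
    have "k u = - k (- u)" for u
    proof (rule entire_eq_off_finite[of k "\<lambda>u. - k (- u)" "{0}"])
      show "(\<lambda>u. - k (- u)) holomorphic_on UNIV"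
        by (intro holomorphic_intros holomorphic_reflect k)
      show "k u = - k (- u)" if "u \<notin> {0}" for u
      proof -
        have "u * k u = u * (- k (- u))" using k(2)[of u] k(2)[of "- u"] f(2)[of u] True by simp
        with that show ?thesis by (simp only: mult_cancel_left) simp
      qed
    qed (use k in auto)
    from this[of 0] show ?thesis using True by simp
  qed
  then obtain g where g: "g holomorphic_on UNIV" "\<And>u. k u = (u - - \<rho>) * g u"
    using entire_divide_zero[OF k(1)] by blast
  have fg: "f u = (u\<^sup>2 - \<rho>\<^sup>2) * g u" for u
    using k(2)[of u] g(2)[of u] by (simp add: power2_eq_square algebra_simps)
  have "g u = g (- u)" for u
  proof (rule entire_eq_off_finite[of g "\<lambda>u. g (- u)" "{u. u\<^sup>2 = \<rho>\<^sup>2}"])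
    show "(\<lambda>u. g (- u)) holomorphic_on UNIV"
      by (intro holomorphic_reflect g)
    show "g u = g (- u)" if "u \<notin> {u. u\<^sup>2 = \<rho>\<^sup>2}" for u
      using fg[of u] fg[of "- u"] f(2)[of u] that by simp
  qed (use g finite_square_roots in auto)
  then have "even_entire g" using g by (simp add: even_entire_def)
  then show ?thesis using fg that by blast
qed

definition cfactor :: "complex \<Rightarrow> complex \<Rightarrow> complex" where
  "cfactor t u = (if Im t = 0 then u\<^sup>2 - t else (u\<^sup>2 - t) * (u\<^sup>2 - cnj t))"

definition cfactors :: "complex list \<Rightarrow> complex \<Rightarrow> complex" where
  "cfactors ts u = (\<Prod>t\<leftarrow>ts. cfactor t u)"

lemma cfactors_simps [simp]: "cfactors [] u = 1" "cfactors (t # ts) u = cfactor t u * cfactors ts u"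
  "cfactors (ss @ ts) u = cfactors ss u * cfactors ts u"
  by (simp_all add: cfactors_def)

lemma cnj_cfactor: "cfactor t (cnj u) = cnj (cfactor t u)"
proof (cases "Im t = 0")
  case True
  then have "cnj t = t" by (simp add: complex_eq_iff)
  with True show ?thesis by (simp add: cfactor_def)
qed (simp add: cfactor_def mult.commute)

lemma cfactor_eq_0: "cfactor t u = 0 \<Longrightarrow> u\<^sup>2 = t \<or> u\<^sup>2 = cnj t"
  by (auto simp: cfactor_def split: if_splits)

lemma cfactors_half: "cfactors ts (of_nat r + 1 / 2) = of_real (factors ts r)"
proof (induction ts)
  case (Cons t ts)
  have e: "(of_nat r + 1 / 2 :: complex)\<^sup>2 = of_real (eig r)" by (simp add: eig_def)
  have "cfactor t (of_nat r + 1 / 2) = of_real (factor t (eig r))"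
    unfolding cfactor_def e factor_def
    by (auto simp: complex_eq_iff power2_eq_square algebra_simps)
  with Cons show ?case by (simp add: factors_def)
qed (simp add: factors_def)

definition decomp :: "(complex \<Rightarrow> complex) \<Rightarrow> complex list \<Rightarrow> (complex \<Rightarrow> complex) \<Rightarrow> bool" where
  "decomp E ts F \<longleftrightarrow> even_entire F \<and> (\<forall>u. F (cnj u) = cnj (F u)) \<and> (\<forall>u. E u = cfactors ts u * F u)"

lemma decomp_self: "even_entire E \<Longrightarrow> \<forall>u. E (cnj u) = cnj (E u) \<Longrightarrow> decomp E [] E"
  by (simp add: decomp_def)

lemma decomp_trans: "decomp E ss F \<Longrightarrow> decomp F ts G \<Longrightarrow> decomp E (ss @ ts) G"
  by (simp add: decomp_def mult.assoc)

text \<open>For nonreal \<rho>^2 the conjugate of \<rho> is a further zero that the first quadratic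
  factor does not account for, so both factors divide. The symmetry of the quotient follows off the
  finitely many zeros of \<open>cfactor\<close>.\<close>

lemma decomp_step:
  assumes "decomp E ts F" "F \<rho> = 0"
  obtains G where "decomp E (ts @ [\<rho>\<^sup>2]) G"
proof -
  have F: "even_entire F" "\<And>u. F (cnj u) = cnj (F u)" using assms by (auto simp: decomp_def)
  obtain g where g: "even_entire g" "\<And>u. F u = (u\<^sup>2 - \<rho>\<^sup>2) * g u"
    using even_entire_divide[OF F(1) assms(2)] by blast
  have "\<exists>G. even_entire G \<and> (\<forall>u. F u = cfactor (\<rho>\<^sup>2) u * G u)"
  proof (cases "Im (\<rho>\<^sup>2) = 0")
    case True
    then show ?thesis using g by (auto simp: cfactor_def)
  next
    case False
    have "F (cnj \<rho>) = 0" using F(2) assms(2) by simp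
    moreover have "(cnj \<rho>)\<^sup>2 - \<rho>\<^sup>2 \<noteq> 0"
    proof
      assume "(cnj \<rho>)\<^sup>2 - \<rho>\<^sup>2 = 0"
      then have "cnj (\<rho>\<^sup>2) = \<rho>\<^sup>2" by simp
      then have "- Im (\<rho>\<^sup>2) = Im (\<rho>\<^sup>2)" by (metis cnj.simps(2))
      then show False using False by simp
    qed
    ultimately have "g (cnj \<rho>) = 0" using g(2)[of "cnj \<rho>"] by simp
    then obtain k where "even_entire k" "\<And>u. g u = (u\<^sup>2 - (cnj \<rho>)\<^sup>2) * k u"
      using even_entire_divide[OF g(1)] by blast
    then show ?thesis using g(2) False by (auto simp: cfactor_def)
  qed
  then obtain G where G: "even_entire G" "\<And>u. F u = cfactor (\<rho>\<^sup>2) u * G u" by blast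
  have "G (cnj u) = cnj (G u)" for u
  proof -
    have h: "(\<lambda>u. cnj (G (cnj u))) holomorphic_on UNIV"
      using G(1) holomorphic_on_compose_cnj_cnj[of G UNIV] holomorphic_on_subset[of G UNIV "range cnj"]
      unfolding even_entire_def by (simp add: o_def)
    have "G u = cnj (G (cnj u))" for u
    proof (rule entire_eq_off_finite[OF _ h, of G "{u. u\<^sup>2 = \<rho>\<^sup>2} \<union> {u. u\<^sup>2 = cnj (\<rho>\<^sup>2)}"])
      show "G u = cnj (G (cnj u))" if "u \<notin> {u. u\<^sup>2 = \<rho>\<^sup>2} \<union> {u. u\<^sup>2 = cnj (\<rho>\<^sup>2)}" for u
      proof -
        have nz: "cfactor (\<rho>\<^sup>2) u \<noteq> 0" using that cfactor_eq_0[of "\<rho>\<^sup>2" u] by auto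
        have "cnj (F (cnj u)) = F u" using F(2) by simp
        then have "cfactor (\<rho>\<^sup>2) u * cnj (G (cnj u)) = cfactor (\<rho>\<^sup>2) u * G u"
          unfolding G(2) by (simp add: cnj_cfactor)
        with nz show ?thesis by simp
      qed
    qed (use G(1) finite_square_roots in \<open>simp_all add: even_entire_def del: complex_cnj_power\<close>)
    from this[of "cnj u"] show ?thesis by (simp only: complex_cnj_cnj)
  qed
  then have "decomp E (ts @ [\<rho>\<^sup>2]) G"
    using assms(1) G by (simp add: decomp_def mult.assoc)
  then show ?thesis using that by blast
qed

lemma decomp_zero: "decomp E ts F \<Longrightarrow> F \<rho> = 0 \<Longrightarrow> E \<rho> = 0"
  by (simp add: decomp_def)

section \<open>Dividing out the zeros in a disc\<close>

lemma cfactor_lower: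
  assumes "norm t \<le> R\<^sup>2" "c * R\<^sup>2 \<le> (norm u)\<^sup>2 - R\<^sup>2" "norm (z\<^sup>2 - t) \<le> c * R\<^sup>2" "norm (z\<^sup>2 - cnj t) \<le> c * R\<^sup>2" "0 \<le> c"
  shows "norm (cfactor t z) \<le> norm (cfactor t u)"
proof -
  have "(norm u)\<^sup>2 - norm t \<le> norm (u\<^sup>2 - t)" "(norm u)\<^sup>2 - norm (cnj t) \<le> norm (u\<^sup>2 - cnj t)"
    by (metis norm_triangle_ineq2 norm_power)+
  then have "norm (z\<^sup>2 - t) \<le> norm (u\<^sup>2 - t)" "norm (z\<^sup>2 - cnj t) \<le> norm (u\<^sup>2 - cnj t)"
    using assms by auto
  then show ?thesis by (auto simp: cfactor_def norm_mult intro!: mult_mono)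
qed

text \<open>For |s| <= R^2, |z^2 - s| is at most 2 R^2, while |u^2 - s| is at least 8 R^2.\<close>

lemma cfactor_lower4:
  assumes "norm t \<le> R\<^sup>2" "norm u = 3 * R" "norm z \<le> R" "0 \<le> R"
  shows "4 * norm (cfactor t z) \<le> norm (cfactor t u)"
proof -
  have z: "(norm z)\<^sup>2 \<le> R\<^sup>2" using assms by (intro power_mono) auto
  have b: "4 * norm (z\<^sup>2 - s) \<le> norm (u\<^sup>2 - s)" "norm (z\<^sup>2 - s) \<le> norm (u\<^sup>2 - s)" if "norm s \<le> R\<^sup>2" for s
  proof -
    have "norm (z\<^sup>2 - s) \<le> 2 * R\<^sup>2"
      using norm_triangle_ineq4[of "z\<^sup>2" s] z that by (simp add: norm_power)
    moreover have "(norm u)\<^sup>2 - norm s \<le> norm (u\<^sup>2 - s)" by (metis norm_triangle_ineq2 norm_power)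
    then have "8 * R\<^sup>2 \<le> norm (u\<^sup>2 - s)" using that assms(2) by (simp add: power_mult_distrib)
    ultimately show "4 * norm (z\<^sup>2 - s) \<le> norm (u\<^sup>2 - s)" by linarith
    with norm_ge_zero[of "z\<^sup>2 - s"] show "norm (z\<^sup>2 - s) \<le> norm (u\<^sup>2 - s)" by linarith
  qed
  note 1 = b(1)[OF assms(1)] b(2)[of "cnj t"]
  show ?thesis
  proof (cases "Im t = 0")
    case False
    have "(4 * norm (z\<^sup>2 - t)) * norm (z\<^sup>2 - cnj t) \<le> norm (u\<^sup>2 - t) * norm (u\<^sup>2 - cnj t)"
      using 1 assms(1) by (intro mult_mono) auto
    then show ?thesis using False by (simp add: cfactor_def norm_mult)
  qed (use 1 in \<open>simp add: cfactor_def\<close>)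
qed

lemma cball_max_modulus:
  assumes "f holomorphic_on UNIV" "0 < R" "\<And>z. norm z = R \<Longrightarrow> norm (f z) \<le> B" "norm \<xi> \<le> R"
  shows "norm (f \<xi>) \<le> B"
  by (rule maximum_modulus_frontier[where S = "cball 0 R" and f = f])
    (use assms in \<open>auto intro: holomorphic_on_subset holomorphic_on_imp_continuous_on continuous_on_subset simp: frontier_cball sphere_def\<close>)

text \<open>Each removed zero in the disc of radius \<open>R\<close> costs a factor 4 in the maximum modulus principle on
  the disc of radius \<open>3 R\<close>, so the removal stops.\<close>

lemma decomp_ball:
  assumes E: "even_entire E" "\<forall>u. E (cnj u) = cnj (E u)" and z0: "E z0 \<noteq> 0" "norm z0 < R"
  obtains ts F where "decomp E ts F" "\<And>u. norm u < R \<Longrightarrow> F u \<noteq> 0"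
    "\<And>t. t \<in> set ts \<Longrightarrow> \<exists>\<rho>. t = \<rho>\<^sup>2 \<and> E \<rho> = 0 \<and> norm \<rho> < R"
proof -
  have R: "0 < R" using z0(2) norm_ge_zero[of z0] by linarith
  define P where "P ts \<longleftrightarrow> (\<exists>F. decomp E ts F) \<and> (\<forall>t\<in>set ts. \<exists>\<rho>. t = \<rho>\<^sup>2 \<and> E \<rho> = 0 \<and> norm \<rho> < R)" for ts
  have "compact (E ` sphere 0 (3 * R))"
    using E(1) unfolding even_entire_def
    by (intro compact_continuous_image) (auto intro: continuous_on_subset holomorphic_on_imp_continuous_on)
  then obtain M where "\<forall>x\<in>E ` sphere 0 (3 * R). norm x \<le> M"
    using compact_imp_bounded bounded_iff by metis
  then have M: "norm (E u) \<le> M" if "norm u = 3 * R" for u using that by simp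
  have bound: "4 ^ length ts * norm (E z0) \<le> M" if "P ts" for ts
  proof -
    obtain F where F: "decomp E ts F" using \<open>P ts\<close> unfolding P_def by blast
    have ts: "norm t \<le> R\<^sup>2" if "t \<in> set ts" for t
    proof -
      obtain \<rho> where "t = \<rho>\<^sup>2" "norm \<rho> < R" using \<open>P ts\<close> \<open>t \<in> set ts\<close> unfolding P_def by blast
      then show ?thesis by (simp add: norm_power power_mono)
    qed
    have c: "4 ^ length ts * norm (cfactors ts z0) \<le> norm (cfactors ts u)" if "norm u = 3 * R" for u
      using ts
    proof (induction ts)
      case (Cons t ts)
      have "(4 * norm (cfactor t z0)) * (4 ^ length ts * norm (cfactors ts z0)) \<le> norm (cfactor t u) * norm (cfactors ts u)"
        using Cons that z0(2) R by (intro mult_mono cfactor_lower4[where R = R]) auto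
      then show ?case by (simp add: norm_mult mult_ac)
    qed simp
    have cz: "cfactors ts z0 \<noteq> 0" "F z0 \<noteq> 0" using F z0(1) by (auto simp: decomp_def)
    define B where "B = M / (4 ^ length ts * norm (cfactors ts z0))"
    have "norm (F z0) \<le> B"
    proof (rule cball_max_modulus[where R = "3 * R" and f = F])
      show "norm (F u) \<le> B" if "norm u = 3 * R" for u
      proof -
        have "(4 ^ length ts * norm (cfactors ts z0)) * norm (F u) \<le> norm (cfactors ts u) * norm (F u)"
          using c[OF that] by (intro mult_right_mono) auto
        also have "\<dots> = norm (E u)" using F by (simp add: decomp_def norm_mult)
        also have "\<dots> \<le> M" by (rule M[OF that])
        finally show ?thesis using cz by (simp add: B_def pos_le_divide_eq mult.commute)
      qed
    qed (use F R z0 in \<open>auto simp: decomp_def even_entire_def\<close>)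
    then have "4 ^ length ts * (norm (cfactors ts z0) * norm (F z0)) \<le> M"
      using cz by (simp add: B_def pos_le_divide_eq mult_ac)
    then show ?thesis using F by (simp add: decomp_def norm_mult)
  qed
  obtain N :: nat where N: "M / norm (E z0) < 4 ^ N" using real_arch_pow[of 4 "M / norm (E z0)"] by auto
  have len: "length ts < N" if "P ts" for ts
  proof -
    have "M < 4 ^ N * norm (E z0)" using N z0(1) by (simp add: pos_divide_less_eq)
    with bound[OF that] have "4 ^ length ts * norm (E z0) < 4 ^ N * norm (E z0)" by linarith
    then have "(4::real) ^ length ts < 4 ^ N" using z0(1) by (simp add: mult_less_cancel_right)
    then show ?thesis by (simp add: power_strict_increasing_iff)
  qed
  have "P []" using decomp_self[OF E] by (auto simp: P_def)
  \<comment> \<open>A list of maximal length: a further zero of the cofactor in the disc would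
    extend it.\<close>
  then obtain ts where ts: "P ts" "\<And>ss. P ss \<Longrightarrow> length ss \<le> length ts"
    using ex_has_greatest_nat[of P "[]" length N] len by (metis less_imp_le)
  then obtain F where F: "decomp E ts F" unfolding P_def by blast
  have "F u \<noteq> 0" if "norm u < R" for u
  proof
    assume "F u = 0"
    then obtain G where "decomp E (ts @ [u\<^sup>2]) G" using decomp_step[OF F] by blast
    moreover have "E u = 0" using decomp_zero[OF F \<open>F u = 0\<close>] .
    ultimately have "P (ts @ [u\<^sup>2])" using ts(1) that by (auto simp: P_def)
    from ts(2)[OF this] show False by simp
  qed
  then show ?thesis using that[OF F] ts(1) by (auto simp: P_def)
qed

text \<open>A Borel--Caratheodory estimate; \<open>F\<close> being even, \<open>G\<close> vanishes to second order at 0.\<close>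

lemma even_entire_log_bound:
  assumes F: "even_entire F" and R: "0 < R" and nz: "\<And>z. norm z < R \<Longrightarrow> F z \<noteq> 0"
    and A: "0 < A" "\<And>z. norm z < R \<Longrightarrow> norm (F z) < norm (F 0) * exp A"
    and u: "4 * (norm u / R)\<^sup>2 \<le> 1"
  obtains G where "F u = F 0 * exp G" "norm G \<le> 8 * A * (norm u / R)\<^sup>2"
proof -
  have Fh: "F holomorphic_on UNIV" and Fe: "\<And>z. F (- z) = F z" using F by (auto simp: even_entire_def)
  have F0: "F 0 \<noteq> 0" using nz[of 0] R by simp
  obtain G0 where G0: "G0 holomorphic_on ball 0 R" "\<And>z. z \<in> ball 0 R \<Longrightarrow> F z = exp (G0 z)"
    using contractible_imp_holomorphic_log[of F "ball 0 R"] Fh nz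
    by (auto intro: holomorphic_on_subset convex_imp_contractible)
  define G where "G z = G0 z - G0 0" for z
  have Gh: "G holomorphic_on ball 0 R" unfolding G_def[abs_def] by (intro holomorphic_intros G0)
  have FG: "F z = F 0 * exp (G z)" if "norm z < R" for z
  proof -
    have "F z = exp (G0 z)" "F 0 = exp (G0 0)" using G0(2) that R by auto
    moreover have "exp (G0 z) = exp (G0 0) * exp (G z)" by (simp add: G_def flip: exp_add)
    ultimately show ?thesis by metis
  qed
  have ReG: "Re (G z) < A" if "norm z < R" for z
  proof -
    have "norm (F 0) * exp (Re (G z)) < norm (F 0) * exp A"
      using A(2)[OF that] FG[OF that] by (simp add: norm_mult)
    then show ?thesis using F0 by simp
  qed
  have dG: "(G has_field_derivative 0) (at 0)"
  proof -
    obtain d where d: "(G has_field_derivative d) (at 0)"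
      using Gh R by (metis centre_in_ball field_differentiable_def holomorphic_on_open open_ball)
    have "((\<lambda>z. F 0 * exp (G z)) has_field_derivative F 0 * (exp (G 0) * d)) (at 0)"
      using d by (auto intro!: derivative_eq_intros)
    then have "(F has_field_derivative F 0 * (exp (G 0) * d)) (at 0)"
    proof (rule has_field_derivative_transform_within_open[where S = "ball 0 R"])
      show "F 0 * exp (G z) = F z" if "z \<in> ball 0 R" for z using FG[of z, symmetric] that by simp
    qed (use R in auto)
    then have D: "(F has_field_derivative F 0 * d) (at 0)" by (simp add: G_def)
    have "((\<lambda>z. F (- z)) has_field_derivative F 0 * d * (- 1)) (at 0)"
      by (rule DERIV_chain2[where g = uminus]) (use D in \<open>auto intro!: derivative_eq_intros\<close>)
    then have "(F has_field_derivative - (F 0 * d)) (at 0)" by (simp add: Fe)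
    from DERIV_unique[OF D this] have "d = 0" using F0 by (simp add: eq_neg_iff_add_eq_0)
    with d show ?thesis by simp
  qed
  have lt: "norm (G z) < norm (2 * of_real A - G z)" if "norm z < R" for z
  proof -
    have "(norm (2 * of_real A - G z))\<^sup>2 - (norm (G z))\<^sup>2 = 4 * A * (A - Re (G z))"
      unfolding cmod_power2 by (simp add: power2_eq_square algebra_simps)
    moreover have "0 < 4 * A * (A - Re (G z))" using ReG[OF that] A(1) by simp
    ultimately have "(norm (G z))\<^sup>2 < (norm (2 * of_real A - G z))\<^sup>2" by linarith
    then show ?thesis by (rule power2_less_imp_less) simp
  qed
  then have ne: "2 * of_real A - G z \<noteq> 0" if "norm z < R" for z
    using that by (metis norm_not_less_zero norm_zero)
  \<comment> \<open>The Moebius map w -> w / (2 A - w) takes the half-plane Re w < A into the unit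
    disc and fixes 0. So the Schwarz lemma applies, and a second time to h(z) / z since h'(0) =
    0.\<close>
  define h where "h z = G (of_real R * z) / (2 * of_real A - G (of_real R * z))" for z
  have sc: "norm (of_real R * z) < R" if "norm z < 1" for z :: complex
    using that R by (simp add: norm_mult)
  have Gs: "(\<lambda>z. G (of_real R * z)) holomorphic_on ball 0 1"
  proof -
    have "(\<lambda>z. of_real R * z) holomorphic_on ball (0::complex) 1" by (intro holomorphic_intros)
    moreover have "(\<lambda>z. of_real R * z) ` ball (0::complex) 1 \<subseteq> ball 0 R" using sc by auto
    ultimately show ?thesis using holomorphic_on_compose_gen[OF _ Gh] by (simp add: o_def)
  qed
  have hh: "h holomorphic_on ball 0 1"
    unfolding h_def[abs_def] by (intro holomorphic_intros Gs) (use ne sc in auto)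
  have G00: "G 0 = 0" by (simp add: G_def)
  then have h0: "h 0 = 0" by (simp add: h_def)
  have h1: "norm (h z) < 1" if "norm z < 1" for z
  proof -
    have "0 < norm (2 * of_real A - G (of_real R * z))" using ne[OF sc[OF that]] by simp
    then show ?thesis using lt[OF sc[OF that]] by (simp add: h_def norm_divide pos_divide_less_eq)
  qed
  have dh: "deriv h 0 = 0"
  proof (rule DERIV_imp_deriv)
    have "((\<lambda>z. G (of_real R * z)) has_field_derivative 0 * of_real R) (at 0)"
      by (rule DERIV_chain2[of G]) (use dG in \<open>auto intro!: derivative_eq_intros\<close>)
    then show "(h has_field_derivative 0) (at 0)"
      unfolding h_def[abs_def] using A(1) G00 by (auto intro!: derivative_eq_intros)
  qed
  obtain k where k: "k holomorphic_on ball 0 1" "\<And>z. norm z < 1 \<Longrightarrow> h z = z * k z" "deriv h 0 = k 0"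
    using Schwarz3[OF hh h0] by blast
  have k1: "norm (k z) \<le> 1" if "norm z < 1" for z
  proof (cases "z = 0")
    case False
    have "norm z * norm (k z) \<le> norm z * 1"
      using Schwarz_Lemma(1)[OF hh h0 h1 that] k(2)[OF that] by (simp add: norm_mult)
    then show ?thesis using False by simp
  qed (use k(3) dh in simp)
  have k2: "norm (k z) \<le> 2 * norm z" if "norm z < 1" for z
  proof -
    \<comment> \<open>Only |k| <= 1 is known; halving gives the strict bound that the Schwarz lemma
      asks for.\<close>
    have "(\<lambda>z. k z / 2) holomorphic_on ball 0 1" by (intro holomorphic_intros k) auto
    moreover have "norm (k z / 2) < 1" if "norm z < 1" for z using k1[OF that] by (simp add: norm_divide)
    moreover have "k 0 / 2 = 0" using k(3) dh by simp
    ultimately have "norm (k z / 2) \<le> norm z" using that by (intro Schwarz_Lemma(1))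
    then show ?thesis by (simp add: norm_divide)
  qed
  define z where "z = u / of_real R"
  have nz': "norm z = norm u / R" using R by (simp add: z_def norm_divide)
  have z1: "norm z < 1"
  proof (rule ccontr)
    assume "\<not> norm z < 1"
    then have "1 \<le> (norm z)\<^sup>2" by (simp add: one_le_power)
    then show False using u nz' by simp
  qed
  define q where "q = 2 * (norm z)\<^sup>2"
  have q: "norm (h z) \<le> q" "q \<le> 1/2"
  proof -
    have "norm (h z) = norm z * norm (k z)" using k(2)[OF z1] by (simp add: norm_mult)
    also have "\<dots> \<le> norm z * (2 * norm z)" using k2[OF z1] by (intro mult_left_mono) auto
    finally show "norm (h z) \<le> q" by (simp add: q_def power2_eq_square)
    show "q \<le> 1/2" using u nz' by (simp add: q_def)
  qed
  have uz: "of_real R * z = u" using R by (simp add: z_def)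
  have un: "norm u < R" using z1 nz' R by (simp add: field_simps)
  have Gu: "G u * (1 + h z) = 2 * of_real A * h z"
  proof -
    have "h z = G u / (2 * of_real A - G u)" unfolding h_def uz ..
    with ne[OF un] show ?thesis by (simp add: field_simps)
  qed
  have "norm (1 + h z) \<ge> 1/2"
    using norm_triangle_ineq2[of 1 "- h z"] q by simp
  then have "norm (G u) * (1/2) \<le> norm (G u) * norm (1 + h z)" by (intro mult_left_mono) auto
  also have "\<dots> = 2 * A * norm (h z)" using arg_cong[OF Gu, of norm] A(1) by (simp add: norm_mult)
  also have "\<dots> \<le> 2 * A * q" using q A(1) by (intro mult_left_mono) auto
  finally have "norm (G u) \<le> 8 * A * (norm u / R)\<^sup>2" by (simp add: q_def nz')
  with FG[OF un] that show ?thesis by blast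
qed

section \<open>Applying all factors to the span of y^n and y^(n+1)\<close>

lemma all_factors:
  assumes nu: "0 < \<nu>" "\<nu> < 2" and n: "1 \<le> n" and ab: "(\<alpha>, \<beta>) \<noteq> (0, 0)"
    and ts: "\<And>t. t \<in> set ts \<Longrightarrow> Im t \<noteq> 0 \<Longrightarrow> tame_zero t"
      "\<And>t. t \<in> set ts \<Longrightarrow> Im t = 0 \<Longrightarrow> Re t \<le> 1 \<and> Re t \<le> 1/4 + e_const n \<nu>"
    and len: "n + 1 \<le> length ts"
  shows "strict_count n (jmul \<nu> (factors ts) (monom \<alpha> (n + 1) + monom \<beta> n)) 0"
proof -
  define f where "f = monom \<alpha> (n + 1) + monom \<beta> n"
  \<comment> \<open>Factors commute, so they can be sorted: an unpaired big one, the pairs of big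
    ones, the tame ones. The unpaired one need not reduce the zeros counted at 0; the other n or
    more reduce them to none.\<close>
  define big where "big t \<longleftrightarrow> Im t = 0 \<and> 1/4 < Re t" for t
  define hi where "hi = filter big ts"
  define lo where "lo = filter (\<lambda>t. \<not> big t) ts"
  have fac: "factors ts = (\<lambda>r. factors lo r * factors hi r)"
  proof
    show "factors ts r = factors lo r * factors hi r" for r
      unfolding hi_def lo_def by (induction ts) (auto simp: factors_def)
  qed
  have J: "jmul \<nu> (factors ts) f = jmul \<nu> (factors lo) (jmul \<nu> (factors hi) f)"
    by (simp add: fac jmul_jmul)
  have l: "length ts = length hi + length lo"
    unfolding hi_def lo_def by (simp add: sum_length_filter_compl)
  have lo: "\<forall>t\<in>set lo. tame_zero t"
    using ts(1) by (force simp: lo_def big_def tame_zero_def)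
  have hi: "\<forall>t\<in>set hi. Im t = 0 \<and> 1/4 < Re t \<and> Re t \<le> 1"
    using ts(2) by (auto simp: hi_def big_def)
  have start: "weak_count n f n" unfolding f_def by (rule weak_count_start[OF n ab])
  show ?thesis
  proof (cases "even (length hi)")
    case True
    show ?thesis
    proof (cases "hi = []")
      case True
      then have "strict_count n (jmul \<nu> (factors lo) f) (n - length lo)"
        using l len by (intro tame_factors[OF nu lo start]) auto
      then show ?thesis unfolding f_def[symmetric] J using True l len by (simp add: jmul_factors_Nil)
    next
      case False
      have h: "strict_count n (jmul \<nu> (factors hi) f) (n - length hi)"
        by (rule large_pairs[OF nu hi start True]) (use False in simp)
      have "strict_count n (jmul \<nu> (factors lo) (jmul \<nu> (factors hi) f)) (n - length hi - length lo)"
        by (rule tame_factors[OF nu lo weak_count_of_strict[OF h]]) (use h in simp)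
      then show ?thesis unfolding f_def[symmetric] J using l len by simp
    qed
  next
    case False
    then obtain h hs where hh: "hi = h # hs" by (cases hi) auto
    have th: "Im h = 0" "1/4 < Re h" "Re h \<le> 1" "Re h \<le> 1/4 + e_const n \<nu>"
    proof -
      have "h \<in> set hi" by (simp add: hh)
      then show "Im h = 0" "1/4 < Re h" "Re h \<le> 1" "Re h \<le> 1/4 + e_const n \<nu>"
        using ts(2)[of h] by (auto simp: hi_def big_def)
    qed
    define f1 where "f1 = jop \<nu> f - smult (Re h) f"
    have f1: "weak_count n f1 n"
    proof (cases "0 < \<alpha> \<or> (\<alpha> = 0 \<and> 0 < \<beta>)")
      case True
      show ?thesis unfolding f1_def f_def
        by (rule leftover_step_pos[OF nu n th(2-4) True])
    next
      case False
      then have "0 < - \<alpha> \<or> (- \<alpha> = 0 \<and> 0 < - \<beta>)" using ab by auto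
      from leftover_step_pos[OF nu n th(2-4) this]
      have "weak_count n (jop \<nu> (- f) - smult (Re h) (- f)) n"
        by (simp add: f_def minus_monom)
      moreover have "jop \<nu> (- f) - smult (Re h) (- f) = - f1"
        by (rule poly_eqI) (simp add: f1_def coeff_jop algebra_simps)
      ultimately show ?thesis by (metis weak_count_uminus)
    qed
    have f1j: "jmul \<nu> (factors hi) f = jmul \<nu> (factors hs) f1"
    proof -
      have "factors hi = (\<lambda>r. factors hs r * (eig r - Re h))"
        by (simp add: fun_eq_iff hh factors_def factor_def th(1))
      then show ?thesis unfolding f1_def smult_diff_jmul jmul_jmul by simp
    qed
    have hs: "\<forall>t\<in>set hs. Im t = 0 \<and> 1/4 < Re t \<and> Re t \<le> 1" "even (length hs)"
      using hi False by (auto simp: hh)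
    have l': "n \<le> length hs + length lo" using l len by (simp add: hh)
    show ?thesis
    proof (cases "hs = []")
      case True
      then have "strict_count n (jmul \<nu> (factors lo) f1) (n - length lo)"
        using l' n by (intro tame_factors[OF nu lo f1]) auto
      then show ?thesis unfolding f_def[symmetric] J using True l' by (simp add: jmul_factors_Nil f1j)
    next
      case False
      have h: "strict_count n (jmul \<nu> (factors hs) f1) (n - length hs)"
        by (rule large_pairs[OF nu hs(1) f1 hs(2)]) (use False in simp)
      have "strict_count n (jmul \<nu> (factors lo) (jmul \<nu> (factors hs) f1)) (n - length hs - length lo)"
        by (rule tame_factors[OF nu lo weak_count_of_strict[OF h]]) (use h in simp)
      then show ?thesis unfolding f_def[symmetric] J using l' by (simp add: f1j)
    qed
  qed
qed

lemma eventually_alternating: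
  assumes "alternating (\<lambda>x e. 0 < e * F x) e xs" "\<And>x. ((\<lambda>m. G m x) \<longlongrightarrow> F x) L"
  shows "eventually (\<lambda>m. alternating (\<lambda>x e. 0 < e * G m x) e xs) L"
  using assms(1)
proof (induction xs arbitrary: e)
  case (Cons x xs)
  have "((\<lambda>m. e * G m x) \<longlongrightarrow> e * F x) L" by (intro tendsto_intros assms(2))
  then have "eventually (\<lambda>m. 0 < e * G m x) L" using Cons.prems by (intro order_tendstoD(1)) auto
  moreover have "eventually (\<lambda>m. alternating (\<lambda>x e. 0 < e * G m x) (- e) xs) L"
    using Cons by simp
  ultimately show ?case by eventually_elim simp
qed simp

text \<open>A limit of alternating functions may fail to alternate. Therefore \<open>g\<close> is not approximated but
  written as the image of functions tending to \<open>f\<close>, which alternate eventually.\<close>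

lemma tail_factors:
  assumes nu: "0 < \<nu>" "\<nu> < 2" and f: "strict_count n f 0"
    and e: "\<And>r. (\<lambda>m. e m r) \<longlonglongrightarrow> 1"
    and ts: "\<And>m t. t \<in> set (ts m) \<Longrightarrow> tame_zero t"
    and g: "\<And>m. g = smult (c m) (jmul \<nu> (factors (ts m)) (jmul \<nu> (e m) f))" and c: "\<And>m. c m \<noteq> 0"
  shows "\<exists>xs e. alternates (poly g) e xs \<and> n + 1 \<le> length xs"
proof -
  obtain xs e0 where xs: "alternates (poly f) e0 xs" "xs \<noteq> []" "e0 = 1 \<or> e0 = -1" "n + 1 \<le> length xs" "1 \<le> degree f"
    using f unfolding strict_count_def by auto
  let ?h = "\<lambda>m. jmul \<nu> (e m) f"
  have "eventually (\<lambda>m. alternating (\<lambda>x e. 0 < e * poly (?h m) x) e0 xs) sequentially"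
    by (rule eventually_alternating[of "poly f"]) (use xs e in \<open>auto simp: alternates_def intro: jmul_tendsto\<close>)
  moreover have "eventually (\<lambda>m. 0 < e m (degree f)) sequentially"
    by (rule order_tendstoD(1)[OF e]) simp
  ultimately have "eventually (\<lambda>m. alternating (\<lambda>x e. 0 < e * poly (?h m) x) e0 xs \<and> 0 < e m (degree f)) sequentially"
    by (rule eventually_conj)
  then obtain m where m: "alternating (\<lambda>x e. 0 < e * poly (?h m) x) e0 xs" "0 < e m (degree f)"
    unfolding eventually_sequentially by blast
  have "f \<noteq> 0" using xs(5) by auto
  then have "coeff (?h m) (degree f) \<noteq> 0" using jmul_coeff[OF order_refl, of \<nu> "e m" f] m(2) by simp
  then have "1 \<le> degree (?h m)" using xs(5) le_degree order_trans by blast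
  moreover have "alternates (poly (?h m)) e0 xs" using m(1) xs(1) by (simp add: alternates_def)
  ultimately have s: "strict_count n (?h m) 0" unfolding strict_count_def
    using xs by (intro exI[of _ 0] exI[of _ xs] exI[of _ e0]) (auto simp: vanishing_def)
  have "strict_count n (jmul \<nu> (factors (ts m)) (?h m)) (0 - length (ts m))"
    using ts s by (intro tame_factors[OF nu _ weak_count_of_strict[OF s]]) auto
  then obtain ys e1 where ys: "alternates (poly (jmul \<nu> (factors (ts m)) (?h m))) e1 ys" "n + 1 \<le> length ys"
    unfolding strict_count_def by auto
  show ?thesis
  proof (cases "0 < c m")
    case True
    have "alternates (poly g) e1 ys"
      by (rule alternates_mult[OF ys(1), of _ "\<lambda>_. c m"]) (use True g[of m] in simp)
    then show ?thesis using ys(2) by blast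
  next
    case False
    have "alternates (\<lambda>x. - poly g x) e1 ys"
      by (rule alternates_mult[OF ys(1), of _ "\<lambda>_. - c m"]) (use False c[of m] g[of m] in simp)
    from alternates_uminus[OF this] show ?thesis using ys(2) by auto
  qed
qed

text \<open>The order is an infimum, so order at most one gives growth bounds with exponents above
  1. An exponent below 2 is what the factor R^(-2) in \<open>even_entire_log_bound\<close> can
  beat.\<close>

definition order_below_2 :: "(complex \<Rightarrow> complex) \<Rightarrow> bool" where
  "order_below_2 E \<longleftrightarrow> (\<exists>C B \<alpha>. 0 < C \<and> \<alpha> < 2 \<and> (\<forall>z. B \<le> norm z \<longrightarrow> norm (E z) \<le> C * exp (norm z powr \<alpha>)))"

lemma order_below_2_of_entire_order:
  assumes "entire_order E \<le> 1" shows "order_below_2 E"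
proof -
  have "entire_order E < 2" using assms by (rule le_less_trans) simp
  then obtain \<alpha> where \<alpha>: "ereal \<alpha> < 2" "(\<lambda>z. norm (E z)) \<in> O[at_infinity](\<lambda>z. exp (norm z powr \<alpha>))"
    unfolding entire_order_def by (auto simp: INF_less_iff)
  from landau_o.bigE[OF \<alpha>(2)] obtain C where
    C: "0 < C" "eventually (\<lambda>z. norm (norm (E z)) \<le> C * norm (exp (norm z powr \<alpha>))) at_infinity" by blast
  then obtain B where "\<forall>z. B \<le> norm z \<longrightarrow> norm (E z) \<le> C * exp (norm z powr \<alpha>)"
    unfolding eventually_at_infinity by auto
  moreover have "\<alpha> < 2" using \<alpha>(1) by simp
  ultimately show ?thesis unfolding order_below_2_def using C(1) by blast
qed

lemma cfactors_ge_1: "\<exists>B. \<forall>z. B \<le> norm z \<longrightarrow> 1 \<le> norm (cfactors ts z)"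
proof (induction ts)
  case (Cons t ts)
  then obtain B where B: "\<forall>z. B \<le> norm z \<longrightarrow> 1 \<le> norm (cfactors ts z)" by blast
  have "1 \<le> norm (cfactors (t # ts) z)" if z: "max B (1 + norm t) \<le> norm z" for z
  proof -
    have "1 + norm t \<le> norm z" "1 \<le> norm z" using z norm_ge_zero[of t] by linarith+
    then have "1 + norm t \<le> (norm z)\<^sup>2"
      using mult_mono[of 1 "norm z" "norm z" "norm z"] by (simp add: power2_eq_square)
    moreover have "(norm z)\<^sup>2 - norm s \<le> norm (z\<^sup>2 - s)" for s by (metis norm_triangle_ineq2 norm_power)
    from this[of t] this[of "cnj t"] have "(norm z)\<^sup>2 - norm t \<le> norm (z\<^sup>2 - t)" "(norm z)\<^sup>2 - norm t \<le> norm (z\<^sup>2 - cnj t)"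
      by auto
    ultimately have 1: "1 \<le> norm (z\<^sup>2 - t)" "1 \<le> norm (z\<^sup>2 - cnj t)" by linarith+
    then have "1 \<le> norm (cfactor t z)"
      using mult_mono[OF 1] by (auto simp: cfactor_def norm_mult)
    moreover have "1 \<le> norm (cfactors ts z)" using B z by simp
    ultimately show ?thesis using mult_mono[of 1 "norm (cfactor t z)" 1 "norm (cfactors ts z)"]
      by (simp add: norm_mult)
  qed
  then show ?case by blast
qed simp

lemma order_below_2_decomp:
  assumes "decomp E ts F" "order_below_2 E" shows "order_below_2 F"
proof -
  obtain C B \<alpha> where b: "0 < C" "\<alpha> < 2" "\<And>z. B \<le> norm z \<Longrightarrow> norm (E z) \<le> C * exp (norm z powr \<alpha>)"
    using assms(2) unfolding order_below_2_def by blast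
  obtain B' where B': "\<And>z. B' \<le> norm z \<Longrightarrow> 1 \<le> norm (cfactors ts z)" using cfactors_ge_1 by blast
  have "norm (F z) \<le> C * exp (norm z powr \<alpha>)" if "max B B' \<le> norm z" for z
  proof -
    have "norm (F z) \<le> norm (cfactors ts z) * norm (F z)"
      using mult_right_mono[OF B'[of z], of "norm (F z)"] that by simp
    also have "\<dots> = norm (E z)" using assms(1) by (simp add: decomp_def norm_mult)
    finally show ?thesis using b(3)[of z] that by simp
  qed
  then show ?thesis unfolding order_below_2_def using b(1,2) by blast
qed

text \<open>This replaces the Hadamard factorization: no convergence of \<open>\<Sum> 1 / |\<rho>|\<^sup>2\<close> is needed.\<close>

lemma remainder_tendsto:
  assumes ord: "order_below_2 E" and E0: "E 0 \<noteq> 0"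
    and dec: "\<And>m. decomp E (ts m) (F m)"
    and nz: "\<And>m u. norm u < real m + 1 \<Longrightarrow> F m u \<noteq> 0"
    and ts: "\<And>m t. t \<in> set (ts m) \<Longrightarrow> norm t \<le> (real m + 1)\<^sup>2"
  shows "(\<lambda>m. F m u / F m 0) \<longlonglongrightarrow> 1"
proof -
  obtain C B \<alpha> where b: "0 < C" "\<alpha> < 2" "\<And>z. B \<le> norm z \<Longrightarrow> norm (E z) \<le> C * exp (norm z powr \<alpha>)"
    using ord unfolding order_below_2_def by blast
  \<comment> \<open>The summand 1 makes \<open>L\<close> positive and the bound on
    \<open>F m\<close> strict.\<close>
  define L where "L = ln (C / norm (E 0) + 1)"
  have C1: "1 < C / norm (E 0) + 1" using b(1) E0 by simp
  have L0: "0 < L" using C1 by (simp add: L_def)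
  have eL: "exp L = C / norm (E 0) + 1" using C1 by (simp add: L_def)
  define R where "R m = real m + 1" for m
  define A where "A m = (2 * R m) powr \<alpha> + L" for m
  have R: "0 < R m" for m by (simp add: R_def)
  have A0: "0 < A m" for m using L0 by (simp add: A_def add_nonneg_pos)
  have bound: "norm (F m z) < norm (F m 0) * exp (A m)" if B: "B \<le> 2 * R m" and z: "norm z < R m" for m z
  proof -
    have F0: "F m 0 \<noteq> 0" "cfactors (ts m) 0 \<noteq> 0" using dec[of m] E0 by (auto simp: decomp_def)
    define K where "K = norm (F m 0) * (C / norm (E 0)) * exp ((2 * R m) powr \<alpha>)"
    have "norm (F m z) \<le> K"
    proof (rule cball_max_modulus[where R = "2 * R m" and f = "F m"])
      show "norm (F m v) \<le> K" if v: "norm v = 2 * R m" for v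
      proof -
        have "norm (cfactors (ts m) 0) \<le> norm (cfactors (ts m) v)"
        proof -
          have "\<forall>t\<in>set xs. norm t \<le> (R m)\<^sup>2 \<Longrightarrow> norm (cfactors xs 0) \<le> norm (cfactors xs v)" for xs
          proof (induction xs)
            case (Cons t xs)
            have "norm (cfactor t 0) \<le> norm (cfactor t v)"
              by (rule cfactor_lower[where R = "R m" and c = 1]) (use Cons.prems v in \<open>auto simp: power_mult_distrib\<close>)
            then show ?case using Cons by (auto simp: norm_mult intro!: mult_mono)
          qed simp
          then show ?thesis using ts[of _ m] by (auto simp: R_def)
        qed
        then have "norm (cfactors (ts m) 0) * norm (F m v) \<le> norm (cfactors (ts m) v) * norm (F m v)"
          by (intro mult_right_mono) auto
        also have "\<dots> = norm (E v)" using dec[of m] by (simp add: decomp_def norm_mult)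
        also have "\<dots> \<le> C * exp ((2 * R m) powr \<alpha>)" using b(3)[of v] B v by simp
        finally have "norm (F m v) \<le> C * exp ((2 * R m) powr \<alpha>) / norm (cfactors (ts m) 0)"
          using F0 by (simp add: pos_le_divide_eq mult.commute)
        also have "\<dots> = K"
        proof -
          have "norm (E 0) = norm (cfactors (ts m) 0) * norm (F m 0)" using dec[of m] by (simp add: decomp_def norm_mult)
          then show ?thesis using F0 by (simp add: K_def field_simps)
        qed
        finally show ?thesis .
      qed
    qed (use dec[of m] R[of m] z in \<open>auto simp: decomp_def even_entire_def\<close>)
    also have "norm (F m 0) * exp (A m) = K + norm (F m 0) * exp ((2 * R m) powr \<alpha>)"
      by (simp add: K_def A_def exp_add eL algebra_simps)
    then have "K < norm (F m 0) * exp (A m)" using F0 by simp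
    finally show ?thesis .
  qed
  have R_top: "filterlim R at_top sequentially"
    by (rule filterlim_at_top_mono[OF filterlim_real_sequentially]) (simp add: R_def)
  have A_lim: "(\<lambda>m. 8 * A m * (norm u / R m)\<^sup>2) \<longlonglongrightarrow> 0"
  proof -
    have "(\<lambda>m. 8 * (norm u)\<^sup>2 * (2 powr \<alpha> * R m powr (\<alpha> - 2) + L * R m powr (- 2))) \<longlonglongrightarrow>
        8 * (norm u)\<^sup>2 * (2 powr \<alpha> * 0 + L * 0)"
      using b(2) by (intro tendsto_intros tendsto_neg_powr[OF _ R_top]) auto
    moreover have "8 * (norm u)\<^sup>2 * (2 powr \<alpha> * R m powr (\<alpha> - 2) + L * R m powr (- 2)) = 8 * A m * (norm u / R m)\<^sup>2" for m
      using R[of m] by (simp add: A_def powr_mult powr_diff powr_minus power_divide field_simps)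
    ultimately show ?thesis by simp
  qed
  have "eventually (\<lambda>m. max B (2 * norm u) + 1 < R m) sequentially"
    using R_top unfolding filterlim_at_top_dense by blast
  then have "eventually (\<lambda>m. \<exists>G. F m u = F m 0 * exp G \<and> norm G \<le> 8 * A m * (norm u / R m)\<^sup>2) sequentially"
  proof eventually_elim
    case (elim m)
    have r: "B \<le> 2 * R m" "2 * norm u \<le> R m" using elim R[of m] by auto
    have "4 * (norm u / R m)\<^sup>2 \<le> 1"
    proof -
      have "(2 * norm u)\<^sup>2 \<le> (R m)\<^sup>2" using r(2) by (intro power_mono) auto
      then show ?thesis using R[of m] by (simp add: power_divide power_mult_distrib field_simps)
    qed
    then show ?case
      using even_entire_log_bound[of "F m" "R m" "A m" u] dec[of m] R[of m] A0[of m] nz[of _ m] bound[OF r(1)]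
      unfolding decomp_def R_def by metis
  qed
  then obtain m0 where m0: "\<And>m. m0 \<le> m \<Longrightarrow> \<exists>G. F m u = F m 0 * exp G \<and> norm G \<le> 8 * A m * (norm u / R m)\<^sup>2"
    unfolding eventually_sequentially by blast
  then obtain G where G: "\<And>m. m0 \<le> m \<Longrightarrow> F m u = F m 0 * exp (G m) \<and> norm (G m) \<le> 8 * A m * (norm u / R m)\<^sup>2"
    by metis
  have "G \<longlonglongrightarrow> 0"
  proof (rule tendsto_0_le[where K = 1, OF A_lim])
    have "norm (G m) \<le> norm (8 * A m * (norm u / R m)\<^sup>2) * 1" if "m0 \<le> m" for m
      using G[OF that] abs_ge_self[of "8 * A m * (norm u / R m)\<^sup>2"] by simp
    then show "eventually (\<lambda>m. norm (G m) \<le> norm (8 * A m * (norm u / R m)\<^sup>2) * 1) sequentially"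
      unfolding eventually_sequentially by blast
  qed
  then have "(\<lambda>m. exp (G m)) \<longlonglongrightarrow> exp 0" by (intro tendsto_intros)
  then have "(\<lambda>m. exp (G m)) \<longlonglongrightarrow> 1" by simp
  moreover have "eventually (\<lambda>m. exp (G m) = F m u / F m 0) sequentially"
    unfolding eventually_sequentially using G nz[of 0] by (intro exI[of _ m0]) simp
  ultimately show ?thesis by (rule Lim_transform_eventually)
qed

section \<open>Interlacing\<close>

lemma decomp_root:
  assumes "decomp E ts F" "t \<in> set ts"
  shows "E (csqrt t) = 0"
proof -
  have "cfactors ts (csqrt t) = 0"
    using assms(2) by (induction ts) (auto simp: cfactor_def)
  then show ?thesis using assms(1) by (simp add: decomp_def)
qed

lemma cfactors_poly: "\<exists>p. cfactors ts = poly p"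
proof (induction ts)
  case (Cons t ts)
  then obtain p where p: "cfactors ts = poly p" by blast
  have "cfactor t = poly (if Im t = 0 then [:- t, 0, 1:] else [:- t, 0, 1:] * [:- cnj t, 0, 1:])"
    by (auto simp: fun_eq_iff cfactor_def power2_eq_square algebra_simps)
  then obtain q where "cfactor t = poly q" by blast
  then have "cfactors (t # ts) = poly (q * p)" using p by (simp add: fun_eq_iff)
  then show ?case by blast
qed (auto simp: fun_eq_iff intro: exI[of _ 1])

text \<open>A real square above 1/4 comes from a real \<rho>, and in the strip such a \<rho> has
  modulus at most 1. Therefore all zeros of modulus at least 2 are tame.\<close>

lemma strip_square:
  assumes "\<rho> \<in> strip h" "0 \<le> h" "h \<le> 1"
  shows "Re (\<rho>\<^sup>2) \<le> h\<^sup>2" "Im (\<rho>\<^sup>2) \<noteq> 0 \<Longrightarrow> tame_zero (\<rho>\<^sup>2)"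
    "2 \<le> norm \<rho> \<Longrightarrow> tame_zero (\<rho>\<^sup>2)"
proof -
  define x y where "x = Re \<rho>" and "y = Im \<rho>"
  have re: "Re (\<rho>\<^sup>2) = x\<^sup>2 - y\<^sup>2" and im: "Im (\<rho>\<^sup>2) = 2 * x * y"
    by (simp_all add: x_def y_def power2_eq_square)
  have x: "x\<^sup>2 \<le> h\<^sup>2" using assms by (intro power2_le_iff_abs_le[THEN iffD2]) (auto simp: strip_def x_def)
  then show "Re (\<rho>\<^sup>2) \<le> h\<^sup>2" using re zero_le_power2[of y] by linarith
  have x1: "x\<^sup>2 \<le> 1" using x power_mono[OF assms(3,2), of 2] by simp
  show t: "tame_zero (\<rho>\<^sup>2)" if "Im (\<rho>\<^sup>2) \<noteq> 0"
  proof -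
    have "0 \<le> 4 * ((1 - x\<^sup>2) * (1 + y\<^sup>2))" using x1 by (intro mult_nonneg_nonneg) auto
    then have "(2 * x * y)\<^sup>2 \<le> 4 * (1 - (x\<^sup>2 - y\<^sup>2))" by (simp add: power_mult_distrib algebra_simps)
    moreover have "x\<^sup>2 - y\<^sup>2 \<le> 1" using x1 zero_le_power2[of y] by linarith
    ultimately show ?thesis using that unfolding tame_zero_def re im by simp
  qed
  show "tame_zero (\<rho>\<^sup>2)" if "2 \<le> norm \<rho>"
  proof (cases "Im (\<rho>\<^sup>2) = 0")
    case True
    have "4 \<le> (norm \<rho>)\<^sup>2" using power_mono[OF that, of 2] by simp
    then have "4 \<le> x\<^sup>2 + y\<^sup>2" by (simp add: cmod_power2 x_def y_def)
    moreover from True im have "x = 0 \<or> y = 0" by simp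
    ultimately have "x = 0" using x1 by auto
    then have "x\<^sup>2 = 0" by simp
    then have "Re (\<rho>\<^sup>2) \<le> 1/4" using re zero_le_power2[of y] by linarith
    then show ?thesis using True by (simp add: tame_zero_def)
  qed (rule t)
qed

text \<open>If the lists were bounded, a longest one would leave a cofactor without zeros. For it,
  \<open>remainder_tendsto\<close> applies with empty lists and shows that it is constant, so
  \<open>E\<close> would be a polynomial.\<close>

lemma long_decomp:
  assumes E: "even_entire E" "\<forall>u. E (cnj u) = cnj (E u)" and np: "\<not> polynomial_fun E"
    and ord: "order_below_2 E"
  shows "\<exists>ts F. decomp E ts F \<and> N \<le> length ts"
proof (rule ccontr)
  assume no: "\<not> ?thesis"
  define P where "P ts \<longleftrightarrow> (\<exists>F. decomp E ts F)" for ts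
  have "P []" using decomp_self[OF E] by (auto simp: P_def)
  moreover have "\<forall>ts. P ts \<longrightarrow> length ts < N" using no by (auto simp: P_def not_le)
  ultimately obtain ts where ts: "P ts" "\<And>ss. P ss \<Longrightarrow> length ss \<le> length ts"
    using ex_has_greatest_nat[of P "[]" length N] by (metis less_imp_le)
  then obtain F where F: "decomp E ts F" by (auto simp: P_def)
  have nz: "F u \<noteq> 0" for u
  proof
    assume "F u = 0"
    then obtain G where "decomp E (ts @ [u\<^sup>2]) G" using decomp_step[OF F] by blast
    then have "P (ts @ [u\<^sup>2])" by (auto simp: P_def)
    from ts(2)[OF this] show False by simp
  qed
  have self: "decomp F [] F" using F unfolding decomp_def[of E] by (blast intro: decomp_self)
  have "F u = F 0" for u
  proof -
    have "(\<lambda>m::nat. F u / F 0) \<longlonglongrightarrow> 1"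
      by (rule remainder_tendsto[OF order_below_2_decomp[OF F ord] nz self]) (use nz in auto)
    then have "F u / F 0 = 1" by (simp add: LIMSEQ_const_iff)
    then show ?thesis using nz[of 0] by simp
  qed
  moreover obtain p where "cfactors ts = poly p" using cfactors_poly by blast
  ultimately have "E = poly (smult (F 0) p)" using F by (simp add: decomp_def fun_eq_iff)
  then show False using np by (auto simp: polynomial_fun_def)
qed

theorem multiplier_sign_changes:
  fixes \<nu> :: real and n :: nat and E :: "complex \<Rightarrow> complex"
  assumes nu: "0 < \<nu>" "\<nu> < 2" and n: "1 \<le> n" and re: "real_entire E" and ev: "\<And>u. E (- u) = E u"
    and np: "\<not> polynomial_fun E" and ord: "entire_order E \<le> 1"
    and zs: "zero_set E \<subseteq> strip (h_const n \<nu>)" and ab: "(\<alpha>, \<beta>) \<noteq> (0, 0)"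
  shows "\<exists>xs e. alternates (poly (jacobi_multiplier E \<nu> (monom \<alpha> (n + 1) + monom \<beta> n))) e xs \<and> n + 1 \<le> length xs"
proof -
  have E: "even_entire E" "\<forall>u. E (cnj u) = cnj (E u)"
    using re ev by (auto simp: real_entire_def even_entire_def)
  have ord2: "order_below_2 E" by (rule order_below_2_of_entire_order[OF ord])
  have e0: "0 \<le> e_const n \<nu>" using nu by (simp add: e_const_def)
  define h where "h = h_const n \<nu>"
  have h: "0 \<le> h" "h \<le> 1" "h\<^sup>2 \<le> 1/4 + e_const n \<nu>" "h\<^sup>2 \<le> 1"
  proof -
    show h: "0 \<le> h" "h \<le> 1" using e0 by (auto simp: h_def h_const_def)
    have "h\<^sup>2 \<le> (sqrt (1/4 + e_const n \<nu>))\<^sup>2" using h by (intro power_mono) (simp_all add: h_def h_const_def)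
    then show "h\<^sup>2 \<le> 1/4 + e_const n \<nu>" using e0 by simp
    show "h\<^sup>2 \<le> 1" using h by (simp add: power_le_one)
  qed
  have st: "\<rho> \<in> strip h" if "E \<rho> = 0" for \<rho> using zs that by (auto simp: zero_set_def h_def)

  obtain ts0 F0 where d0: "decomp E ts0 F0" "n + 1 \<le> length ts0"
    using long_decomp[OF E np ord2] by blast
  have "\<exists>z. F0 z \<noteq> 0"
  proof (rule ccontr)
    assume "\<not> ?thesis"
    then have "E = poly 0" using d0(1) by (simp add: decomp_def fun_eq_iff)
    then show False using np by (auto simp: polynomial_fun_def)
  qed
  then obtain z0 where z0: "F0 z0 \<noteq> 0" by blast
  \<comment> \<open>The disc contains \<open>z0\<close>, because \<open>F0\<close> may vanish at 0.
    As R >= 2, the zeros left in \<open>F1\<close> are all tame, so the factors that need pairing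
    are among finitely many.\<close>
  define R where "R = max 2 (norm z0 + 1)"
  have F0: "even_entire F0" "\<forall>u. F0 (cnj u) = cnj (F0 u)" using d0(1) unfolding decomp_def by blast+
  obtain ts1 F1 where d1: "decomp F0 ts1 F1" "\<And>u. norm u < R \<Longrightarrow> F1 u \<noteq> 0"
  proof -
    have "norm z0 < R" by (simp add: R_def)
    then show ?thesis by (rule decomp_ball[OF F0 z0]) (rule that)
  qed
  define ts where "ts = ts0 @ ts1"
  have d: "decomp E ts F1" unfolding ts_def by (rule decomp_trans[OF d0(1) d1(1)])
  have F1: "even_entire F1" "\<forall>u. F1 (cnj u) = cnj (F1 u)" "F1 0 \<noteq> 0" "order_below_2 F1"
  proof -
    show "even_entire F1" "\<forall>u. F1 (cnj u) = cnj (F1 u)" using d unfolding decomp_def by blast+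
    show "F1 0 \<noteq> 0" using d1(2)[of 0] by (simp add: R_def)
    show "order_below_2 F1" by (rule order_below_2_decomp[OF d ord2])
  qed

  define f where "f = monom \<alpha> (n + 1) + monom \<beta> n"
  define f1 where "f1 = jmul \<nu> (factors ts) f"
  have f1: "strict_count n f1 0"
    unfolding f1_def f_def
  proof (rule all_factors[OF nu n ab])
    fix t assume "t \<in> set ts"
    then have "csqrt t \<in> strip h" by (intro st decomp_root[OF d])
    note s = strip_square[OF this h(1,2), simplified]
    show "Im t \<noteq> 0 \<Longrightarrow> tame_zero t" using s(2) by simp
    show "Re t \<le> 1 \<and> Re t \<le> 1/4 + e_const n \<nu>" using s(1) h(3,4) by linarith
  qed (use d0(2) in \<open>simp add: ts_def\<close>)

  have "\<exists>ss F. decomp F1 ss F \<and> (\<forall>u. norm u < real m + 1 \<longrightarrow> F u \<noteq> 0) \<and>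
      (\<forall>t\<in>set ss. norm t \<le> (real m + 1)\<^sup>2 \<and> tame_zero t)" for m
  proof -
    obtain ss F where s: "decomp F1 ss F" "\<And>u. norm u < real m + 1 \<Longrightarrow> F u \<noteq> 0"
      "\<And>t. t \<in> set ss \<Longrightarrow> \<exists>\<rho>. t = \<rho>\<^sup>2 \<and> F1 \<rho> = 0 \<and> norm \<rho> < real m + 1"
      using decomp_ball[OF F1(1,2,3), of "real m + 1"] by auto
    have "norm t \<le> (real m + 1)\<^sup>2 \<and> tame_zero t" if t: "t \<in> set ss" for t
    proof -
      obtain \<rho> where \<rho>: "t = \<rho>\<^sup>2" "F1 \<rho> = 0" "norm \<rho> < real m + 1" using s(3)[OF t] by blast
      have "\<not> norm \<rho> < R" using d1(2)[of \<rho>] \<rho>(2) by blast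
      then have "2 \<le> norm \<rho>" by (simp add: R_def)
      then have "tame_zero t" unfolding \<rho>(1) using \<rho>(2) decomp_zero[OF d]
        by (intro strip_square(3)[OF st h(1,2)]) auto
      moreover have "norm t \<le> (real m + 1)\<^sup>2" unfolding \<rho>(1) norm_power using \<rho>(3) by (intro power_mono) auto
      ultimately show ?thesis by simp
    qed
    with s show ?thesis by blast
  qed
  then obtain ss F where s: "\<And>m. decomp F1 (ss m) (F m)" "\<And>m u. norm u < real m + 1 \<Longrightarrow> F m u \<noteq> 0"
    "\<And>m t. t \<in> set (ss m) \<Longrightarrow> norm t \<le> (real m + 1)\<^sup>2" "\<And>m t. t \<in> set (ss m) \<Longrightarrow> tame_zero t"
    by metis
  have lim: "(\<lambda>m. F m u / F m 0) \<longlonglongrightarrow> 1" for u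
    by (rule remainder_tendsto[of F1 ss F, OF F1(4,3) s(1)]) (use s(2,3) in blast)+
  define c where "c m = Re (F m 0)" for m
  have Fc: "F m 0 = of_real (c m)" for m
  proof -
    have "cnj (F m 0) = F m 0" using s(1)[of m] by (metis complex_cnj_zero decomp_def)
    then show ?thesis by (auto simp: c_def complex_eq_iff)
  qed
  have c0: "c m \<noteq> 0" for m using s(2)[of 0 m] Fc[of m] by auto
  define e where "e m r = Re (F m (of_nat r + 1 / 2) / F m 0)" for m r
  have e: "(\<lambda>m. e m r) \<longlonglongrightarrow> 1" for r
    using tendsto_Re[OF lim[of "of_nat r + 1 / 2"]] by (simp add: e_def)
  have val: "Re (E (of_nat r + 1 / 2)) = c m * (factors (ss m) r * (e m r * factors ts r))" for r m
  proof -
    let ?u = "of_nat r + 1 / 2 :: complex"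
    have "E ?u = of_real (factors ts r * factors (ss m) r) * F m ?u"
      using d s(1)[of m] by (simp add: decomp_def cfactors_half)
    then have "Re (E ?u) = factors ts r * factors (ss m) r * Re (F m ?u)" by simp
    moreover have "Re (F m ?u) = c m * e m r" using c0[of m] by (simp add: e_def Fc)
    ultimately show ?thesis by simp
  qed
  have "jmul \<nu> (\<lambda>r. Re (E (of_nat r + 1 / 2))) f = smult (c m) (jmul \<nu> (factors (ss m)) (jmul \<nu> (e m) f1))" for m
    unfolding f1_def jmul_jmul jmul_const[of "c m" _ \<nu>] val[of _ m] ..
  from tail_factors[OF nu f1 e s(4) this c0] show ?thesis
    by (simp add: jacobi_multiplier_eq_jmul f_def)
qed

text \<open>Division by (y - \<eta>)^2 preserves the alternation, as \<eta> is none of its points,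
  but leaves degree at most n - 1. The n + 1 points force n roots.\<close>

lemma double_root_alternation:
  fixes g :: "real poly"
  assumes a: "alternates (poly g) e xs" and len: "n + 1 \<le> length xs" and deg: "degree g \<le> n + 1"
    and \<eta>: "0 < \<eta>" "\<eta> < 4" "poly g \<eta> = 0" "poly (pderiv g) \<eta> = 0"
  shows False
proof -
  have "g \<noteq> 0" using a len by (cases xs) (auto simp: alternates_def)
  obtain k where k: "g = [:- \<eta>, 1:] * k" using \<eta>(3) by (auto simp: poly_eq_0_iff_dvd)
  have "poly ([:- \<eta>, 1:] * pderiv k + k * pderiv [:- \<eta>, 1:]) \<eta> = 0"
    using \<eta>(4) unfolding k pderiv_mult .
  then have "poly k \<eta> = 0" by (simp add: pderiv_pCons)
  then obtain l where l: "k = [:- \<eta>, 1:] * l" by (auto simp: poly_eq_0_iff_dvd)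
  have g: "g = [:- \<eta>, 1:] ^ 2 * l" by (simp only: k l power2_eq_square mult.assoc)
  have "l \<noteq> 0" using \<open>g \<noteq> 0\<close> g by auto
  have "degree g = degree ([:- \<eta>, 1:] ^ 2) + degree l"
    unfolding g by (rule degree_mult_eq) (use \<open>l \<noteq> 0\<close> in auto)
  then have dl: "degree l + 2 \<le> n + 1" using deg by (simp add: degree_linear_power)
  have pg: "poly g x = (x - \<eta>)\<^sup>2 * poly l x" for x unfolding g by (simp add: poly_power)
  have al: "alternates (poly l) e xs"
  proof -
    have b: "alternating (\<lambda>x e. 0 < e * poly g x) e xs" using a by (simp add: alternates_def)
    have "alternating (\<lambda>x e. 0 < e * poly l x) e xs"
    proof (rule alternating_mono[OF b])
      fix x e assume "0 < e * poly g x"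
      then have "0 < (x - \<eta>)\<^sup>2 * (e * poly l x)" by (simp add: pg mult.left_commute)
      moreover from this have "x \<noteq> \<eta>" by auto
      then have "0 < (x - \<eta>)\<^sup>2" by simp
      ultimately show "0 < e * poly l x" by (rule zero_less_mult_pos)
    qed
    then show ?thesis using a by (simp add: alternates_def)
  qed
  have roots: "\<exists>ys. Suc (length ys) = length xs \<and> sorted_wrt (<) ys \<and> (\<forall>y\<in>set ys. hd xs < y \<and> poly l y = 0)"
    if "alternates (poly l) e xs" "xs \<noteq> []" for e xs
    using that
  proof (induction xs arbitrary: e rule: induct_list012)
    case (3 x x' xs)
    have "alternates (poly l) (- e) (x' # xs)" using 3(3) by (simp add: alternates_def)
    then obtain ys where ys: "Suc (length ys) = length (x' # xs)" "sorted_wrt (<) ys" "\<forall>y\<in>set ys. x' < y \<and> poly l y = 0"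
      using "3.IH"(2) by fastforce
    have xx: "x < x'" "0 < e * poly l x" "0 < - e * poly l x'" using 3(3) by (auto simp: alternates_def)
    then have "poly l x * poly l x' < 0"
      by (auto simp: zero_less_mult_iff mult_less_0_iff)
    then obtain y where "x < y" "y < x'" "poly l y = 0"
      using poly_IVT[of x x' l] xx by blast
    then show ?case using ys by (intro exI[of _ "y # ys"]) force
  qed auto
  have "xs \<noteq> []" using len by auto
  obtain ys where ys: "Suc (length ys) = length xs" "sorted_wrt (<) ys" "\<forall>y\<in>set ys. poly l y = 0"
    using roots[OF al \<open>xs \<noteq> []\<close>] by blast
  have "distinct ys" using ys(2) by (simp add: strict_sorted_iff)
  then have "length ys = card (set ys)" by (simp add: distinct_card)
  also have "\<dots> \<le> card {y. poly l y = 0}"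
    using ys(3) by (intro card_mono poly_roots_finite \<open>l \<noteq> 0\<close>) auto
  also have "\<dots> \<le> degree l" by (rule card_poly_roots_bound[OF \<open>l \<noteq> 0\<close>])
  finally show False using ys(1) len dl by simp
qed

text \<open>Rolle's theorem for \<open>p / q\<close>.\<close>

lemma zero_between:
  fixes p q :: "real poly"
  assumes "a < b" "poly p a = 0" "poly p b = 0"
    and W: "\<And>y. a \<le> y \<Longrightarrow> y \<le> b \<Longrightarrow> poly (pderiv q) y * poly p y - poly q y * poly (pderiv p) y \<noteq> 0"
  shows "\<exists>y. a < y \<and> y < b \<and> poly q y = 0"
proof (rule ccontr)
  assume no: "\<not> ?thesis"
  have nz: "poly q y \<noteq> 0" if "a \<le> y" "y \<le> b" for y
  proof (cases "y = a \<or> y = b")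
    case True
    then show ?thesis using W[of y] assms(2,3) that by auto
  next
    case False
    then show ?thesis using no that by force
  qed
  define R where "R y = poly p y / poly q y" for y
  define R' where "R' y = (poly (pderiv p) y * poly q y - poly p y * poly (pderiv q) y) / (poly q y * poly q y)" for y
  have D: "(R has_real_derivative R' y) (at y)" if "a \<le> y" "y \<le> b" for y
    unfolding R_def[abs_def] R'_def using nz[OF that] by (intro DERIV_divide poly_DERIV)
  have "\<exists>z>a. z < b \<and> R b - R a = (b - a) * R' z"
    by (rule MVT2[OF assms(1)]) (use D in auto)
  then obtain z where z: "a < z" "z < b" "R b - R a = (b - a) * R' z" by blast
  then have "R' z = 0" using assms(1-3) by (simp add: R_def)
  then show False using W[of z] nz[of z] z by (simp add: R'_def algebra_simps)
qed

lemma interlace_of_wronskian: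
  fixes p q :: "real poly"
  assumes pq: "p \<noteq> 0" "q \<noteq> 0" and sub: "{y. poly p y = 0} \<subseteq> {0<..<4}" "{y. poly q y = 0} \<subseteq> {0<..<4}"
    and W: "\<And>y. 0 < y \<Longrightarrow> y < 4 \<Longrightarrow> poly (pderiv q) y * poly p y - poly q y * poly (pderiv p) y \<noteq> 0"
  shows "strictly_interlace {y. poly p y = 0} {y. poly q y = 0}"
proof -
  let ?A = "{y. poly p y = 0}" and ?B = "{y. poly q y = 0}"
  have fin: "finite ?A" "finite ?B" using pq by (simp_all add: poly_roots_finite)
  have disj: "?A \<inter> ?B = {}"
  proof (rule ccontr)
    assume "?A \<inter> ?B \<noteq> {}"
    then obtain y where "poly p y = 0" "poly q y = 0" by auto
    moreover have "0 < y" "y < 4" using \<open>poly p y = 0\<close> sub(1) by auto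
    ultimately show False using W[of y] by simp
  qed
  have betw: "\<exists>y. a < y \<and> y < b \<and> y \<in> ?B" if "a \<in> ?A" "b \<in> ?A" "a < b" for a b
  proof -
    have "0 < a" "b < 4" using that sub(1) by auto
    then show ?thesis using zero_between[of a b p q] W that by auto
  qed
  have betw': "\<exists>y. a < y \<and> y < b \<and> y \<in> ?A" if "a \<in> ?B" "b \<in> ?B" "a < b" for a b
  proof -
    have "0 < a" "b < 4" using that sub(2) by auto
    then have "poly (pderiv p) y * poly q y - poly p y * poly (pderiv q) y \<noteq> 0" if "a \<le> y" "y \<le> b" for y
      using W[of y] that by (auto simp: mult.commute)
    then show ?thesis using zero_between[of a b q p] that by auto
  qed
  define xs where "xs = sorted_list_of_set (?A \<union> ?B)"
  have set_xs: "set xs = ?A \<union> ?B" and sorted: "sorted_wrt (<) xs"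
    using fin by (simp_all add: xs_def)
  have "xs ! i \<in> ?A \<longleftrightarrow> xs ! Suc i \<in> ?B" if i: "Suc i < length xs" for i
  proof -
    have lt: "xs ! i < xs ! Suc i" using sorted_wrt_nth_less[OF sorted _ i, of i] by simp
    have none: False if y: "xs ! i < y" "y < xs ! Suc i" "y \<in> ?A \<union> ?B" for y
    proof -
      obtain j where j: "j < length xs" "xs ! j = y" using y(3) set_xs by (metis in_set_conv_nth)
      have "i < j"
      proof (rule ccontr)
        assume "\<not> i < j"
        then have "j = i \<or> j < i" by auto
        then show False using sorted_wrt_nth_less[OF sorted, of j i] i j y(1) by auto
      qed
      moreover have "j < Suc i"
      proof (rule ccontr)
        assume "\<not> j < Suc i"
        then have "j = Suc i \<or> Suc i < j" by auto
        then show False using sorted_wrt_nth_less[OF sorted, of "Suc i" j] i j y(2) by auto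
      qed
      ultimately show False by simp
    qed
    have mem: "xs ! i \<in> ?A \<union> ?B" "xs ! Suc i \<in> ?A \<union> ?B" using i set_xs by (metis Suc_lessD nth_mem)+
    show ?thesis
    proof
      assume "xs ! i \<in> ?A"
      then show "xs ! Suc i \<in> ?B" using betw[OF _ _ lt] none mem(2) by blast
    next
      assume "xs ! Suc i \<in> ?B"
      then show "xs ! i \<in> ?A" using betw'[OF _ _ lt] none mem(1) by blast
    qed
  qed
  then show ?thesis using fin disj by (simp add: strictly_interlace_def xs_def)
qed

lemma poly_of_real_map: "poly (map_poly complex_of_real p) (complex_of_real y) = complex_of_real (poly p y)"
  by (induction p) (simp_all add: map_poly_pCons)

lemma zeros_simple_in_real:
  assumes "zeros_simple_in p A" shows "{y. poly p y = 0} \<subseteq> A"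
proof
  fix y assume "y \<in> {y. poly p y = 0}"
  then have "poly (map_poly complex_of_real p) (complex_of_real y) = 0"
    by (simp add: poly_of_real_map)
  then show "y \<in> A" using assms unfolding zeros_simple_in_def by auto
qed

theorem theorem1p3:
  fixes \<nu> :: real and n :: nat and E :: "complex \<Rightarrow> complex"
  assumes "0 < \<nu>" and "\<nu> < 2" and "n \<ge> 1"
    and "real_entire E"
    and "\<And>u. E (- u) = E u"
    and "\<not> polynomial_fun E"
    and "entire_order E \<le> 1"
    and "zero_set E \<subseteq> strip (h_const n \<nu>)"
    and "zeros_simple_in (jacobi_multiplier E \<nu> (monom 1 n)) {0<..<4}"
    and "zeros_simple_in (jacobi_multiplier E \<nu> (monom 1 (n + 1))) {0<..<4}"
  shows "strictly_interlace
    {y. poly (jacobi_multiplier E \<nu> (monom 1 n)) y = 0}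
    {y. poly (jacobi_multiplier E \<nu> (monom 1 (n + 1))) y = 0}"
proof -
  define e where "e r = Re (E (of_nat r + 1 / 2))" for r
  have M: "jacobi_multiplier E \<nu> = jmul \<nu> e" by (simp add: jacobi_multiplier_eq_jmul e_def[abs_def])
  define p where "p = jacobi_multiplier E \<nu> (monom 1 n)"
  define q where "q = jacobi_multiplier E \<nu> (monom 1 (n + 1))"
  have lin: "jacobi_multiplier E \<nu> (monom \<alpha> (n + 1) + monom \<beta> n) = smult \<alpha> q + smult \<beta> p" for \<alpha> \<beta>
    unfolding p_def q_def M by (simp add: smult_monom flip: jmul_linear)
  have sc: "\<exists>xs e. alternates (poly (smult \<alpha> q + smult \<beta> p)) e xs \<and> n + 1 \<le> length xs"
    if "(\<alpha>, \<beta>) \<noteq> (0, 0)" for \<alpha> \<beta>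
    using multiplier_sign_changes[OF assms(1-8) that] by (simp only: lin)
  have deg: "degree (smult \<alpha> q + smult \<beta> p) \<le> n + 1" for \<alpha> \<beta>
    unfolding lin[symmetric] M
    by (rule jmul_coeff[THEN conjunct1]) (auto intro!: degree_add_le order_trans[OF degree_monom_le])
  have nz: "smult \<alpha> q + smult \<beta> p \<noteq> 0" if ab: "(\<alpha>, \<beta>) \<noteq> (0, 0)" for \<alpha> \<beta>
  proof
    assume z: "smult \<alpha> q + smult \<beta> p = 0"
    obtain xs e where "alternates (poly (smult \<alpha> q + smult \<beta> p)) e xs" "n + 1 \<le> length xs"
      using sc[OF ab] by blast
    then show False unfolding z by (cases xs) (auto simp: alternates_def)
  qed
  have "strictly_interlace {y. poly p y = 0} {y. poly q y = 0}"
  proof (rule interlace_of_wronskian)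
    show "p \<noteq> 0" "q \<noteq> 0" using nz[of 0 1] nz[of 1 0] by auto
    show "{y. poly p y = 0} \<subseteq> {0<..<4}" "{y. poly q y = 0} \<subseteq> {0<..<4}"
      unfolding p_def q_def by (intro zeros_simple_in_real assms)+
    show "poly (pderiv q) y * poly p y - poly q y * poly (pderiv p) y \<noteq> 0" if y: "0 < y" "y < 4" for y
    proof
      assume W: "poly (pderiv q) y * poly p y - poly q y * poly (pderiv p) y = 0"
      \<comment> \<open>A zero of the Wronskian at y would give a combination with a double zero
        there: take \<alpha> = p(y), \<beta> = - q(y) unless both vanish. In that case take \<alpha>
        = p'(y), \<beta> = - q'(y), or \<open>p\<close> itself if p'(y) = 0.\<close>
      have dbl: "poly (smult \<alpha> q + smult \<beta> p) y \<noteq> 0 \<or> poly (pderiv (smult \<alpha> q + smult \<beta> p)) y \<noteq> 0"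
        if "(\<alpha>, \<beta>) \<noteq> (0, 0)" for \<alpha> \<beta>
        using sc[OF that] double_root_alternation[OF _ _ deg y] by blast
      show False
      proof (cases "poly p y = 0 \<and> poly q y = 0")
        case True
        then show False
        proof (cases "poly (pderiv p) y = 0")
          case pd: True
          then show False using dbl[of 0 1] True by simp
        next
          case pd: False
          then show False using dbl[of "poly (pderiv p) y" "- poly (pderiv q) y"] True
            by (simp add: pderiv_diff pderiv_smult mult.commute)
        qed
      next
        case False
        then show False using dbl[of "poly p y" "- poly q y"] W
          by (auto simp: pderiv_add pderiv_smult pderiv_diff algebra_simps)
      qed
    qed
  qed
  then show ?thesis by (simp add: p_def q_def)
qed

end
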